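(* (1) Let $q=(p_+,p_-,s,h)\in\mathcal C_{\mathcal B}$ and assume $W(z,q)$ is strongly transversal. Then: (a) $\ker\Gamma_{0,red}(q)=T_q\mathcal C_{\mathcal B}$; (b) $T_q\mathcal C_{\mathcal B}$ is the set of $(\dot p_+,\dot p_-,\dot s,\dot h)\in\mathbb R^{2N+d}$ for which there exists a solution $(\dot w_+,\dot w_-,\dot s,\dot h)$ of the fully linearized profile problem $$\mathcal L_0(z,q,\partial_z)\dot w=\mathcal L_{0,1}(z,q)(\dot s,\dot h)\ \text{ on }\pm z\ge0,\qquad[\dot w]=0,\ [\dot w_z]=0,\ \dot s+\dot w_+\cdot\underline w_z=0\ \text{ on }z=0$$ with $\lim_{z\to\pm\infty}\dot w_\pm=\dot p_\pm$. (2) The same conclusions hold if one assumes just that $W(z,q)$ is transversal.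
   Context: Setting. $A_0=I$; $A_1,\dots,A_d$ are $C^\infty$ maps from a connected open set $\mathcal U^*\subset\mathbb R^N$ to $\mathbb R^{N\times N}$; $\mathcal U_\pm\subset\mathcal U^*$ are connected open sets such that for $u\in\mathcal U_+\cup\mathcal U_-$, $\xi\in\mathbb R^d\setminus\{0\}$ all eigenvalues of $\sum_{j=1}^d\xi_jA_j(u)$ are real. $\mathcal A_d(u,s,h)=A_d(u)-sA_0(u)-\sum_{j<d}h_jA_j(u)$. $\mathbb E_\pm(M)$ is the sum of (real) generalized eigenspaces for eigenvalues with $\pm\mathrm{Re}\,\mu>0$. Profile equation: $(1+|h|^2)w''=\mathcal A_d(w,s,h)w'$. $[f]=f_+-f_-$ at $z=0$. $\underline q=(\underline p_+,\underline p_-,0,0)$, $\underline p_\pm\in\mathcal U_\pm$, $A_d(\underline p_\pm)$ invertible; $\underline w$ is a nonconstant solution of $\underline w''=A_d(\underline w)\underline w'$ on $\mathbb R$ with limits $\underline p_\pm$. (Number of negative eigenvalues of $A_d(\underline p_+)$)+(number of positive eigenvalues of $A_d(\underline p_-)$)$=N+1-k$, $k\ge0$. Let $G_d=(1+|h|^2)^{-1}\mathcal A_d$; fix smooth families of isomorphisms $\alpha_\pm(p_\pm,s,h;\cdot):\mathbb E_\mp(G_d(\underline p_\pm,0,0))\to\mathbb E_\mp(G_d(p_\pm,s,h))$, $\Pi_\mp$ the spectral projection on $\mathbb E_\mp(G_d(p_\pm,s,h))$. There are (small) $R,r>0$ such that for $(p_\pm,s,h)$ near $(\underline p_\pm,0,0)$,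 $a_\pm\in\mathbb E_\mp(G_d(\underline p_\pm,0,0))$, $|a_\pm|\le r$, the profile equation on $\pm z\ge0$ has a unique solution $\Phi_\pm(z,p_\pm,s,h,a_\pm)$ with limit $p_\pm$, $\Pi_\mp\partial_z\Phi_\pm(0)=\alpha_\pm(p_\pm,s,h;a_\pm)$, $\|\partial_z\Phi_\pm\|_{L^1},\|\partial_z\Phi_\pm\|_{L^\infty}\le R$; $\Phi_\pm$ is $C^\infty$ (same notation for maximal extension in $z$). There are $\underline z\le0$, $\underline a$ with $\underline w(z)=\Phi_\pm(z\pm\underline z,\underline p_\pm,0,0,\underline a_\pm)$ on $\pm z\ge0$. Set $\phi_\pm(z,\cdot)=\Phi_\pm(z\pm\underline z,\cdot)$ and $$\widetilde\Psi(p,s,h,a)=\big(\phi_+-\phi_-,\partial_z\phi_+-\partial_z\phi_-,s+\phi_+\cdot\underline w_z(0)-\underline w(0)\cdot\underline w_z(0)\big)|_{z=0}\in\mathbb R^{2N+1},\quad p=(p_+,p_-),\ a=(a_+,a_-).$$ It is assumed that $\mathrm{rank}\,\nabla_a\widetilde\Psi=N+1-k$ and that $\nabla_{a,p}\widetilde\Psi$ (or $\nabla_{a,p,s}\widetilde\Psi$) has rank $2N+1$ at $(\underline p,0,0,\underline a)$. By the implicit function theorem the zero set of $\widetilde\Psi$ near $(\underline p,0,0,\underline a)$ is then the graph $\{(q,a(q)):q\in\mathcal C_{\mathcal B}\}$ of a smooth function over a $C^\infty$ manifold $\mathcal C_{\mathcal B}$ of dimension $N+d-k$ of points $q=(p,s,h)$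 near $\underline q$, and $W(z,q)=\phi_\pm(z,p_\pm,s,h,a_\pm(q))$ on $\pm z\ge0$ is a viscous profile for $q$. At $(q,a(q))$: $W(z,q)$ is strongly transversal if $\mathrm{rank}\,\nabla_a\widetilde\Psi=N+1-k$ and $\mathrm{rank}\,\nabla_{a,p}\widetilde\Psi=2N+1$; transversal if $\mathrm{rank}\,\nabla_a\widetilde\Psi=N+1-k$ and $\mathrm{rank}\,\nabla_{a,p,s}\widetilde\Psi=2N+1$. Operators ($W=W(z,q)$, $'=\partial_z$): $\mathcal L_0w=-(1+|h|^2)w''+\mathcal A_d(W,s,h)w'+(\partial_w\mathcal A_d(W,s,h)w)W'$ and $\mathcal L_{0,1}(\dot s,\dot h)=\dot sA_0(W)W'+\sum_{j<d}\dot h_jA_j(W)W'+2\sum_{j<d}h_j\dot h_jW''$. Reduced operator. Let $\mathcal R_\pm(z,q,\dot s,\dot h)$ be $C^\infty$ on $\pm z\ge0$, linear in $(\dot s,\dot h)$, exponentially decaying in $z$, with $\mathcal L_0\mathcal R_\pm=\mathcal L_{0,1}(\dot s,\dot h)$ and $\underline w_z(0)\cdot\mathcal R_\pm(0,q,\dot s,\dot h)=-\dot s$ (such functions exist). For $\dot v=(\dot v_+,\dot v_-)$ put $\Gamma_b(q)(\dot v,\dot s,\dot h)=\big([\dot v]+[\mathcal R(\cdot,q,\dot s,\dot h)],[\dot v_z]+[\mathcal R_z(\cdot,q,\dot s,\dot h)],\dot v_+(0)\cdot\underline w_z(0)\big)\in\mathbb R^{2N+1}$. Let $\mathbb F_P(q)=\{\Gamma_b(q)(\dot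 v,0,0):\mathcal L_0\dot v_\pm=0\text{ on }\pm z\ge0,\ \dot v_\pm\to0\text{ as }z\to\pm\infty\}$, choose a complement $\mathbb R^{2N+1}=\mathbb F_{H,\mathcal R}(q)\oplus\mathbb F_P(q)$ and let $\pi_{H,\mathcal R}(q)$ be the projection onto $\mathbb F_{H,\mathcal R}(q)$ along $\mathbb F_P(q)$. Then $\Gamma_{0,red}(q):\mathbb R^{2N+d}\to\mathbb F_{H,\mathcal R}(q)$ is the (well-defined) map $\Gamma_{0,red}(q)(\dot p_+,\dot p_-,\dot s,\dot h)=\pi_{H,\mathcal R}(q)\Gamma_b(q)(\dot v,\dot s,\dot h)$, where $\dot v$ is any solution of $\mathcal L_0\dot v_\pm=0$ on $\pm z\ge0$ with $\lim_{z\to\pm\infty}\dot v_\pm=\dot p_\pm$. *)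

theory Defs
  imports "HOL-Analysis.Analysis"
begin

section \<open>Smooth maps, submanifolds, tangent spaces\<close>

primrec Ck_on :: "nat \<Rightarrow> 'a::real_normed_vector set \<Rightarrow> ('a \<Rightarrow> 'b::real_normed_vector) \<Rightarrow> bool" where
  "Ck_on 0 S f = continuous_on S f"
| "Ck_on (Suc k) S f =
     ((\<forall>x\<in>S. f differentiable (at x)) \<and> (\<forall>v. Ck_on k S (\<lambda>x. frechet_derivative f (at x) v)))"

text \<open>On an arbitrary set, smooth means: locally the restriction of a \<open>C\<^sup>\<infinity>\<close> map defined on an
  open set of the ambient space.  For open sets this is the usual notion; it is also used below on
  half-lines, submanifolds and linear subspaces.\<close>

definition smooth_on :: "'a::real_normed_vector set \<Rightarrow> ('a \<Rightarrow> 'b::real_normed_vector) \<Rightarrow> bool" where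
  "smooth_on S f \<longleftrightarrow>
     (\<forall>x\<in>S. \<exists>U g. open U \<and> x \<in> U \<and> (\<forall>k. Ck_on k U g) \<and> (\<forall>y\<in>U \<inter> S. g y = f y))"

definition smooth_submanifold :: "nat \<Rightarrow> 'a::euclidean_space set \<Rightarrow> bool" where
  "smooth_submanifold m M \<longleftrightarrow>
     (\<forall>x\<in>M. \<exists>(U::'a set) (V::'a set) f g T. open U \<and> open V \<and> x \<in> U \<and> homeomorphism U V f g \<and>
        smooth_on U f \<and> smooth_on V g \<and> subspace T \<and> dim T = m \<and> f ` (M \<inter> U) = V \<inter> T)"

definition tangent_space :: "'a::real_normed_vector set \<Rightarrow> 'a \<Rightarrow> 'a set" where
  "tangent_space M x =
     {v. \<exists>c>0. \<exists>\<gamma>. smooth_on {-c<..<c} \<gamma> \<and> \<gamma> ` {-c<..<c} \<subseteq> M \<and> \<gamma> 0 = x \<and>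
           (\<gamma> has_vector_derivative v) (at (0::real))}"


section \<open>Spectral subspaces\<close>

definition complementary :: "'a::real_vector set \<Rightarrow> 'a set \<Rightarrow> bool" where
  "complementary F P \<longleftrightarrow>
     subspace F \<and> subspace P \<and> F \<inter> P = {0} \<and> {x + y |x y. x \<in> F \<and> y \<in> P} = UNIV"

definition proj_along :: "'a::real_vector set \<Rightarrow> 'a set \<Rightarrow> 'a \<Rightarrow> 'a" where
  "proj_along F P x = (THE u. u \<in> F \<and> x - u \<in> P)"

definition complex_eigenvalue :: "real^'n^'n \<Rightarrow> complex \<Rightarrow> bool" where
  "complex_eigenvalue M \<mu> \<longleftrightarrow>
     (\<exists>x::complex^'n. x \<noteq> 0 \<and> map_matrix complex_of_real M *v x = \<mu> *s x)"

definition gen_eigenspace :: "real^'n^'n \<Rightarrow> real \<Rightarrow> (real^'n) set" where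
  "gen_eigenspace M \<mu> = {v. \<exists>m. (((*v) (M - mat \<mu>)) ^^ m) v = 0}"

text \<open>Sum of the generalized eigenspaces for the eigenvalues in \<open>S\<close>.  Only real eigenvalues
  enter: all matrices to which this is applied have real spectrum, by hyperbolicity.
  Since algebraic multiplicities are dimensions of generalized eigenspaces, the dimension of the
  spectral subspace is the number of eigenvalues in \<open>S\<close>.\<close>

definition spectral_space :: "real^'n^'n \<Rightarrow> real set \<Rightarrow> (real^'n) set" where
  "spectral_space M S = span (\<Union>\<mu>\<in>S. gen_eigenspace M \<mu>)"

definition spectral_proj :: "real^'n^'n \<Rightarrow> real set \<Rightarrow> real^'n \<Rightarrow> real^'n" where
  "spectral_proj M S = proj_along (spectral_space M S) (spectral_space M (- S))"


section \<open>The two sides of the shock\<close>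

datatype side = Pl | Mi

fun sg :: "side \<Rightarrow> real" where
  "sg Pl = 1"
| "sg Mi = -1"

fun far :: "side \<Rightarrow> real filter" where
  "far Pl = at_top"
| "far Mi = at_bot"

fun at_side :: "side \<Rightarrow> 'a \<times> 'a \<Rightarrow> 'a" where
  "at_side Pl x = fst x"
| "at_side Mi x = snd x"

definition half :: "side \<Rightarrow> real set" where
  "half e = {z. 0 \<le> sg e * z}"

text \<open>\<open>\<real>\<^sub>-\<close> on the plus side, \<open>\<real>\<^sub>+\<close> on the minus side: the eigenvalues of modes decaying as
  \<open>z \<rightarrow> \<plusminus>\<infinity>\<close>.\<close>

definition decay_rates :: "side \<Rightarrow> real set" where
  "decay_rates e = {\<mu>. sg e * \<mu> < 0}"

abbreviation deriv_in :: "real set \<Rightarrow> (real \<Rightarrow> 'a::real_normed_vector) \<Rightarrow> real \<Rightarrow> 'a" where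
  "deriv_in J f \<equiv> (\<lambda>z. vector_derivative f (at z within J))"

definition twice_differentiable_on :: "real set \<Rightarrow> (real \<Rightarrow> 'a::real_normed_vector) \<Rightarrow> bool" where
  "twice_differentiable_on J f \<longleftrightarrow> f differentiable_on J \<and> deriv_in J f differentiable_on J"


section \<open>Profile equation\<close>

text \<open>The finite type \<open>'d\<close> stands for the directions \<open>{1, \<dots>, d}\<close> and \<open>dd\<close> for the last one, so
  that \<open>A dd\<close> is \<open>A\<^sub>d\<close> and \<open>A j\<close> with \<open>j \<noteq> dd\<close> are the tangential matrices; \<open>A\<^sub>0 = I\<close>.  The
  parameters \<open>(s, h) \<in> \<real> \<times> \<real>\<^bsup>d-1\<^esup>\<close> are stored in one vector \<open>\<sigma> \<in> \<real>\<^bsup>d\<^esup>\<close>: the slot \<open>dd\<close> holds \<open>s\<close>,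
  the slots \<open>j \<noteq> dd\<close> hold \<open>h\<^sub>j\<close>. (A separate index type for \<open>h\<close> would exclude \<open>d = 1\<close>.)
  Points \<open>q = (p\<^sub>+, p\<^sub>-, s, h)\<close> and tangent vectors to them are of type \<open>state\<close>; one side of the
  shock only sees \<open>(p\<^sub>\<plusminus>, \<sigma>)\<close>, of type \<open>side_state\<close>.\<close>

type_synonym ('n, 'd) state = "(real^'n) \<times> (real^'n) \<times> (real^'d)"
type_synonym ('n, 'd) side_state = "(real^'n) \<times> (real^'d)"
type_synonym ('n, 'd) coeffs = "'d \<Rightarrow> real^'n \<Rightarrow> real^'n^'n"

fun restrict_side :: "side \<Rightarrow> ('n::finite, 'd::finite) state \<Rightarrow> ('n, 'd) side_state" where
  "restrict_side e (pp, pm, \<sigma>) = (at_side e (pp, pm), \<sigma>)"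

definition hsq :: "'d::finite \<Rightarrow> real^'d \<Rightarrow> real" where
  "hsq dd \<sigma> = (\<Sum>j\<in>UNIV - {dd}. (\<sigma> $ j)\<^sup>2)"

definition Acal :: "('n::finite, 'd::finite) coeffs \<Rightarrow> 'd \<Rightarrow> real^'n \<Rightarrow> real^'d \<Rightarrow> real^'n^'n" where
  "Acal A dd u \<sigma> = A dd u - (\<sigma> $ dd) *\<^sub>R mat 1 - (\<Sum>j\<in>UNIV - {dd}. (\<sigma> $ j) *\<^sub>R A j u)"

definition Gd :: "('n::finite, 'd::finite) coeffs \<Rightarrow> 'd \<Rightarrow> ('n, 'd) side_state \<Rightarrow> real^'n^'n" where
  "Gd A dd x = (1 / (1 + hsq dd (snd x))) *\<^sub>R Acal A dd (fst x) (snd x)"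

text \<open>\<open>\<E>\<^sub>\<mp>(G\<^sub>d(p\<^sub>\<plusminus>, s, h))\<close> and the spectral projection onto it.\<close>

definition decay_space ::
  "('n::finite, 'd::finite) coeffs \<Rightarrow> 'd \<Rightarrow> side \<Rightarrow> ('n, 'd) side_state \<Rightarrow> (real^'n) set" where
  "decay_space A dd e x = spectral_space (Gd A dd x) (decay_rates e)"

definition decay_proj ::
  "('n::finite, 'd::finite) coeffs \<Rightarrow> 'd \<Rightarrow> side \<Rightarrow> ('n, 'd) side_state \<Rightarrow> real^'n \<Rightarrow> real^'n" where
  "decay_proj A dd e x = spectral_proj (Gd A dd x) (decay_rates e)"

definition profile_on ::
  "('n::finite, 'd::finite) coeffs \<Rightarrow> 'd \<Rightarrow> (real^'n) set \<Rightarrow> real^'d \<Rightarrow> real set \<Rightarrow> (real \<Rightarrow> real^'n) \<Rightarrow> bool"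
where
  "profile_on A dd Us \<sigma> J w \<longleftrightarrow>
     twice_differentiable_on J w \<and>
     (\<forall>z\<in>J. w z \<in> Us \<and>
        (1 + hsq dd \<sigma>) *\<^sub>R deriv_in J (deriv_in J w) z = Acal A dd (w z) \<sigma> *v deriv_in J w z)"

text \<open>Domain of the maximal extension of a solution \<open>u\<close> given on the half-line.\<close>

definition max_dom ::
  "('n::finite, 'd::finite) coeffs \<Rightarrow> 'd \<Rightarrow> (real^'n) set \<Rightarrow> real^'d \<Rightarrow> side \<Rightarrow> (real \<Rightarrow> real^'n) \<Rightarrow> real set"
where
  "max_dom A dd Us \<sigma> e u =
     \<Union>{J. open J \<and> is_interval J \<and> half e \<subseteq> J \<and>
          (\<exists>w. profile_on A dd Us \<sigma> J w \<and> (\<forall>z\<in>half e. w z = u z))}"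


section \<open>Hyperbolic system with a reference profile\<close>

text \<open>\<open>pb\<close> and \<open>wb\<close> are the underlined end states and profile; \<open>alpha e\<close> is the family of
  isomorphisms \<open>\<alpha>\<^sub>\<plusminus>\<close>, defined for side states in the neighbourhood \<open>Om e\<close> of \<open>(pb e, 0)\<close>.\<close>

locale viscous_shock =
  fixes A :: "('n::finite, 'd::finite) coeffs" and dd :: 'd
    and Us :: "(real^'n) set" and U :: "side \<Rightarrow> (real^'n) set"
    and pb :: "side \<Rightarrow> real^'n" and wb :: "real \<Rightarrow> real^'n" and k :: nat
    and Om :: "side \<Rightarrow> ('n, 'd) side_state set"
    and alpha :: "side \<Rightarrow> ('n, 'd) side_state \<Rightarrow> real^'n \<Rightarrow> real^'n"
  assumes Us: "open Us" "connected Us"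
    and A_smooth: "smooth_on Us (A j)"
    and U: "open (U e)" "connected (U e)" "U e \<subseteq> Us"
    and hyperbolic: "\<lbrakk>u \<in> U Pl \<union> U Mi; (\<xi>::real^'d) \<noteq> 0;
           complex_eigenvalue (\<Sum>j\<in>UNIV. (\<xi> $ j) *\<^sub>R A j u) \<mu>\<rbrakk> \<Longrightarrow> \<mu> \<in> \<real>"
    and pb: "pb e \<in> U e" "invertible (A dd (pb e))"
    and wb_profile: "profile_on A dd Us 0 UNIV wb"
    and wb_nonconst: "\<not> wb constant_on UNIV"
    and wb_limits: "(wb \<longlongrightarrow> pb e) (far e)"
    and index: "dim (spectral_space (A dd (pb Pl)) {..<0}) +
                dim (spectral_space (A dd (pb Mi)) {0<..}) + k = CARD('n) + 1"
    and Om: "open (Om e)" "(pb e, 0) \<in> Om e" "fst ` Om e \<subseteq> U e"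
    and alpha_linear: "x \<in> Om e \<Longrightarrow> \<exists>L. linear L \<and> (\<forall>a\<in>decay_space A dd e (pb e, 0). alpha e x a = L a)"
    and alpha_bij: "x \<in> Om e \<Longrightarrow> bij_betw (alpha e x) (decay_space A dd e (pb e, 0)) (decay_space A dd e x)"
    and alpha_smooth: "smooth_on (Om e \<times> decay_space A dd e (pb e, 0)) (\<lambda>(x, a). alpha e x a)"
begin

definition half_sol ::
  "real \<Rightarrow> side \<Rightarrow> ('n, 'd) side_state \<Rightarrow> real^'n \<Rightarrow> (real \<Rightarrow> real^'n) \<Rightarrow> bool" where
  "half_sol R e x a w \<longleftrightarrow>
     profile_on A dd Us (snd x) (half e) w \<and> (w \<longlongrightarrow> fst x) (far e) \<and>
     decay_proj A dd e x (deriv_in (half e) w 0) = alpha e x a \<and>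
     deriv_in (half e) w absolutely_integrable_on half e \<and>
     integral (half e) (\<lambda>z. norm (deriv_in (half e) w z)) \<le> R \<and>
     (\<forall>z\<in>half e. norm (deriv_in (half e) w z) \<le> R)"

definition qb :: "('n, 'd) state" where
  "qb = (pb Pl, pb Mi, 0)"

definition amp_space :: "((real^'n) \<times> (real^'n)) set" where
  "amp_space = decay_space A dd Pl (pb Pl, 0) \<times> decay_space A dd Mi (pb Mi, 0)"

definition wb_z0 :: "real^'n" where
  "wb_z0 = vector_derivative wb (at 0)"

end


section \<open>Half-line solutions and the connection map\<close>

text \<open>\<open>Phi e z x a\<close> is \<open>\<Phi>\<^sub>\<plusminus>(z, p\<^sub>\<plusminus>, s, h, a\<^sub>\<plusminus>)\<close> with \<open>x = (p\<^sub>\<plusminus>, (s, h))\<close>, for \<open>x\<close> in the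
  neighbourhood \<open>om e\<close> of \<open>(pb e, 0)\<close>.  The locale does not say that \<open>R\<close>, \<open>r\<close> and \<open>om e\<close> are
  small; a theorem must require them to be below a threshold that depends only on the data of
  \<open>viscous_shock\<close>.\<close>

locale half_line_solutions = viscous_shock A dd Us U pb wb k Om alpha
  for A :: "('n::finite, 'd::finite) coeffs" and dd Us U pb wb k Om alpha +
  fixes R r :: real and om :: "side \<Rightarrow> ('n, 'd) side_state set"
    and Phi :: "side \<Rightarrow> real \<Rightarrow> ('n, 'd) side_state \<Rightarrow> real^'n \<Rightarrow> real^'n"
    and zb :: real and ab :: "(real^'n) \<times> (real^'n)"
  assumes R_r: "R > 0" "r > 0"
    and om: "open (om e)" "(pb e, 0) \<in> om e" "om e \<subseteq> Om e"
    and Phi_sol: "\<lbrakk>x \<in> om e; a \<in> decay_space A dd e (pb e, 0); norm a \<le> r\<rbrakk> \<Longrightarrow>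
           half_sol R e x a (\<lambda>z. Phi e z x a)"
    and Phi_unique: "\<lbrakk>x \<in> om e; a \<in> decay_space A dd e (pb e, 0); norm a \<le> r;
           half_sol R e x a w; z \<in> half e\<rbrakk> \<Longrightarrow> w z = Phi e z x a"
    and Phi_extension: "\<lbrakk>x \<in> om e; a \<in> decay_space A dd e (pb e, 0); norm a \<le> r\<rbrakk> \<Longrightarrow>
           profile_on A dd Us (snd x) (max_dom A dd Us (snd x) e (\<lambda>z. Phi e z x a)) (\<lambda>z. Phi e z x a)"
    and Phi_smooth: "smooth_on
           {(z, x, a). x \<in> om e \<and> a \<in> decay_space A dd e (pb e, 0) \<and> norm a \<le> r \<and>
              z \<in> half e \<union> max_dom A dd Us (snd x) e (\<lambda>z. Phi e z x a)}
           (\<lambda>(z, x, a). Phi e z x a)"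
    and zb: "zb \<le> 0"
    and ab: "ab \<in> amp_space" "norm (at_side e ab) \<le> r"
    and wb_Phi: "z \<in> half e \<Longrightarrow> wb z = Phi e (z + sg e * zb) (pb e, 0) (at_side e ab)"
begin

definition phi :: "side \<Rightarrow> real \<Rightarrow> ('n, 'd) side_state \<Rightarrow> real^'n \<Rightarrow> real^'n" where
  "phi e z x a = Phi e (z + sg e * zb) x a"

text \<open>The points at which the connection map is defined, with \<open>a\<close> in the interior of its range.\<close>

definition Psi_dom :: "(('n, 'd) state \<times> (real^'n) \<times> (real^'n)) set" where
  "Psi_dom = {(q, a). a \<in> amp_space \<and>
     (\<forall>e. restrict_side e q \<in> om e \<and> norm (at_side e a) < r \<and>
        sg e * zb \<in> max_dom A dd Us (snd (restrict_side e q)) e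
          (\<lambda>z. Phi e z (restrict_side e q) (at_side e a)))}"

definition Psi :: "('n, 'd) state \<times> (real^'n) \<times> (real^'n) \<Rightarrow> (real^'n) \<times> (real^'n) \<times> real" where
  "Psi = (\<lambda>((pp, pm, \<sigma>), (ap, am)).
     (phi Pl 0 (pp, \<sigma>) ap - phi Mi 0 (pm, \<sigma>) am,
      vector_derivative (\<lambda>z. phi Pl z (pp, \<sigma>) ap) (at 0)
        - vector_derivative (\<lambda>z. phi Mi z (pm, \<sigma>) am) (at 0),
      \<sigma> $ dd + phi Pl 0 (pp, \<sigma>) ap \<bullet> wb_z0 - wb 0 \<bullet> wb_z0))"

text \<open>Rank of the partial gradient of \<open>Psi\<close> at \<open>(q, a)\<close> along a space \<open>V\<close> of directions.  The
  variable \<open>a\<close> only ranges over \<open>amp_space\<close>, whence the derivative within a subspace; its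
  values are determined on the directions \<open>V \<subseteq> UNIV \<times> amp_space\<close>.\<close>

definition rank_along ::
  "(('n, 'd) state \<times> (real^'n) \<times> (real^'n)) set \<Rightarrow> ('n, 'd) state \<times> (real^'n) \<times> (real^'n) \<Rightarrow> nat" where
  "rank_along V y = dim (frechet_derivative Psi (at y within UNIV \<times> amp_space) ` V)"

definition dirs_a :: "(('n, 'd) state \<times> (real^'n) \<times> (real^'n)) set" where
  "dirs_a = {(0, a) |a. a \<in> amp_space}"

definition dirs_ap :: "(('n, 'd) state \<times> (real^'n) \<times> (real^'n)) set" where
  "dirs_ap = {((pp, pm, 0), a) |pp pm a. a \<in> amp_space}"

definition dirs_aps :: "(('n, 'd) state \<times> (real^'n) \<times> (real^'n)) set" where
  "dirs_aps = {((pp, pm, \<sigma>), a) |pp pm \<sigma> a. (\<forall>j. j \<noteq> dd \<longrightarrow> \<sigma> $ j = 0) \<and> a \<in> amp_space}"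

definition strongly_transversal_at :: "('n, 'd) state \<times> (real^'n) \<times> (real^'n) \<Rightarrow> bool" where
  "strongly_transversal_at y \<longleftrightarrow>
     rank_along dirs_a y + k = CARD('n) + 1 \<and> rank_along dirs_ap y = 2 * CARD('n) + 1"

definition transversal_at :: "('n, 'd) state \<times> (real^'n) \<times> (real^'n) \<Rightarrow> bool" where
  "transversal_at y \<longleftrightarrow>
     rank_along dirs_a y + k = CARD('n) + 1 \<and> rank_along dirs_aps y = 2 * CARD('n) + 1"

end


section \<open>The manifold of profiles and the linearized problem\<close>

text \<open>\<open>C\<close> is the manifold of admissible \<open>q\<close> and \<open>af\<close> the implicit function.  The subtraction in its
  dimension does not truncate: \<open>k \<le> N + 1 \<le> N + d\<close> by \<open>index\<close>.\<close>

locale profile_manifold =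
  half_line_solutions A dd Us U pb wb k Om alpha R r om Phi zb ab
  for A :: "('n::finite, 'd::finite) coeffs" and dd Us U pb wb k Om alpha R r om Phi zb ab +
  fixes C :: "('n, 'd) state set" and af :: "('n, 'd) state \<Rightarrow> (real^'n) \<times> (real^'n)"
  assumes base_transversal: "strongly_transversal_at (qb, ab) \<or> transversal_at (qb, ab)"
    and C_manifold: "smooth_submanifold (CARD('n) + CARD('d) - k) C"
    and af_smooth: "smooth_on C af"
    and zero_set: "\<exists>V. open V \<and> (qb, ab) \<in> V \<and> V \<inter> (UNIV \<times> amp_space) \<subseteq> Psi_dom \<and>
           {y \<in> V \<inter> (UNIV \<times> amp_space). Psi y = 0} = (\<lambda>q. (q, af q)) ` C"
begin

definition W :: "('n, 'd) state \<Rightarrow> side \<Rightarrow> real \<Rightarrow> real^'n" where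
  "W q e z = phi e z (restrict_side e q) (at_side e (af q))"

definition strongly_transversal :: "('n, 'd) state \<Rightarrow> bool" where
  "strongly_transversal q \<longleftrightarrow> strongly_transversal_at (q, af q)"

definition transversal :: "('n, 'd) state \<Rightarrow> bool" where
  "transversal q \<longleftrightarrow> transversal_at (q, af q)"

definition L0 :: "('n, 'd) state \<Rightarrow> side \<Rightarrow> (real \<Rightarrow> real^'n) \<Rightarrow> real \<Rightarrow> real^'n" where
  "L0 q e w z =
     (let \<sigma> = snd (snd q); D = deriv_in (half e) in
        - ((1 + hsq dd \<sigma>) *\<^sub>R D (D w) z) + Acal A dd (W q e z) \<sigma> *v D w z
        + frechet_derivative (\<lambda>u. Acal A dd u \<sigma>) (at (W q e z)) (w z) *v D (W q e) z)"

definition L01 :: "('n, 'd) state \<Rightarrow> side \<Rightarrow> real^'d \<Rightarrow> real \<Rightarrow> real^'n" where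
  "L01 q e \<tau> z =
     (let \<sigma> = snd (snd q); D = deriv_in (half e) in
        (\<tau> $ dd) *\<^sub>R D (W q e) z
        + (\<Sum>j\<in>UNIV - {dd}. (\<tau> $ j) *\<^sub>R (A j (W q e z) *v D (W q e) z))
        + (2 * (\<Sum>j\<in>UNIV - {dd}. \<sigma> $ j * \<tau> $ j)) *\<^sub>R D (D (W q e)) z)"

definition jump :: "(side \<Rightarrow> real \<Rightarrow> real^'n) \<Rightarrow> real^'n" where
  "jump f = f Pl 0 - f Mi 0"

definition jump_z :: "(side \<Rightarrow> real \<Rightarrow> real^'n) \<Rightarrow> real^'n" where
  "jump_z f = deriv_in (half Pl) (f Pl) 0 - deriv_in (half Mi) (f Mi) 0"

text \<open>Solutions \<open>(w\<^sub>+, w\<^sub>-, \<tau>)\<close> of \<open>\<L>\<^sub>0 w = \<L>\<^sub>0\<^sub>,\<^sub>1 \<tau>\<close> on both half-lines, with end states \<open>dp\<close>.\<close>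

definition linearized_sol ::
  "('n, 'd) state \<Rightarrow> (real^'n) \<times> (real^'n) \<Rightarrow> real^'d \<Rightarrow> (side \<Rightarrow> real \<Rightarrow> real^'n) \<Rightarrow> bool" where
  "linearized_sol q dp \<tau> w \<longleftrightarrow>
     (\<forall>e. twice_differentiable_on (half e) (w e) \<and>
          (\<forall>z\<in>half e. L0 q e (w e) z = L01 q e \<tau> z) \<and>
          (w e \<longlongrightarrow> at_side e dp) (far e))"

definition homogeneous_sol ::
  "('n, 'd) state \<Rightarrow> (real^'n) \<times> (real^'n) \<Rightarrow> (side \<Rightarrow> real \<Rightarrow> real^'n) \<Rightarrow> bool" where
  "homogeneous_sol q dp v \<longleftrightarrow>
     (\<forall>e. twice_differentiable_on (half e) (v e) \<and>
          (\<forall>z\<in>half e. L0 q e (v e) z = 0) \<and>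
          (v e \<longlongrightarrow> at_side e dp) (far e))"

definition linearized_profile_states :: "('n, 'd) state \<Rightarrow> ('n, 'd) state set" where
  "linearized_profile_states q =
     {(pp, pm, \<tau>). \<exists>w. linearized_sol q (pp, pm) \<tau> w \<and>
        jump w = 0 \<and> jump_z w = 0 \<and> \<tau> $ dd + w Pl 0 \<bullet> wb_z0 = 0}"

definition corrector :: "(side \<Rightarrow> real \<Rightarrow> ('n, 'd) state \<Rightarrow> real^'d \<Rightarrow> real^'n) \<Rightarrow> bool" where
  "corrector \<R> \<longleftrightarrow>
     (\<forall>e. smooth_on (half e \<times> C \<times> UNIV) (\<lambda>(z, q, \<tau>). \<R> e z q \<tau>) \<and>
        (\<forall>q\<in>C.
           (\<forall>z\<in>half e. linear (\<R> e z q)) \<and>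
           (\<exists>K \<delta>. \<delta> > 0 \<and> (\<forall>z\<in>half e. \<forall>\<tau>. norm (\<R> e z q \<tau>) \<le> K * exp (- \<delta> * \<bar>z\<bar>) * norm \<tau>)) \<and>
           (\<forall>\<tau>. (\<forall>z\<in>half e. L0 q e (\<lambda>z. \<R> e z q \<tau>) z = L01 q e \<tau> z) \<and>
                wb_z0 \<bullet> \<R> e 0 q \<tau> = - (\<tau> $ dd))))"

definition Gamma_b ::
  "(side \<Rightarrow> real \<Rightarrow> ('n, 'd) state \<Rightarrow> real^'d \<Rightarrow> real^'n) \<Rightarrow> ('n, 'd) state \<Rightarrow>
   (side \<Rightarrow> real \<Rightarrow> real^'n) \<Rightarrow> real^'d \<Rightarrow> (real^'n) \<times> (real^'n) \<times> real" where
  "Gamma_b \<R> q v \<tau> =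
     (jump v + jump (\<lambda>e z. \<R> e z q \<tau>), jump_z v + jump_z (\<lambda>e z. \<R> e z q \<tau>), v Pl 0 \<bullet> wb_z0)"

definition F_P ::
  "(side \<Rightarrow> real \<Rightarrow> ('n, 'd) state \<Rightarrow> real^'d \<Rightarrow> real^'n) \<Rightarrow> ('n, 'd) state \<Rightarrow>
   ((real^'n) \<times> (real^'n) \<times> real) set" where
  "F_P \<R> q = {Gamma_b \<R> q v 0 |v. homogeneous_sol q (0, 0) v}"

text \<open>\<open>F\<^sub>H\<close> is the chosen complement of \<open>F_P \<R> q\<close>.  The value does not depend on the solution
  \<open>v\<close> that is selected, since two of them differ by a solution tending to 0.\<close>

definition Gamma_red ::
  "(side \<Rightarrow> real \<Rightarrow> ('n, 'd) state \<Rightarrow> real^'d \<Rightarrow> real^'n) \<Rightarrow> ((real^'n) \<times> (real^'n) \<times> real) set \<Rightarrow>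
   ('n, 'd) state \<Rightarrow> ('n, 'd) state \<Rightarrow> (real^'n) \<times> (real^'n) \<times> real" where
  "Gamma_red \<R> F\<^sub>H q = (\<lambda>(pp, pm, \<tau>).
     proj_along F\<^sub>H (F_P \<R> q) (Gamma_b \<R> q (SOME v. homogeneous_sol q (pp, pm) v) \<tau>))"

end

end

theory Submission
  imports Defs "HOL-Computational_Algebra.Fundamental_Theorem_Algebra"
begin

text \<open>Why the theorem is true.  The map \<open>Psi\<close> vanishes exactly on the graph of \<open>af\<close> over the manifold \<open>C\<close>.
Differentiating \<open>Psi (q, af q) = 0\<close> along curves in \<open>C\<close> gives
\<open>tangent_space C q \<subseteq> {dq. \<exists>da. DPsi (dq, da) = 0}\<close>.  At a transversal point the rank conditions and
the count of eigenvalues in \<open>index\<close> show that the right-hand side has dimension at most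
\<open>N + d - k = dim C\<close>, so that the inclusion is an equality (\<open>tangent_space_eq\<close>).  Strong
transversality is a special case, because fewer directions already give full rank.

It remains to read \<open>DPsi (dq, da) = 0\<close> as the linearized profile problem.  The components of
\<open>DPsi (dq, da)\<close> are the jumps at \<open>z = 0\<close> of the variations of the half-line profiles
\<open>Phi e\<close> in the direction \<open>(dq, da)\<close>, and these variations solve the linearized profile
equation (\<open>variation\<close>).  The substance is in two facts about infinity, where the smoothness of \<open>Phi\<close>,
a local statement, gives nothing.

First, the variation in the direction \<open>(dp, dh, da)\<close> tends to \<open>dp\<close> (\<open>variation_limit\<close>).  Near the
end state the derivative of a profile solves \<open>y' = G y\<close> with \<open>G\<close> close to a hyperbolic matrix, for
which there is a quadratic form \<open>B\<close> that increases along all solutions (\<open>lyapunov_form\<close>).  A solution that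
stays bounded must keep \<open>B \<le> 0\<close>, and this yields an exponentially weighted \<open>L\<^sup>2\<close> bound on the
derivative (\<open>weighted_energy_estimate\<close>).  Applied to difference quotients in the
parameters, whose limit at infinity is known exactly, the bound is uniform (\<open>coupled_estimate\<close>) and
survives the passage to the derivative.  Here the smallness of \<open>R\<close> and of the neighbourhoods \<open>om e\<close> enters.

Secondly, every solution of the homogeneous equation that tends to 0 is a variation in an amplitude
direction \<open>(0, da)\<close> (\<open>decaying_modes_are_variations\<close>).  The same estimate shows that the initial
velocities of such solutions form a space on which \<open>B\<close> is negative definite, so its dimension is at most that of
the space of amplitudes; on the other hand \<open>da \<mapsto> DPsi (0, da)\<close> is injective by the rank
condition on \<open>\<nabla>\<^sub>a Psi\<close>, so the variations fill that space.

Together these two facts give part (b).  For part (a), solutions of the homogeneous equation with any prescribed limits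
exist as variations in the directions \<open>(dp, 0, 0)\<close>; adding the corrector turns the vanishing of
\<open>Gamma_red\<close> into the linearized profile problem (\<open>Gamma_red_kernel\<close>).\<close>

section \<open>Lyapunov forms of matrices with real nonzero spectrum\<close>

lemma linear_relation_of_sequence:
  fixes x :: "nat \<Rightarrow> 'a::euclidean_space"
  obtains c :: "nat \<Rightarrow> real" and n where "c n \<noteq> 0" "(\<Sum>i\<le>n. c i *\<^sub>R x i) = 0"
proof -
  let ?n = "DIM('a)"
  have "\<exists>c. (\<exists>i\<le>?n. c i \<noteq> 0) \<and> (\<Sum>i\<le>?n. c i *\<^sub>R x i) = 0"
  proof (cases "inj_on x {..?n}")
    case True
    then have "dependent (x ` {..?n})"
      by (intro dependent_biggerset) (auto simp: card_image)
    then obtain u where u: "\<exists>v\<in>x ` {..?n}. u v \<noteq> 0" "(\<Sum>v\<in>x ` {..?n}. u v *\<^sub>R v) = 0"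
      by (auto simp: real_vector.dependent_finite)
    then show ?thesis
      using True by (intro exI[of _ "u \<circ> x"]) (auto simp: sum.reindex o_def)
  next
    case False
    then obtain i j where ij: "i \<le> ?n" "j \<le> ?n" "i \<noteq> j" "x i = x j"
      by (auto simp: inj_on_def)
    let ?c = "\<lambda>k. (if k = i then 1 else 0) - (if k = j then 1 else (0::real))"
    have "(\<Sum>k\<le>?n. ?c k *\<^sub>R x k) = 0"
      using ij by (simp add: scaleR_diff_left sum_subtractf if_distrib[of "\<lambda>c. c *\<^sub>R _"] cong: if_cong)
    then show ?thesis
      using ij by (intro exI[of _ ?c]) auto
  qed
  then obtain c where c: "\<exists>i\<le>?n. c i \<noteq> 0" "(\<Sum>i\<le>?n. c i *\<^sub>R x i) = 0"
    by blast
  define n where "n = Max {i. i \<le> ?n \<and> c i \<noteq> 0}"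
  have fin: "finite {i. i \<le> ?n \<and> c i \<noteq> 0}" by simp
  have n: "n \<le> ?n" "c n \<noteq> 0"
    using Max_in[OF fin] c(1) unfolding n_def by blast+
  have z: "c i = 0" if "i \<le> ?n" "n < i" for i
    using Max_ge[OF fin, of i] that unfolding n_def by fastforce
  have "(\<Sum>i\<le>n. c i *\<^sub>R x i) = (\<Sum>i\<le>?n. c i *\<^sub>R x i)"
    using n z by (intro sum.mono_neutral_left) auto
  then show ?thesis using that[of c n] n c by simp
qed

definition poly_action :: "complex^'n^'n \<Rightarrow> complex poly \<Rightarrow> complex^'n \<Rightarrow> complex^'n" where
  "poly_action M p v = (\<Sum>i\<le>degree p. coeff p i *s (((*v) M) ^^ i) v)"

lemma poly_action_upto:
  "degree p \<le> n \<Longrightarrow> poly_action M p v = (\<Sum>i\<le>n. coeff p i *s (((*v) M) ^^ i) v)"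
  unfolding poly_action_def
  by (intro sum.mono_neutral_left) (auto simp: coeff_eq_0)

lemma mat_vector_mult: "mat z *v v = z *s (v :: 'a::comm_ring_1^'n)"
  by (simp add: mat_def matrix_vector_mult_def vec_eq_iff if_distrib[of "\<lambda>c. c * _"] cong: if_cong)

lemma poly_action_linear_factor:
  "poly_action M ([:- z, 1:] * p) v = (M - mat z) *v poly_action M p v"
proof -
  let ?n = "degree p"
  have d: "degree ([:- z, 1:] * p) \<le> Suc ?n"
    by (rule order_trans[OF degree_mult_le]) simp
  have c: "coeff ([:- z, 1:] * p) (Suc i) = coeff p i - z * coeff p (Suc i)" for i
    by simp
  have "poly_action M ([:- z, 1:] * p) v
      = - (z * coeff p 0) *s v + (\<Sum>i\<le>?n. (coeff p i - z * coeff p (Suc i)) *s (((*v) M) ^^ Suc i) v)"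
    unfolding poly_action_upto[OF d] by (subst sum.atMost_Suc_shift) (simp add: c del: funpow.simps(2))
  also have "\<dots> = (\<Sum>i\<le>?n. coeff p i *s (((*v) M) ^^ Suc i) v)
       - (z * coeff p 0) *s v - (\<Sum>i\<le>?n. (z * coeff p (Suc i)) *s (((*v) M) ^^ Suc i) v)"
    by (simp add: vector_sub_rdistrib sum_subtractf del: funpow.simps(2))
  also have "\<dots> = (\<Sum>i\<le>?n. coeff p i *s (((*v) M) ^^ Suc i) v)
       - (\<Sum>i\<le>Suc ?n. (z * coeff p i) *s (((*v) M) ^^ i) v)"
    using sum.atMost_Suc_shift[of "\<lambda>i. (z * coeff p i) *s (((*v) M) ^^ i) v" ?n]
    by (simp del: funpow.simps(2) sum.atMost_Suc)
  also have "(\<Sum>i\<le>Suc ?n. (z * coeff p i) *s (((*v) M) ^^ i) v) = z *s poly_action M p v"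
    by (subst poly_action_upto[of p "Suc ?n"]) (auto simp: vec.scale_sum_right)
  also have "(\<Sum>i\<le>?n. coeff p i *s (((*v) M) ^^ Suc i) v) = M *v poly_action M p v"
    unfolding poly_action_def by (simp add: vec.sum vec.scale)
  finally show ?thesis
    by (simp add: matrix_vector_mult_diff_rdistrib mat_vector_mult)
qed

abbreviation shift_prod :: "'a::comm_ring_1^'n^'n \<Rightarrow> 'a list \<Rightarrow> 'a^'n \<Rightarrow> 'a^'n" where
  "shift_prod M zs v \<equiv> foldr (\<lambda>z. (*v) (M - mat z)) zs v"

lemma shift_apply: "(M - mat z) *v v = M *v v - z *s (v :: 'a::comm_ring_1^'n)"
  by (simp add: matrix_vector_mult_diff_rdistrib mat_vector_mult)

lemma mult_smult: "M *v (c *s v) = c *s (M *v (v :: 'a::comm_ring_1^'n))"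
  by (simp add: matrix_vector_mult_def vec_eq_iff sum_distrib_left mult.left_commute)

lemma shift_commute:
  fixes M :: "'a::comm_ring_1^'n^'n"
  shows "(M - mat z) *v ((M - mat w) *v v) = (M - mat w) *v ((M - mat z) *v v)"
  unfolding shift_apply
  by (simp add: matrix_vector_mult_diff_distrib mult_smult
      vector_sub_rdistrib vector_ssub_ldistrib vector_smult_assoc algebra_simps)

lemma shift_shift_prod_commute:
  fixes M :: "'a::comm_ring_1^'n^'n"
  shows "(M - mat z) *v (shift_prod M zs v) = shift_prod M zs ((M - mat z) *v v)"
  by (induction zs) (simp_all add: shift_commute[of M z])

text \<open>The powers of \<open>M\<close> are linearly dependent, and the polynomial that expresses this splits over
  \<open>\<complex>\<close>.\<close>

lemma complex_annihilating_list:
  fixes M :: "complex^'n^'n"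
  obtains zs where "\<And>v. shift_prod M zs v = 0"
proof -
  obtain c :: "nat \<Rightarrow> real" and n where cn: "c n \<noteq> 0"
      and c: "(\<Sum>i\<le>n. c i *\<^sub>R (((**) M) ^^ i) (mat 1)) = 0"
    using linear_relation_of_sequence[of "\<lambda>i. (((**) M) ^^ i) (mat 1)"] by blast
  define p where "p = (\<Sum>i\<le>n. monom (complex_of_real (c i)) i)"
  have coeff: "coeff p i = (if i \<le> n then complex_of_real (c i) else 0)" for i
    by (simp add: p_def coeff_sum)
  have p0: "p \<noteq> 0"
    using cn coeff[of n] by auto
  have deg: "degree p \<le> n"
    by (rule degree_le) (simp add: coeff)
  have pow: "((((**) M) ^^ i) (mat 1)) *v v = (((*v) M) ^^ i) v" for i v
    by (induction i) (simp_all flip: matrix_vector_mul_assoc)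
  have act: "poly_action M p v = 0" for v
  proof -
    have "0 = (\<Sum>i\<le>n. c i *\<^sub>R (((**) M) ^^ i) (mat 1)) *v v"
      using c by simp
    also have "\<dots> = (\<Sum>i\<le>n. (c i *\<^sub>R ((((**) M) ^^ i) (mat 1))) *v v)"
      by (induction n) (simp_all add: matrix_vector_mult_add_rdistrib)
    also have "\<dots> = (\<Sum>i\<le>n. c i *\<^sub>R (((*v) M) ^^ i) v)"
      by (intro sum.cong refl)
         (simp add: pow[symmetric] matrix_vector_mult_def vec_eq_iff scaleR_sum_right)
    also have "\<dots> = poly_action M p v"
      unfolding poly_action_upto[OF deg]
      by (intro sum.cong refl) (simp add: coeff vec_eq_iff complex_eq_iff)
    finally show ?thesis by simp
  qed
  obtain root where root: "smult (lead_coeff p) (\<Prod>i<degree p. [:- root i, 1:]) = p"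
    by (rule complex_poly_decompose')
  have act_prod: "poly_action M (\<Prod>i<m. [:- root i, 1:]) v
      = shift_prod M (map root (rev [0..<m])) v" for m v
  proof (induction m)
    case 0
    show ?case by (simp add: poly_action_def)
  next
    case (Suc m)
    have "(\<Prod>i<Suc m. [:- root i, 1:]) = [:- root m, 1:] * (\<Prod>i<m. [:- root i, 1:])"
      by (simp only: lessThan_Suc prod.insert finite_lessThan) (simp add: mult.commute)
    then show ?case
      using Suc by (simp only: poly_action_linear_factor) simp
  qed
  have smult: "poly_action M (smult a r) v = a *s poly_action M r v" for a r v
    by (subst poly_action_upto[of "smult a r" "degree r"])
       (auto simp: poly_action_def vec.scale_sum_right)
  have "lead_coeff p *s poly_action M (\<Prod>i<degree p. [:- root i, 1:]) v = 0" for v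
    using act[of v] root smult by metis
  then have "poly_action M (\<Prod>i<degree p. [:- root i, 1:]) v = 0" for v
    using p0 by (simp add: vec.scale_eq_0_iff)
  then show ?thesis
    using that act_prod by metis
qed

text \<open>Factors \<open>M - z\<close> for which \<open>z\<close> is not an eigenvalue are injective and can be cancelled.\<close>

lemma shift_prod_only_eigenvalues:
  fixes M :: "complex^'n^'n"
  assumes "shift_prod M zs v = 0"
  shows "shift_prod M (filter (\<lambda>z. \<exists>x. x \<noteq> 0 \<and> M *v x = z *s x) zs) v = 0"
  using assms
proof (induction zs arbitrary: v)
  case (Cons z zs)
  show ?case
  proof (cases "\<exists>x. x \<noteq> 0 \<and> M *v x = z *s x")
    case True
    from Cons.prems have "shift_prod M zs ((M - mat z) *v v) = 0"
      by (simp add: shift_shift_prod_commute)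
    from Cons.IH[OF this] True show ?thesis
      by (simp add: shift_shift_prod_commute)
  next
    case False
    from Cons.prems have "(M - mat z) *v shift_prod M zs v = 0"
      by simp
    then have "M *v shift_prod M zs v = z *s shift_prod M zs v"
      unfolding shift_apply by simp
    with False have "shift_prod M zs v = 0" by blast
    with Cons.IH False show ?thesis by simp
  qed
qed simp

lemma map_matrix_of_real_mult:
  "map_matrix complex_of_real M *v (\<chi> i. complex_of_real (v $ i)) = (\<chi> i. complex_of_real ((M *v v) $ i))"
  by (simp add: matrix_vector_mult_def map_matrix_def vec_eq_iff)

text \<open>After cancellation only eigenvalues are left in the list.  They are real by assumption, so the
  product of the factors can be read over \<open>\<real>\<close>, and nonzero because \<open>M\<close> is invertible.\<close>

lemma real_spectrum_annihilating_list:
  fixes M :: "real^'n^'n"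
  assumes real: "\<And>\<mu>. complex_eigenvalue M \<mu> \<Longrightarrow> \<mu> \<in> \<real>"
    and inv: "invertible M"
  obtains \<nu>s where "0 \<notin> set \<nu>s" "\<And>v. shift_prod M \<nu>s v = 0"
proof -
  let ?M = "map_matrix complex_of_real M"
  let ?c = "\<lambda>v. \<chi> i. complex_of_real ((v::real^'n) $ i)"
  let ?eig = "\<lambda>z. \<exists>x. x \<noteq> 0 \<and> ?M *v x = z *s x"
  obtain zs where zs: "\<And>v. shift_prod ?M zs v = 0"
    using complex_annihilating_list by blast
  define \<nu>s where "\<nu>s = map Re (filter ?eig zs)"
  have "map complex_of_real \<nu>s = filter ?eig zs"
    unfolding \<nu>s_def map_map
  proof (rule map_idI)
    fix z assume "z \<in> set (filter ?eig zs)"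
    then have "complex_eigenvalue M z"
      by (auto simp: complex_eigenvalue_def)
    then show "(complex_of_real \<circ> Re) z = z"
      using real by (auto elim: Reals_cases)
  qed
  then have ann: "shift_prod ?M (map complex_of_real \<nu>s) v = 0" for v
    using shift_prod_only_eigenvalues[OF zs] by simp
  have shiftc: "(?M - mat (complex_of_real \<nu>)) *v ?c v = ?c ((M - mat \<nu>) *v v)" for \<nu> v
    by (simp add: matrix_vector_mult_diff_rdistrib mat_vector_mult map_matrix_of_real_mult)
       (simp add: vec_eq_iff)
  have "shift_prod ?M (map complex_of_real \<mu>s) (?c v) = ?c (shift_prod M \<mu>s v)" for \<mu>s v
    by (induction \<mu>s) (simp_all add: shiftc)
  then have "?c (shift_prod M \<nu>s v) = 0" for v
    using ann[of "?c v"] by simp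
  then have "shift_prod M \<nu>s v = 0" for v
    by (simp add: vec_eq_iff)
  moreover have "0 \<notin> set \<nu>s"
  proof
    assume "0 \<in> set \<nu>s"
    then have "complex_of_real 0 \<in> set (filter ?eig zs)"
      using \<open>map complex_of_real \<nu>s = filter ?eig zs\<close> by (metis image_eqI list.set_map)
    then obtain x where x: "x \<noteq> 0" "?M *v x = 0"
      by auto
    have "M *v (\<chi> i. Re (x $ i)) = 0" "M *v (\<chi> i. Im (x $ i)) = 0"
      using x(2) by (simp_all add: vec_eq_iff matrix_vector_mult_def map_matrix_def complex_eq_iff)
    moreover have "y = 0" if "M *v y = 0" for y
      using inv that
      by (metis invertible_def matrix_vector_mul_assoc matrix_vector_mul_lid matrix_vector_mult_0_right)
    ultimately have "(\<chi> i. Re (x $ i)) = 0" "(\<chi> i. Im (x $ i)) = 0"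
      by blast+
    then have "x = 0"
      by (simp add: vec_eq_iff complex_eq_iff)
    with x show False by simp
  qed
  ultimately show ?thesis using that by blast
qed

lemma shift_funpow_linear: "linear (((*v) (M - mat (\<mu>::real))) ^^ i)"
proof (induction i)
  case (Suc i)
  show ?case
    unfolding funpow.simps by (rule linear_compose[OF Suc matrix_vector_mul_linear])
qed (simp add: linear_ident)

lemma shift_prod_linear: "linear (shift_prod M (\<nu>s :: real list))"
proof (induction \<nu>s)
  case (Cons \<nu> \<nu>s)
  show ?case
    using linear_compose[OF Cons matrix_vector_mul_linear[of "M - mat \<nu>"]] by (simp add: o_def)
qed (simp add: linear_ident)

lemma shift_prod_shift_prod_commute:
  "shift_prod M xs (shift_prod M ys v) = shift_prod M ys (shift_prod M xs v)"
  by (induction xs arbitrary: v) (simp_all add: shift_shift_prod_commute)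

lemma shift_prod_funpow_commute:
  "(((*v) (M - mat z)) ^^ i) (shift_prod M zs v) = shift_prod M zs ((((*v) (M - mat z)) ^^ i) v)"
  by (induction i) (simp_all add: shift_shift_prod_commute)

lemma shift_prod_split:
  "shift_prod M zs v = (((*v) (M - mat z)) ^^ length (filter (\<lambda>w. w = z) zs)) (shift_prod M (filter (\<lambda>w. w \<noteq> z) zs) v)"
  by (induction zs) (auto simp: shift_prod_funpow_commute shift_shift_prod_commute)

lemma gen_eigenspace_shift:
  assumes "v \<in> gen_eigenspace M \<mu>"
  shows "(M - mat \<nu>) *v v \<in> gen_eigenspace M \<mu>"
proof -
  obtain m where m: "(((*v) (M - mat \<mu>)) ^^ m) v = 0"
    using assms by (auto simp: gen_eigenspace_def)
  have "(((*v) (M - mat \<mu>)) ^^ m) ((M - mat \<nu>) *v v) = (M - mat \<nu>) *v ((((*v) (M - mat \<mu>)) ^^ m) v)"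
    using shift_prod_funpow_commute[where M = M and z = \<mu> and i = m and zs = "[\<nu>]" and v = v] by simp
  then show ?thesis
    using m unfolding gen_eigenspace_def by (auto simp del: mult_minus_left)
qed

lemma gen_eigenspace_shift_prod:
  "v \<in> gen_eigenspace M \<mu> \<Longrightarrow> shift_prod M \<nu>s v \<in> gen_eigenspace M \<mu>"
  by (induction \<nu>s) (auto intro: gen_eigenspace_shift)

lemma gen_eigenspace_shift_injective:
  assumes v: "v \<in> gen_eigenspace M \<mu>" and "\<nu> \<noteq> \<mu>" and 0: "(M - mat \<nu>) *v v = 0"
  shows "v = 0"
proof -
  obtain m where m: "(((*v) (M - mat \<mu>)) ^^ m) v = 0"
    using v by (auto simp: gen_eigenspace_def)
  have eig: "(M - mat \<mu>) *v v = (\<nu> - \<mu>) *s v"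
    using 0 by (simp add: shift_apply vector_sub_rdistrib)
  have "(((*v) (M - mat \<mu>)) ^^ i) v = (\<nu> - \<mu>) ^ i *s v" for i
  proof (induction i)
    case (Suc i)
    have "(((*v) (M - mat \<mu>)) ^^ Suc i) v = (M - mat \<mu>) *v ((\<nu> - \<mu>) ^ i *s v)"
      using Suc by (simp del: matrix_vector_mult_diff_rdistrib)
    also have "\<dots> = (\<nu> - \<mu>) ^ i *s ((M - mat \<mu>) *v v)"
      by (rule mult_smult)
    also have "\<dots> = (\<nu> - \<mu>) ^ Suc i *s v"
      unfolding eig vector_smult_assoc by (simp add: mult.commute)
    finally show ?case .
  qed simp
  with m \<open>\<nu> \<noteq> \<mu>\<close> show ?thesis by (simp add: vec_eq_iff)
qed

lemma gen_eigenspace_shift_prod_injective: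
  assumes "v \<in> gen_eigenspace M \<mu>" "\<mu> \<notin> set \<nu>s" "shift_prod M \<nu>s v = 0"
  shows "v = 0"
  using assms
proof (induction \<nu>s)
  case (Cons \<nu> \<nu>s)
  then have "shift_prod M \<nu>s v = 0"
    using gen_eigenspace_shift_injective[of "shift_prod M \<nu>s v" M \<mu> \<nu>] gen_eigenspace_shift_prod
    by auto
  with Cons show ?case by simp
qed simp

lemma gen_eigenspace_disjoint:
  assumes "v \<in> gen_eigenspace M \<mu>" "v \<in> gen_eigenspace M \<nu>" "\<nu> \<noteq> \<mu>"
  shows "v = 0"
proof -
  obtain m where m: "(((*v) (M - mat \<nu>)) ^^ m) v = 0"
    using assms by (auto simp: gen_eigenspace_def)
  have "foldr (\<lambda>z. (*v) (M - mat z)) (replicate m \<nu>) v = (((*v) (M - mat \<nu>)) ^^ m) v"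
    by (induction m) auto
  then show ?thesis
    using gen_eigenspace_shift_prod_injective[OF assms(1), of "replicate m \<nu>"] m assms(3) by auto
qed

text \<open>If the factors are applied one after the other, the last vector before 0 is an eigenvector.\<close>

lemma shift_prod_kernel_eigenvector:
  assumes "shift_prod M zs v = 0" "v \<noteq> 0"
  obtains z ys where "z \<in> set zs" "shift_prod M ys v \<noteq> 0" "(M - mat z) *v shift_prod M ys v = 0"
  using assms
proof (induction zs arbitrary: thesis)
  case (Cons z zs)
  show ?case
  proof (cases "shift_prod M zs v = 0")
    case True
    from Cons.IH[OF _ True] Cons.prems show ?thesis
      by (metis list.set_intros(2))
  next
    case False
    with Cons.prems(1)[of z zs] Cons.prems(2) show ?thesis by simp
  qed
qed simp

text \<open>With \<open>a i = (M - \<mu>)\<^sup>i v\<close> on a generalized eigenspace, the left-hand sum is the inner product of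
  \<open>v\<close> and \<open>(M - \<mu>) v\<close> in an adapted Euclidean structure, the right-hand one the square of the
  adapted norm of \<open>v\<close>.  The weight \<open>4 / \<mu>\<^sup>2\<close> makes the nilpotent part at most half as large as \<open>\<mu>\<close>.\<close>

lemma weighted_shift_sum_bound:
  fixes a :: "nat \<Rightarrow> 'a::real_inner"
  assumes "\<mu> \<noteq> 0" and "a (Suc m) = 0"
  shows "\<bar>\<Sum>i\<le>m. (4 / \<mu>\<^sup>2) ^ i * (a i \<bullet> a (Suc i))\<bar> \<le> \<bar>\<mu>\<bar> / 2 * (\<Sum>i\<le>m. (4 / \<mu>\<^sup>2) ^ i * (norm (a i))\<^sup>2)"
proof -
  let ?t = "4 / \<mu>\<^sup>2"
  let ?n = "\<lambda>i. ?t ^ i * (norm (a i))\<^sup>2"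
  have t: "?t > 0" using assms by simp
  have one: "\<bar>?t ^ i * (a i \<bullet> a (Suc i))\<bar> \<le> \<bar>\<mu>\<bar> / 4 * (?n i + ?n (Suc i))" for i
  proof -
    let ?x = "norm (a i)" and ?y = "norm (a (Suc i))"
    have "?x * ?y \<le> \<bar>\<mu>\<bar> / 4 * (?x\<^sup>2 + ?t * ?y\<^sup>2)"
    proof -
      have "\<bar>\<mu>\<bar> / 4 * (?x\<^sup>2 + ?t * ?y\<^sup>2) - ?x * ?y = (\<bar>\<mu>\<bar> * ?x / 2 - ?y)\<^sup>2 / \<bar>\<mu>\<bar>"
        using assms(1) by (simp add: field_simps power2_eq_square)
      also have "\<dots> \<ge> 0" by simp
      finally show ?thesis by simp
    qed
    then have "?t ^ i * (?x * ?y) \<le> ?t ^ i * (\<bar>\<mu>\<bar> / 4 * (?x\<^sup>2 + ?t * ?y\<^sup>2))"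
      using t by (intro mult_left_mono) auto
    moreover have "\<bar>?t ^ i * (a i \<bullet> a (Suc i))\<bar> \<le> ?t ^ i * (?x * ?y)"
      using t Cauchy_Schwarz_ineq2[of "a i" "a (Suc i)"] by (simp add: abs_mult mult_left_mono del: times_divide_eq_left)
    ultimately show ?thesis by (simp add: algebra_simps)
  qed
  have "(\<Sum>i\<le>m. ?n (Suc i)) \<le> (\<Sum>i\<le>m. ?n i)"
  proof -
    have "(\<Sum>i\<le>m. ?n i) + ?n (Suc m) = ?n 0 + (\<Sum>i\<le>m. ?n (Suc i))"
      using sum.atMost_Suc_shift[of ?n m] by (simp only: sum.atMost_Suc)
    moreover have "?n (Suc m) = 0" "?n 0 \<ge> 0"
      using assms(2) by auto
    ultimately show ?thesis by linarith
  qed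
  then have le: "(\<Sum>i\<le>m. ?n i + ?n (Suc i)) \<le> 2 * (\<Sum>i\<le>m. ?n i)"
    by (simp add: sum.distrib)
  have "\<bar>\<Sum>i\<le>m. ?t ^ i * (a i \<bullet> a (Suc i))\<bar> \<le> (\<Sum>i\<le>m. \<bar>\<mu>\<bar> / 4 * (?n i + ?n (Suc i)))"
    by (rule order_trans[OF sum_abs sum_mono]) (rule one)
  also have "\<dots> = \<bar>\<mu>\<bar> / 4 * (\<Sum>i\<le>m. ?n i + ?n (Suc i))"
    by (rule sum_distrib_left[symmetric])
  also have "\<dots> \<le> \<bar>\<mu>\<bar> / 4 * (2 * (\<Sum>i\<le>m. ?n i))"
    by (rule mult_left_mono[OF le]) simp
  finally show ?thesis by simp
qed

lemma quadratic_positive_lower_bound: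
  fixes g :: "'a::euclidean_space \<Rightarrow> real"
  assumes cont: "continuous_on UNIV g" and hom: "\<And>a v. g (a *\<^sub>R v) = a\<^sup>2 * g v"
    and pos: "\<And>v. v \<noteq> 0 \<Longrightarrow> g v > 0"
  obtains c where "c > 0" "\<And>v. c * (norm v)\<^sup>2 \<le> g v"
proof -
  have "compact (sphere (0::'a) 1)" "sphere (0::'a) 1 \<noteq> {}" by auto
  then obtain u where u: "u \<in> sphere 0 1" "\<And>v. v \<in> sphere 0 1 \<Longrightarrow> g u \<le> g v"
    using continuous_attains_inf[of "sphere 0 1" g] cont continuous_on_subset by blast
  have "g u * (norm v)\<^sup>2 \<le> g v" for v
  proof (cases "v = 0")
    case True
    then show ?thesis using hom[of 0 0] by simp
  next
    case False
    have "g v = (norm v)\<^sup>2 * g (v /\<^sub>R norm v)"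
      using False hom[of "inverse (norm v)" v] by (simp add: field_simps)
    with u(2)[of "v /\<^sub>R norm v"] False show ?thesis
      by (simp add: mult.commute mult_right_mono)
  qed
  moreover have "u \<noteq> 0" using u(1) by auto
  then have "g u > 0" by (rule pos)
  ultimately show ?thesis using that by blast
qed

text \<open>For \<open>\<mu>\<close> in the annihilating list let \<open>p \<mu>\<close> be the product of the factors with \<open>\<nu> \<noteq> \<mu>\<close>.  It maps
  into the generalized eigenspace of \<open>\<mu>\<close>, is injective there and annihilates the other ones, so it
  replaces the spectral projection.  The form adds up the adapted squared norms of the vectors \<open>p \<mu> v\<close>,
  with the sign of \<open>\<mu>\<close>.  On a subspace where \<open>s * B\<close> is negative definite, the sum of the \<open>p \<mu>\<close> with
  \<open>s * \<mu> < 0\<close> is injective, which bounds the dimension.\<close>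

lemma lyapunov_form:
  fixes M :: "real^'n^'n"
  assumes nz: "0 \<notin> set \<nu>s" and ann: "\<And>v. shift_prod M \<nu>s v = 0"
  obtains B :: "real^'n \<Rightarrow> real^'n \<Rightarrow> real" and c where "bilinear B" "\<And>v w. B v w = B w v"
    "c > 0" "\<And>v. c * (norm v)\<^sup>2 \<le> B v (M *v v)"
    "\<And>Y s. \<lbrakk>subspace Y; \<And>v. \<lbrakk>v \<in> Y; v \<noteq> 0\<rbrakk> \<Longrightarrow> s * B v v < 0\<rbrakk> \<Longrightarrow>
        dim Y \<le> dim (spectral_space M {\<mu>. s * \<mu> < 0})"
proof -
  define p where "p \<mu> = shift_prod M (filter (\<lambda>\<nu>. \<nu> \<noteq> \<mu>) \<nu>s)" for \<mu>
  define m where "m = length \<nu>s"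
  define T where "T \<mu> i = (((*v) (M - mat \<mu>)) ^^ i)" for \<mu> i
  define q where "q \<mu> v w = (\<Sum>i\<le>m. (4 / \<mu>\<^sup>2) ^ i * (T \<mu> i (p \<mu> v) \<bullet> T \<mu> i (p \<mu> w)))" for \<mu> v w
  define B where "B v w = (\<Sum>\<mu>\<in>set \<nu>s. sgn \<mu> * q \<mu> v w)" for v w
  have lin_p: "linear (p \<mu>)" for \<mu>
    unfolding p_def by (rule shift_prod_linear)
  have lin_T: "linear (T \<mu> i)" for \<mu> i
    unfolding T_def by (rule shift_funpow_linear)
  have nilp: "T \<mu> (Suc m) (p \<mu> v) = 0" for \<mu> v
  proof -
    let ?k = "length (filter (\<lambda>\<nu>. \<nu> = \<mu>) \<nu>s)"
    have "T \<mu> ?k (p \<mu> v) = 0"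
      using shift_prod_split[of M \<nu>s v \<mu>] ann by (simp add: T_def p_def)
    moreover have "Suc m = (Suc m - ?k) + ?k"
      unfolding m_def using length_filter_le[of "\<lambda>\<nu>. \<nu> = \<mu>" \<nu>s] by linarith
    then have "T \<mu> (Suc m) (p \<mu> v) = T \<mu> (Suc m - ?k) (T \<mu> ?k (p \<mu> v))"
      unfolding T_def by (metis funpow_add o_apply)
    ultimately show ?thesis
      using linear_0[OF lin_T] by metis
  qed
  have pK: "p \<mu> v \<in> gen_eigenspace M \<mu>" for \<mu> v
    using nilp unfolding gen_eigenspace_def T_def by blast
  have p_inj: "v = 0" if "v \<in> gen_eigenspace M \<mu>" "p \<mu> v = 0" for \<mu> v
    using gen_eigenspace_shift_prod_injective[OF that(1)] that(2) unfolding p_def by force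
  have p_kill: "p \<mu> v = 0" if "v \<in> gen_eigenspace M \<nu>" "\<nu> \<noteq> \<mu>" for \<mu> \<nu> v
    using gen_eigenspace_disjoint[OF pK _ that(2)] gen_eigenspace_shift_prod[OF that(1)]
    unfolding p_def by blast
  have p_faithful: "v = 0" if "\<And>\<mu>. \<mu> \<in> set \<nu>s \<Longrightarrow> p \<mu> v = 0" for v
  proof (rule ccontr)
    assume "v \<noteq> 0"
    then obtain \<mu> ys where y: "\<mu> \<in> set \<nu>s" "shift_prod M ys v \<noteq> 0" "(M - mat \<mu>) *v shift_prod M ys v = 0"
      using shift_prod_kernel_eigenvector[OF ann] by blast
    have "(((*v) (M - mat \<mu>)) ^^ 1) (shift_prod M ys v) = 0"
      using y(3) by simp
    then have "shift_prod M ys v \<in> gen_eigenspace M \<mu>"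
      unfolding gen_eigenspace_def by blast
    moreover have "p \<mu> (shift_prod M ys v) = shift_prod M ys (p \<mu> v)"
      unfolding p_def by (rule shift_prod_shift_prod_commute)
    then have "p \<mu> (shift_prod M ys v) = 0"
      using that[OF y(1)] linear_0[OF shift_prod_linear] by metis
    ultimately show False using p_inj y(2) by blast
  qed
  have qq: "q \<mu> v v = (\<Sum>i\<le>m. (4 / \<mu>\<^sup>2) ^ i * (norm (T \<mu> i (p \<mu> v)))\<^sup>2)" for \<mu> v
    by (simp add: q_def power2_norm_eq_inner)
  have q_ge: "(norm (p \<mu> v))\<^sup>2 \<le> q \<mu> v v" for \<mu> v
  proof -
    have "(\<Sum>i\<in>{0}. (4 / \<mu>\<^sup>2) ^ i * (norm (T \<mu> i (p \<mu> v)))\<^sup>2) \<le> q \<mu> v v"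
      unfolding qq by (rule sum_mono2) auto
    then show ?thesis by (simp add: T_def)
  qed
  have q_nonneg: "0 \<le> q \<mu> v v" for \<mu> v
    using q_ge[of \<mu> v] by (meson order_trans zero_le_power2)
  have T_M: "T \<mu> i (p \<mu> (M *v v)) = T \<mu> (Suc i) (p \<mu> v) + \<mu> *\<^sub>R T \<mu> i (p \<mu> v)" for \<mu> i v
  proof -
    have "M *v v = (M - mat \<mu>) *v v + \<mu> *\<^sub>R v"
      by (simp add: shift_apply scalar_mult_eq_scaleR)
    then have "p \<mu> (M *v v) = (M - mat \<mu>) *v (p \<mu> v) + \<mu> *\<^sub>R p \<mu> v"
      using linear_add[OF lin_p] linear_scale[OF lin_p] shift_shift_prod_commute
      unfolding p_def by metis
    then have "T \<mu> i (p \<mu> (M *v v)) = T \<mu> i ((M - mat \<mu>) *v (p \<mu> v)) + \<mu> *\<^sub>R T \<mu> i (p \<mu> v)"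
      using linear_add[OF lin_T] linear_scale[OF lin_T] by metis
    then show ?thesis
      unfolding T_def by (simp only: funpow_Suc_right o_apply)
  qed
  have q_M: "\<bar>\<mu>\<bar> / 2 * (norm (p \<mu> v))\<^sup>2 \<le> sgn \<mu> * q \<mu> v (M *v v)" if "\<mu> \<noteq> 0" for \<mu> v
  proof -
    let ?S = "\<Sum>i\<le>m. (4 / \<mu>\<^sup>2) ^ i * (T \<mu> i (p \<mu> v) \<bullet> T \<mu> (Suc i) (p \<mu> v))"
    have "q \<mu> v (M *v v) = ?S + \<mu> * q \<mu> v v"
      unfolding q_def T_M by (simp add: inner_add_right algebra_simps sum.distrib sum_distrib_left)
    then have "sgn \<mu> * q \<mu> v (M *v v) = sgn \<mu> * ?S + \<bar>\<mu>\<bar> * q \<mu> v v"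
      by (simp add: algebra_simps abs_sgn)
    moreover have "\<bar>?S\<bar> \<le> \<bar>\<mu>\<bar> / 2 * q \<mu> v v"
      unfolding qq using weighted_shift_sum_bound[OF that, of "\<lambda>i. T \<mu> i (p \<mu> v)" m] nilp by simp
    then have "- (\<bar>\<mu>\<bar> / 2 * q \<mu> v v) \<le> sgn \<mu> * ?S"
      using that by (auto simp: sgn_if abs_le_iff)
    moreover have "\<bar>\<mu>\<bar> / 2 * (norm (p \<mu> v))\<^sup>2 \<le> \<bar>\<mu>\<bar> / 2 * q \<mu> v v"
      by (rule mult_left_mono[OF q_ge]) simp
    ultimately show ?thesis by (simp add: field_simps)
  qed
  have bil_q: "bilinear (q \<mu>)" for \<mu>
    unfolding bilinear_def q_def
    by (intro allI conjI linearI)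
       (simp_all add: linear_add[OF lin_p] linear_add[OF lin_T] linear_scale[OF lin_p]
         linear_scale[OF lin_T] inner_simps algebra_simps sum.distrib sum_distrib_left)
  have bil: "bilinear B"
    unfolding bilinear_def
  proof (intro allI conjI linearI)
    fix u v w :: "real^'n" and a :: real
    show "B u (v + w) = B u v + B u w" "B (v + w) u = B v u + B w u"
      unfolding B_def bilinear_radd[OF bil_q] bilinear_ladd[OF bil_q] distrib_left
      by (rule sum.distrib)+
    show "B u (a *\<^sub>R v) = a *\<^sub>R B u v" "B (a *\<^sub>R v) u = a *\<^sub>R B v u"
      unfolding B_def bilinear_rmul[OF bil_q] bilinear_lmul[OF bil_q]
      by (simp_all add: sum_distrib_left mult.left_commute)
  qed
  have sym: "B v w = B w v" for v w
    unfolding B_def q_def by (simp add: inner_commute)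
  have B_M: "(\<Sum>\<mu>\<in>set \<nu>s. \<bar>\<mu>\<bar> / 2 * (norm (p \<mu> v))\<^sup>2) \<le> B v (M *v v)" for v
    unfolding B_def by (rule sum_mono, rule q_M) (use nz in auto)
  have pos: "0 < B v (M *v v)" if "v \<noteq> 0" for v
  proof -
    have "\<exists>\<mu>\<in>set \<nu>s. p \<mu> v \<noteq> 0"
      using p_faithful[of v] that by auto
    then obtain \<mu> where \<mu>: "\<mu> \<in> set \<nu>s" "p \<mu> v \<noteq> 0"
      by auto
    have "\<mu> \<noteq> 0"
      using \<mu>(1) nz by metis
    then have "0 < \<bar>\<mu>\<bar> / 2 * (norm (p \<mu> v))\<^sup>2"
      using \<mu>(2) by simp
    also have "\<dots> \<le> (\<Sum>\<mu>\<in>set \<nu>s. \<bar>\<mu>\<bar> / 2 * (norm (p \<mu> v))\<^sup>2)"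
      by (rule member_le_sum) (use \<mu> in auto)
    finally show ?thesis using B_M[of v] by linarith
  qed
  interpret Bb: bounded_bilinear B
    using bil by (simp add: bilinear_conv_bounded_bilinear)
  have "continuous_on UNIV (\<lambda>v. B v (M *v v))"
    by (intro Bb.continuous_on continuous_intros matrix_vector_mult_linear_continuous_on)
  moreover have "B (a *\<^sub>R v) (M *v (a *\<^sub>R v)) = a\<^sup>2 * B v (M *v v)" for a v
    by (simp add: Bb.scaleR_left Bb.scaleR_right power2_eq_square linear_scale[OF matrix_vector_mul_linear])
  ultimately obtain c where c: "c > 0" "\<And>v. c * (norm v)\<^sup>2 \<le> B v (M *v v)"
    using quadratic_positive_lower_bound[of "\<lambda>v. B v (M *v v)"] pos by blast
  have dims: "dim Y \<le> dim (spectral_space M {\<mu>. s * \<mu> < 0})"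
    if Y: "subspace Y" and neg: "\<And>v. \<lbrakk>v \<in> Y; v \<noteq> 0\<rbrakk> \<Longrightarrow> s * B v v < 0" for Y s
  proof -
    define S where "S = {\<mu>\<in>set \<nu>s. s * \<mu> < 0}"
    define P where "P v = (\<Sum>\<mu>\<in>S. p \<mu> v)" for v
    have fin: "finite S" by (simp add: S_def)
    have linP: "linear P"
      unfolding P_def by (rule linear_compose_sum) (simp add: lin_p)
    have "P ` Y \<subseteq> spectral_space M {\<mu>. s * \<mu> < 0}"
    proof (rule image_subsetI)
      show "P v \<in> spectral_space M {\<mu>. s * \<mu> < 0}" for v
        unfolding P_def spectral_space_def
        by (rule span_sum, rule span_base) (use pK in \<open>auto simp: S_def\<close>)
    qed
    then have le: "dim (P ` Y) \<le> dim (spectral_space M {\<mu>. s * \<mu> < 0})"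
      by (rule dim_subset)
    have "v = 0" if v: "v \<in> Y" "P v = 0" for v
    proof (rule ccontr)
      assume "v \<noteq> 0"
      have "p \<mu> v = 0" if \<mu>: "\<mu> \<in> S" for \<mu>
      proof (rule p_inj[OF pK])
        have "0 = p \<mu> (P v)"
          using v linear_0[OF lin_p] by simp
        also have "\<dots> = (\<Sum>\<nu>\<in>S. p \<mu> (p \<nu> v))"
          unfolding P_def by (rule linear_sum[OF lin_p])
        also have "\<dots> = (\<Sum>\<nu>\<in>S. if \<nu> = \<mu> then p \<mu> (p \<mu> v) else 0)"
          by (rule sum.cong) (auto intro: p_kill[OF pK])
        also have "\<dots> = p \<mu> (p \<mu> v)"
          using fin \<mu> by simp
        finally show "p \<mu> (p \<mu> v) = 0" by simp
      qed
      then have "q \<mu> v v = 0" if "\<mu> \<in> S" for \<mu>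
        using that by (simp add: q_def linear_0[OF lin_T])
      then have "0 \<le> s * (sgn \<mu> * q \<mu> v v)" if "\<mu> \<in> set \<nu>s" for \<mu>
        using that q_nonneg[of \<mu> v] nz unfolding S_def
        by (cases "s * \<mu> < 0") (auto simp: sgn_if not_less zero_le_mult_iff mult_le_0_iff)
      then have "0 \<le> s * B v v"
        unfolding B_def by (simp add: sum_distrib_left sum_nonneg)
      with neg[OF v(1) \<open>v \<noteq> 0\<close>] show False by simp
    qed
    then have "inj_on P Y"
      using linear_injective_on_subspace_0[OF linP Y] by blast
    then have "dim (P ` Y) = dim Y"
      using dim_image_eq[OF linP, of Y] Y by (simp add: span_eq_iff[THEN iffD2])
    then show ?thesis using le by simp
  qed
  show ?thesis
    by (rule that[OF bil sym c dims])
qed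

section \<open>Energy estimates on the half-line\<close>

lemma nondecreasing_on_interval:
  fixes f f' :: "real \<Rightarrow> real"
  assumes "a \<le> b" and deriv: "\<And>t. t \<in> {a..b} \<Longrightarrow> (f has_vector_derivative f' t) (at t within {a..b})"
    and nonneg: "\<And>t. t \<in> {a..b} \<Longrightarrow> 0 \<le> f' t"
  shows "f a \<le> f b"
proof (cases "a = b")
  case False
  then have "a < b" using assms(1) by simp
  then obtain x where x: "x \<in> {a<..<b}" "f b - f a = (b - a) *\<^sub>R f' x"
    using mvt_simple[of a b f "\<lambda>t h. h *\<^sub>R f' t"] deriv
    by (auto simp: has_vector_derivative_def)
  then show ?thesis
    using \<open>a < b\<close> nonneg[of x] by (smt (verit) greaterThanLessThan_iff atLeastAtMost_iff mult_nonneg_nonneg real_scaleR_def)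
qed simp

lemma integral_has_vector_derivative_half_line:
  fixes f :: "real \<Rightarrow> 'a::banach"
  assumes "continuous_on {0..} f" "0 \<le> t"
  shows "((\<lambda>u. integral {0..u} f) has_vector_derivative f t) (at t within {0..})"
proof -
  have "((\<lambda>u. integral {0..u} f) has_vector_derivative f t) (at t within {0..t+1})"
    using assms by (intro integral_has_vector_derivative continuous_on_subset[OF assms(1)]) auto
  moreover have "at t within {0..t+1} = at t within {0..}"
    by (rule at_within_nhd[where S = "{..<t+1}"]) auto
  ultimately show ?thesis by simp
qed

lemma bounded_of_limit_at_top:
  fixes v :: "real \<Rightarrow> 'a::real_normed_vector"
  assumes "continuous_on {0..} v" "(v \<longlongrightarrow> l) at_top"
  obtains C where "\<And>t. 0 \<le> t \<Longrightarrow> norm (v t) \<le> C"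
proof -
  have "eventually (\<lambda>t. dist (v t) l < 1) at_top"
    using assms(2) by (rule tendstoD) simp
  then obtain T where T: "\<And>t. T \<le> t \<Longrightarrow> dist (v t) l < 1"
    by (auto simp: eventually_at_top_linorder)
  have "compact (v ` {0..max T 0})"
    by (intro compact_continuous_image continuous_on_subset[OF assms(1)]) auto
  then obtain C where C: "\<And>t. t \<in> {0..max T 0} \<Longrightarrow> norm (v t) \<le> C"
    by (meson bounded_iff compact_imp_bounded image_eqI)
  have "norm (v t) \<le> max C (norm l + 1)" if "0 \<le> t" for t
  proof (cases "t \<le> max T 0")
    case True
    then show ?thesis using C[of t] that by simp
  next
    case False
    then have "dist (v t) l < 1" by (intro T) simp
    then have "norm (v t) \<le> norm l + 1"
      using norm_triangle_sub[of "v t" l] by (simp add: dist_norm)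
    then show ?thesis by simp
  qed
  then show ?thesis by (rule that)
qed

text \<open>Constants of a form that is increasing along the solutions of a hyperbolic system: \<open>K\<close> bounds the
  form, \<open>c\<close> is the rate of increase in the estimates below.\<close>

locale symmetric_form =
  fixes B :: "'v::euclidean_space \<Rightarrow> 'v \<Rightarrow> real" and K c :: real
  assumes bil: "bilinear B" and sym: "B v w = B w v"
    and bound: "\<bar>B v w\<bar> \<le> K * (norm v * norm w)"
    and Kpos: "K > 0" and cpos: "c > 0"
begin

sublocale bb: bounded_bilinear B
  using bil by (simp add: bilinear_conv_bounded_bilinear)

text \<open>Up to the forcing, \<open>B (y t) (y t)\<close> increases at rate at least \<open>c * (norm (y t))\<^sup>2\<close>.  If it ever
  exceeded what the remaining forcing can undo, it would from then on grow like \<open>exp (c / K * t)\<close>, which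
  the growth condition excludes.  So it stays below that threshold, and integrating its increase
  bounds the \<open>L\<^sup>2\<close> norm of \<open>y\<close>.\<close>

lemma energy_estimate:
  assumes y: "\<And>t. 0 \<le> t \<Longrightarrow> (y has_vector_derivative y' t) (at t within {0..})"
    and B: "\<And>t. 0 \<le> t \<Longrightarrow> c * (norm (y t))\<^sup>2 - K * norm (y t) * f t \<le> B (y t) (y' t)"
    and f: "continuous_on {0..} f" "\<And>Z. 0 \<le> Z \<Longrightarrow> integral {0..Z} (\<lambda>t. (f t)\<^sup>2) \<le> \<gamma>"
    and growth: "\<And>t. 0 \<le> t \<Longrightarrow> norm (y t) \<le> C * exp (b * t)" "2 * b * K < c"
    and Z: "0 \<le> Z"
  shows "c * integral {0..Z} (\<lambda>t. (norm (y t))\<^sup>2) \<le> - B (y 0) (y 0) + K\<^sup>2 / c * \<gamma>"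
proof -
  define \<kappa> where "\<kappa> = K\<^sup>2 / c"
  have \<kappa>: "\<kappa> > 0" unfolding \<kappa>_def using Kpos cpos by simp
  have yc: "continuous_on {0..} y"
    using y by (auto simp: continuous_on_eq_continuous_within intro: has_vector_derivative_continuous)
  define F where "F t = integral {0..t} (\<lambda>t. (f t)\<^sup>2)" for t
  define Y where "Y t = integral {0..t} (\<lambda>t. (norm (y t))\<^sup>2)" for t
  have F': "(F has_vector_derivative (f t)\<^sup>2) (at t within {0..})" if "0 \<le> t" for t
    unfolding F_def by (rule integral_has_vector_derivative_half_line[OF _ that]) (intro continuous_intros f)
  have Y': "(Y has_vector_derivative (norm (y t))\<^sup>2) (at t within {0..})" if "0 \<le> t" for t
    unfolding Y_def by (rule integral_has_vector_derivative_half_line[OF _ that]) (intro continuous_intros yc)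
  (* The form, lowered by the forcing that is still to come. *)
  define m where "m t = B (y t) (y t) + \<kappa> * F t - \<kappa> * \<gamma>" for t
  define m' where "m' t = 2 * B (y t) (y' t) + \<kappa> * (f t)\<^sup>2" for t
  have m_deriv: "(m has_vector_derivative m' t) (at t within {0..})" if "0 \<le> t" for t
    unfolding m_def m'_def
    by (rule derivative_eq_intros bb.has_vector_derivative y F' that refl
         has_vector_derivative_mult_right | simp add: sym[of "y' t"])+
  have m'_ge: "c * (norm (y t))\<^sup>2 \<le> m' t" if "0 \<le> t" for t
  proof -
    have "c * (norm (y t))\<^sup>2 + \<kappa> * (f t)\<^sup>2 - 2 * (K * norm (y t) * f t) = (c * norm (y t) - K * f t)\<^sup>2 / c"
      unfolding \<kappa>_def using cpos by (simp add: field_simps power2_eq_square)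
    also have "\<dots> \<ge> 0" using cpos by simp
    finally show ?thesis using B[OF that] unfolding m'_def by linarith
  qed
  have m_le: "m t \<le> K * (norm (y t))\<^sup>2" if "0 \<le> t" for t
  proof -
    have "\<kappa> * F t \<le> \<kappa> * \<gamma>"
      using f(2)[OF that] \<kappa> unfolding F_def by simp
    then show ?thesis
      using bound[of "y t" "y t"] unfolding m_def power2_eq_square by linarith
  qed
  have m_nonpos: "m t0 \<le> 0" if t0: "0 \<le> t0" for t0
  proof (rule ccontr)
    assume "\<not> m t0 \<le> 0"
    define \<kappa>' where "\<kappa>' = c / K"
    define E where "E t = m t * exp (- \<kappa>' * t)" for t
    define E' where "E' t = m' t * exp (- \<kappa>' * t) - \<kappa>' * m t * exp (- \<kappa>' * t)" for t
    have E_mono: "E t0 \<le> E t" if "t0 \<le> t" for t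
    proof (rule nondecreasing_on_interval[OF that])
      fix s assume s: "s \<in> {t0..t}"
      then have s0: "0 \<le> s" using t0 by simp
      have "(E has_vector_derivative E' s) (at s within {0..})"
        unfolding E_def E'_def
        by (rule derivative_eq_intros m_deriv s0 refl has_vector_derivative_mult | simp add: algebra_simps
            | simp flip: has_real_derivative_iff_has_vector_derivative)+
      then show "(E has_vector_derivative E' s) (at s within {t0..t})"
        by (rule has_vector_derivative_within_subset) (use t0 in auto)
      have "\<kappa>' * m s \<le> \<kappa>' * (K * (norm (y s))\<^sup>2)"
        using m_le[OF s0] cpos Kpos unfolding \<kappa>'_def by (intro mult_left_mono) auto
      also have "\<dots> = c * (norm (y s))\<^sup>2" using Kpos by (simp add: \<kappa>'_def)
      also have "\<dots> \<le> m' s" by (rule m'_ge[OF s0])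
      finally show "0 \<le> E' s"
        unfolding E'_def by (simp add: left_diff_distrib[symmetric])
    qed
    have E_le: "E t \<le> K * C\<^sup>2 * exp ((2 * b - \<kappa>') * t)" if "t0 \<le> t" for t
    proof -
      have t: "0 \<le> t" using that t0 by simp
      have "m t \<le> K * (norm (y t))\<^sup>2" by (rule m_le[OF t])
      also have "\<dots> \<le> K * (C * exp (b * t))\<^sup>2"
        using growth(1)[OF t] Kpos by (intro mult_left_mono power_mono) auto
      also have "\<dots> = K * C\<^sup>2 * exp (2 * b * t)"
        by (simp add: power_mult_distrib exp_double[symmetric] mult.assoc)
      finally have "E t \<le> K * C\<^sup>2 * exp (2 * b * t) * exp (- \<kappa>' * t)"
        unfolding E_def by (intro mult_right_mono) auto
      also have "\<dots> = K * C\<^sup>2 * exp ((2 * b - \<kappa>') * t)"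
        by (simp add: exp_add[symmetric] algebra_simps)
      finally show ?thesis .
    qed
    have "2 * b - \<kappa>' < 0" unfolding \<kappa>'_def using growth(2) Kpos by (simp add: field_simps)
    then have "((\<lambda>t. exp ((2 * b - \<kappa>') * t)) \<longlongrightarrow> 0) at_top"
      by (intro filterlim_compose[OF exp_at_bot] filterlim_tendsto_neg_mult_at_bot[OF tendsto_const] filterlim_ident)
    then have "((\<lambda>t. K * C\<^sup>2 * exp ((2 * b - \<kappa>') * t)) \<longlongrightarrow> K * C\<^sup>2 * 0) at_top"
      by (rule tendsto_mult_left)
    moreover have "eventually (\<lambda>t. E t0 \<le> K * C\<^sup>2 * exp ((2 * b - \<kappa>') * t)) at_top"
      using eventually_ge_at_top[of t0] by eventually_elim (use E_mono E_le order_trans in blast)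
    ultimately have "E t0 \<le> K * C\<^sup>2 * 0"
      using tendsto_lowerbound by fastforce
    then show False
      using \<open>\<not> m t0 \<le> 0\<close> unfolding E_def by (simp add: mult_le_0_iff)
  qed
  have "m 0 - c * Y 0 \<le> m Z - c * Y Z"
  proof (rule nondecreasing_on_interval[OF Z])
    fix t assume "t \<in> {0..Z}"
    then have t: "0 \<le> t" by simp
    have "((\<lambda>t. m t - c * Y t) has_vector_derivative m' t - c * (norm (y t))\<^sup>2) (at t within {0..})"
      by (intro has_vector_derivative_diff has_vector_derivative_mult_right m_deriv Y' t)
    then show "((\<lambda>t. m t - c * Y t) has_vector_derivative m' t - c * (norm (y t))\<^sup>2) (at t within {0..Z})"
      by (rule has_vector_derivative_within_subset) auto
    show "0 \<le> m' t - c * (norm (y t))\<^sup>2"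
      using m'_ge[OF t] by simp
  qed
  moreover have "Y 0 = 0" "F 0 = 0" by (simp_all add: Y_def F_def)
  ultimately have "c * Y Z \<le> - B (y 0) (y 0) + \<kappa> * \<gamma>"
    using m_nonpos[OF Z] unfolding m_def by simp
  then show ?thesis unfolding Y_def \<kappa>_def .
qed

text \<open>A weight with this exponent costs at most half of the rate of increase \<open>c\<close>.\<close>

definition rate :: real where "rate = c / (8 * K)"

lemma rate_pos: "rate > 0"
  unfolding rate_def using Kpos cpos by simp

text \<open>The previous estimate for \<open>exp (rate * t) * y t\<close>; boundedness of \<open>y\<close> is the growth condition.\<close>

lemma weighted_energy_estimate:
  assumes y: "\<And>t. 0 \<le> t \<Longrightarrow> (y has_vector_derivative y' t) (at t within {0..})"
    and B: "\<And>t. 0 \<le> t \<Longrightarrow> c * (norm (y t))\<^sup>2 - K * norm (y t) * f t \<le> B (y t) (y' t)"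
    and f: "continuous_on {0..} f"
      "\<And>Z. 0 \<le> Z \<Longrightarrow> integral {0..Z} (\<lambda>t. (exp (rate * t) * f t)\<^sup>2) \<le> \<gamma>"
    and bounded: "\<And>t. 0 \<le> t \<Longrightarrow> norm (y t) \<le> C"
    and Z: "0 \<le> Z"
  shows "c / 2 * integral {0..Z} (\<lambda>t. (exp (rate * t) * norm (y t))\<^sup>2) \<le> - B (y 0) (y 0) + 2 * K\<^sup>2 / c * \<gamma>"
proof -
  interpret half: symmetric_form B K "c / 2"
    by unfold_locales (use bil sym bound Kpos cpos in auto)
  define u where "u t = exp (rate * t) *\<^sub>R y t" for t
  define u' where "u' t = exp (rate * t) *\<^sub>R (y' t + rate *\<^sub>R y t)" for t
  have "c / 2 * integral {0..Z} (\<lambda>t. (norm (u t))\<^sup>2) \<le> - B (u 0) (u 0) + K\<^sup>2 / (c / 2) * \<gamma>"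
  proof (rule half.energy_estimate[where f = "\<lambda>t. exp (rate * t) * f t" and C = C and b = rate])
    fix t :: real assume t: "0 \<le> t"
    show "(u has_vector_derivative u' t) (at t within {0..})"
      unfolding u_def u'_def
      by (rule derivative_eq_intros y t refl has_vector_derivative_scaleR | simp add: algebra_simps
           | simp flip: has_real_derivative_iff_has_vector_derivative)+
    show "norm (u t) \<le> C * exp (rate * t)"
      unfolding u_def using bounded[OF t] by simp
    let ?e = "exp (rate * t)" and ?n = "norm (y t)"
    have "B (u t) (u' t) = ?e * (?e * (B (y t) (y' t) + rate * B (y t) (y t)))"
      unfolding u_def u'_def by (simp add: bb.scaleR_left bb.scaleR_right bb.add_right distrib_left mult.left_commute)
    moreover have "c / 2 * ?n\<^sup>2 - K * ?n * f t \<le> B (y t) (y' t) + rate * B (y t) (y t)"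
    proof -
      have "- (K * ?n\<^sup>2) \<le> B (y t) (y t)"
        using bound[of "y t" "y t"] unfolding power2_eq_square by linarith
      then have "rate * - (K * ?n\<^sup>2) \<le> rate * B (y t) (y t)"
        using rate_pos by (intro mult_left_mono) auto
      moreover have "rate * - (K * ?n\<^sup>2) = - (c * ?n\<^sup>2) / 8"
        unfolding rate_def using Kpos by simp
      moreover have "0 \<le> c * ?n\<^sup>2" using cpos by simp
      ultimately show ?thesis using B[OF t] by linarith
    qed
    then have "?e * (?e * (c / 2 * ?n\<^sup>2 - K * ?n * f t)) \<le> ?e * (?e * (B (y t) (y' t) + rate * B (y t) (y t)))"
      by (intro mult_left_mono) auto
    ultimately show "c / 2 * (norm (u t))\<^sup>2 - K * norm (u t) * (?e * f t) \<le> B (u t) (u' t)"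
      unfolding u_def by (simp add: power2_eq_square algebra_simps)
  next
    show "continuous_on {0..} (\<lambda>t. exp (rate * t) * f t)"
      by (intro continuous_intros f)
    show "2 * rate * K < c / 2"
      unfolding rate_def using Kpos cpos by simp
  qed (use f Z in auto)
  then show ?thesis by (simp add: u_def)
qed

text \<open>The constant in the passage from the weighted \<open>L\<^sup>2\<close> norm of a derivative to the decay of
  the function.\<close>

definition tail_const :: real where "tail_const = (1 + 1 / (2 * rate)) / 2"

lemma tail_const_pos: "tail_const > 0"
  unfolding tail_const_def using rate_pos by (simp add: add_pos_pos)

text \<open>Cauchy-Schwarz for the integral of \<open>y = v'\<close> over \<open>[t, \<infinity>)\<close>, in the form of the inequality between
  arithmetic and geometric means with the parameter \<open>\<eta>\<close>.\<close>

lemma tail_estimate: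
  fixes v :: "real \<Rightarrow> 'v"
  assumes v: "\<And>t. 0 \<le> t \<Longrightarrow> (v has_vector_derivative y t) (at t within {0..})"
    and y: "continuous_on {0..} y" and lim: "(v \<longlongrightarrow> l) at_top"
    and S: "\<And>Z. 0 \<le> Z \<Longrightarrow> integral {0..Z} (\<lambda>t. (exp (rate * t) * norm (y t))\<^sup>2) \<le> S"
    and t: "0 \<le> t"
  shows "norm (v t - l) \<le> tail_const * sqrt S * exp (- rate * t)"
proof -
  have S0: "0 \<le> S" using S[of 0] by simp
  define I where "I Z = integral {0..Z} (\<lambda>t. (exp (rate * t) * norm (y t))\<^sup>2)" for Z
  have I': "(I has_vector_derivative (exp (rate * s) * norm (y s))\<^sup>2) (at s within {0..})" if "0 \<le> s" for s
    unfolding I_def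
    by (rule integral_has_vector_derivative_half_line[OF _ that]) (intro continuous_intros y)
  have vc: "continuous_on {0..} v"
    using v by (auto simp: continuous_on_eq_continuous_within intro: has_vector_derivative_continuous)
  have Ic: "continuous_on {0..} I"
    using I' by (auto simp: continuous_on_eq_continuous_within intro: has_vector_derivative_continuous)
  have I_nonneg: "0 \<le> I s" for s
    unfolding I_def by (cases "(\<lambda>t. (exp (rate * t) * norm (y t))\<^sup>2) integrable_on {0..s}")
      (auto intro: integral_nonneg simp: not_integrable_integral)
  have main: "norm (v t - l) \<le> tail_const * M * exp (- rate * t)" if M: "sqrt S < M" for M
  proof -
    have Mpos: "M > 0" using M S0 by (smt (verit) real_sqrt_ge_zero)
    have SM: "S \<le> M\<^sup>2"
    proof -
      have "(sqrt S)\<^sup>2 \<le> M\<^sup>2"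
        using M S0 by (intro power_mono) auto
      then show ?thesis using S0 by simp
    qed
    (* The optimal parameter; M > sqrt S keeps it positive even for S = 0. *)
    define \<eta> where "\<eta> = M * exp (rate * t)"
    have \<eta>: "\<eta> > 0" unfolding \<eta>_def using Mpos by simp
    define g where "g s = - \<eta> / (4 * rate) * exp (- 2 * rate * s) + I s / (2 * \<eta>)" for s
    define g' where "g' s = \<eta> / 2 * exp (- 2 * rate * s) + (exp (rate * s) * norm (y s))\<^sup>2 / (2 * \<eta>)" for s
    have dist: "norm (v Z - v t) \<le> g Z - g t" if "t < Z" for Z
    proof (rule differentiable_bound_general[OF that])
      show "continuous_on {t..Z} v"
        by (rule continuous_on_subset[OF vc]) (use t in auto)
      show "continuous_on {t..Z} g"
        unfolding g_def using \<eta>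
        by (intro continuous_intros continuous_on_subset[OF Ic]) (use t in auto)
      fix s assume s: "t < s" "s < Z"
      then have s0: "0 < s" using t by simp
      have at: "at s within {0..} = at s"
        by (rule at_within_interior) (use s0 in auto)
      show "(v has_vector_derivative y s) (at s)"
        using v[of s] s0 at by simp
      have "(I has_vector_derivative (exp (rate * s) * norm (y s))\<^sup>2) (at s)"
        using I'[of s] s0 at by simp
      then have I'': "(I has_real_derivative (exp (rate * s) * norm (y s))\<^sup>2) (at s)"
        by (simp add: has_real_derivative_iff_has_vector_derivative)
      have "(g has_real_derivative g' s) (at s)"
        unfolding g_def g'_def
        by (rule derivative_eq_intros I'' refl | use \<eta> rate_pos in \<open>simp add: field_simps\<close>)+
      then show "(g has_vector_derivative g' s) (at s)"
        by (simp add: has_real_derivative_iff_has_vector_derivative)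
      show "norm (y s) \<le> g' s"
      proof -
        let ?a = "exp (- rate * s)" and ?z = "exp (rate * s) * norm (y s)"
        have "norm (y s) = ?a * ?z"
          by (simp add: mult.assoc[symmetric] exp_add[symmetric])
        also have "\<dots> \<le> \<eta> / 2 * ?a\<^sup>2 + ?z\<^sup>2 / (2 * \<eta>)"
        proof -
          have "\<eta> / 2 * ?a\<^sup>2 + ?z\<^sup>2 / (2 * \<eta>) - ?a * ?z = (\<eta> * ?a - ?z)\<^sup>2 / (2 * \<eta>)"
            using \<eta> by (simp add: field_simps power2_eq_square)
          also have "\<dots> \<ge> 0" using \<eta> by simp
          finally show ?thesis by linarith
        qed
        also have "?a\<^sup>2 = exp (- 2 * rate * s)"
          by (simp add: exp_double[symmetric])
        finally show ?thesis unfolding g'_def .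
      qed
    qed
    have g_diff: "g Z - g t \<le> tail_const * M * exp (- rate * t)" if "t < Z" for Z
    proof -
      have "I Z \<le> M\<^sup>2"
        using S[of Z] SM that t unfolding I_def by (smt (verit))
      then have "I Z / (2 * \<eta>) \<le> M\<^sup>2 / (2 * \<eta>)"
        using \<eta> by (simp add: divide_right_mono)
      moreover have "0 \<le> I t / (2 * \<eta>)" using I_nonneg \<eta> by simp
      moreover have "0 \<le> \<eta> / (4 * rate) * exp (- 2 * rate * Z)"
        using \<eta> rate_pos by simp
      ultimately have "g Z - g t \<le> M\<^sup>2 / (2 * \<eta>) + \<eta> / (4 * rate) * exp (- 2 * rate * t)"
        unfolding g_def by simp
      also have "M\<^sup>2 / (2 * \<eta>) = M / 2 * exp (- rate * t)"
        unfolding \<eta>_def using Mpos by (simp add: exp_minus field_simps power2_eq_square)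
      also have "\<eta> / (4 * rate) * exp (- 2 * rate * t) = M / (4 * rate) * (exp (rate * t) * exp (- 2 * rate * t))"
        unfolding \<eta>_def by simp
      also have "exp (rate * t) * exp (- 2 * rate * t) = exp (- rate * t)"
        by (simp add: exp_add[symmetric])
      finally show ?thesis
        unfolding tail_const_def using rate_pos by (simp add: field_simps)
    qed
    have "((\<lambda>Z. norm (v Z - v t)) \<longlongrightarrow> norm (l - v t)) at_top"
      by (intro tendsto_intros lim)
    moreover have "eventually (\<lambda>Z. norm (v Z - v t) \<le> tail_const * M * exp (- rate * t)) at_top"
      using eventually_gt_at_top[of t] by eventually_elim (use dist g_diff order_trans in blast)
    ultimately have "norm (l - v t) \<le> tail_const * M * exp (- rate * t)"
      using tendsto_upperbound by fastforce
    then show ?thesis by (simp add: norm_minus_commute)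
  qed
  define k where "k = tail_const * exp (- rate * t)"
  have k: "k > 0" unfolding k_def using tail_const_pos by simp
  have "norm (v t - l) / k \<le> M" if "sqrt S < M" for M
    using main[OF that] k unfolding k_def by (simp add: pos_divide_le_eq mult_ac)
  then have "norm (v t - l) / k \<le> sqrt S"
    by (rule dense_ge)
  then have "norm (v t - l) \<le> sqrt S * k"
    using k by (simp add: pos_divide_le_eq)
  then show ?thesis
    unfolding k_def by (simp add: mult_ac)
qed

text \<open>The forcing in the equation for \<open>y\<close> contains \<open>v\<close>, whose supremum is controlled by the limit of \<open>v\<close> and,
  through the tail estimate, by the weighted norm of \<open>y\<close> itself.  The loop closes because the
  forcing also contains \<open>V\<close>, whose weighted norm is of the order of the small number \<open>R\<close>.\<close>

lemma coupled_estimate: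
  fixes v :: "real \<Rightarrow> 'v"
  assumes v: "\<And>t. 0 \<le> t \<Longrightarrow> (v has_vector_derivative y t) (at t within {0..})"
    and y: "\<And>t. 0 \<le> t \<Longrightarrow> (y has_vector_derivative y' t) (at t within {0..})"
    and By: "\<And>t. 0 \<le> t \<Longrightarrow> c * (norm (y t))\<^sup>2 - K * norm (y t) * (L * (norm (v t) + \<tau>) * norm (V t)) \<le> B (y t) (y' t)"
    and V: "\<And>t. 0 \<le> t \<Longrightarrow> (V has_vector_derivative V' t) (at t within {0..})"
    and BV: "\<And>t. 0 \<le> t \<Longrightarrow> c * (norm (V t))\<^sup>2 \<le> B (V t) (V' t)"
    and VR: "\<And>t. 0 \<le> t \<Longrightarrow> norm (V t) \<le> R"
    and y_bounded: "\<And>t. 0 \<le> t \<Longrightarrow> norm (y t) \<le> C"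
    and lim: "(v \<longlongrightarrow> l) at_top"
    and nonneg: "0 \<le> L" "0 \<le> \<tau>"
    and small: "32 * K ^ 3 * L\<^sup>2 * tail_const\<^sup>2 * R\<^sup>2 \<le> c ^ 3"
    and Z: "0 \<le> Z"
  shows "c / 4 * integral {0..Z} (\<lambda>t. (exp (rate * t) * norm (y t))\<^sup>2)
      \<le> - B (y 0) (y 0) + c / (4 * tail_const\<^sup>2) * (norm l + \<tau>)\<^sup>2"
proof -
  have R0: "0 \<le> R" using VR[of 0] norm_ge_zero order_trans by blast
  have vc: "continuous_on {0..} v" and yc: "continuous_on {0..} y" and Vc: "continuous_on {0..} V"
    using v y V by (auto simp: continuous_on_eq_continuous_within intro: has_vector_derivative_continuous)
  define I where "I Z = integral {0..Z} (\<lambda>t. (exp (rate * t) * norm (y t))\<^sup>2)" for Z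
  let ?J = "\<lambda>Z. integral {0..Z} (\<lambda>t. (exp (rate * t) * norm (V t))\<^sup>2)"
  define V2 where "V2 = 2 * K * R\<^sup>2 / c"
  have V2: "?J Z \<le> V2" if "0 \<le> Z" for Z
  proof -
    have "c / 2 * ?J Z \<le> - B (V 0) (V 0) + 2 * K\<^sup>2 / c * 0"
      by (rule weighted_energy_estimate[where f = "\<lambda>_. 0" and C = R and y' = V'])
        (use V BV VR that in auto)
    also have "\<dots> \<le> K * R\<^sup>2"
    proof -
      have "norm (V 0) * norm (V 0) \<le> R * R"
        using VR[of 0] R0 by (intro mult_mono) auto
      then have "K * (norm (V 0) * norm (V 0)) \<le> K * (R * R)"
        using Kpos by (intro mult_left_mono) auto
      then show ?thesis
        using bound[of "V 0" "V 0"] unfolding power2_eq_square by linarith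
    qed
    finally show ?thesis
      unfolding V2_def using cpos by (simp add: field_simps)
  qed
  have est: "c / 2 * I Z \<le> - B (y 0) (y 0) + 2 * K\<^sup>2 / c * (L\<^sup>2 * (X + \<tau>)\<^sup>2 * V2)"
    if X: "\<And>t. 0 \<le> t \<Longrightarrow> norm (v t) \<le> X" and Z: "0 \<le> Z" for X Z
    unfolding I_def
  proof (rule weighted_energy_estimate[where f = "\<lambda>t. L * (norm (v t) + \<tau>) * norm (V t)" and C = C and y' = y'])
    show "continuous_on {0..} (\<lambda>t. L * (norm (v t) + \<tau>) * norm (V t))"
      by (intro continuous_intros vc Vc)
    fix Z :: real assume Z: "0 \<le> Z"
    have "integral {0..Z} (\<lambda>t. (exp (rate * t) * (L * (norm (v t) + \<tau>) * norm (V t)))\<^sup>2)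
       \<le> integral {0..Z} (\<lambda>t. (L\<^sup>2 * (X + \<tau>)\<^sup>2) * (exp (rate * t) * norm (V t))\<^sup>2)"
    proof (rule integral_le)
      show "(\<lambda>t. (exp (rate * t) * (L * (norm (v t) + \<tau>) * norm (V t)))\<^sup>2) integrable_on {0..Z}"
        by (intro integrable_continuous_interval continuous_intros continuous_on_subset[OF vc] continuous_on_subset[OF Vc]) auto
      show "(\<lambda>t. (L\<^sup>2 * (X + \<tau>)\<^sup>2) * (exp (rate * t) * norm (V t))\<^sup>2) integrable_on {0..Z}"
        by (intro integrable_continuous_interval continuous_intros continuous_on_subset[OF Vc]) auto
      fix t assume "t \<in> {0..Z}"
      then have "norm (v t) \<le> X" using X by simp
      then have "(norm (v t) + \<tau>)\<^sup>2 \<le> (X + \<tau>)\<^sup>2"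
        using nonneg by (intro power_mono) auto
      then have "(norm (v t) + \<tau>)\<^sup>2 * (L\<^sup>2 * (exp (rate * t) * norm (V t))\<^sup>2) \<le> (X + \<tau>)\<^sup>2 * (L\<^sup>2 * (exp (rate * t) * norm (V t))\<^sup>2)"
        by (intro mult_right_mono) auto
      then show "(exp (rate * t) * (L * (norm (v t) + \<tau>) * norm (V t)))\<^sup>2 \<le> (L\<^sup>2 * (X + \<tau>)\<^sup>2) * (exp (rate * t) * norm (V t))\<^sup>2"
        by (simp add: power_mult_distrib mult_ac)
    qed
    also have "\<dots> = L\<^sup>2 * (X + \<tau>)\<^sup>2 * ?J Z" by simp
    also have "\<dots> \<le> L\<^sup>2 * (X + \<tau>)\<^sup>2 * V2"
      by (intro mult_left_mono V2 Z) auto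
    finally show "integral {0..Z} (\<lambda>t. (exp (rate * t) * (L * (norm (v t) + \<tau>) * norm (V t)))\<^sup>2) \<le> L\<^sup>2 * (X + \<tau>)\<^sup>2 * V2" .
  qed (use y By y_bounded Z in auto)
  (* The crude bound on v only serves to make the supremum S finite. *)
  obtain X0 where "\<And>t. 0 \<le> t \<Longrightarrow> norm (v t) \<le> X0"
    using bounded_of_limit_at_top[OF vc lim] by blast
  from est[OF this] have bdd: "bdd_above (I ` {0..})"
    using cpos by (intro bdd_aboveI2[where M = "(- B (y 0) (y 0) + 2 * K\<^sup>2 / c * (L\<^sup>2 * (X0 + \<tau>)\<^sup>2 * V2)) / (c / 2)"])
      (simp add: field_simps)
  define S where "S = (SUP Z\<in>{0..}. I Z)"
  have IS: "I Z \<le> S" if "0 \<le> Z" for Z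
    unfolding S_def by (rule cSUP_upper[OF _ bdd]) (use that in simp)
  have S0: "0 \<le> S" using IS[of 0] by (simp add: I_def)
  define X where "X = norm l + tail_const * sqrt S"
  have vX: "norm (v t) \<le> X" if "0 \<le> t" for t
  proof -
    have "norm (v t - l) \<le> tail_const * sqrt S * exp (- rate * t)"
      by (rule tail_estimate[OF v yc lim _ that]) (use IS in \<open>auto simp: I_def\<close>)
    also have "\<dots> \<le> tail_const * sqrt S * 1"
      using tail_const_pos S0 rate_pos that by (intro mult_left_mono) auto
    finally show ?thesis
      unfolding X_def using norm_triangle_sub[of "v t" l] by simp
  qed
  let ?k = tail_const and ?n = "norm l + \<tau>"
  have coef: "2 * K\<^sup>2 / c * (L\<^sup>2 * V2) \<le> c / (8 * ?k\<^sup>2)"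
  proof -
    have "2 * K\<^sup>2 / c * (L\<^sup>2 * V2) = 32 * K ^ 3 * L\<^sup>2 * ?k\<^sup>2 * R\<^sup>2 / (8 * c\<^sup>2 * ?k\<^sup>2)"
      unfolding V2_def using cpos tail_const_pos by (simp add: field_simps power2_eq_square power3_eq_cube)
    also have "\<dots> \<le> c ^ 3 / (8 * c\<^sup>2 * ?k\<^sup>2)"
      by (rule divide_right_mono[OF small]) auto
    also have "\<dots> = c / (8 * ?k\<^sup>2)"
      using cpos by (simp add: field_simps power2_eq_square power3_eq_cube)
    finally show ?thesis .
  qed
  have sq: "(X + \<tau>)\<^sup>2 \<le> 2 * ?n\<^sup>2 + 2 * (?k\<^sup>2 * S)"
  proof -
    have "(?k * sqrt S)\<^sup>2 = ?k\<^sup>2 * S" using S0 by (simp add: power_mult_distrib)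
    moreover have "X + \<tau> = ?n + ?k * sqrt S" by (simp add: X_def)
    moreover have "(p + r)\<^sup>2 \<le> 2 * p\<^sup>2 + 2 * r\<^sup>2" for p r :: real
      using sum_squares_bound[of p r] by (simp add: power2_sum)
    ultimately show ?thesis by metis
  qed
  have half: "c / 2 * I Z \<le> - B (y 0) (y 0) + c / (4 * ?k\<^sup>2) * ?n\<^sup>2 + c / 4 * S" if "0 \<le> Z" for Z
  proof -
    have "c / 2 * I Z \<le> - B (y 0) (y 0) + (2 * K\<^sup>2 / c * (L\<^sup>2 * V2)) * (X + \<tau>)\<^sup>2"
      using est[OF vX that] by (simp add: mult_ac)
    also have "(2 * K\<^sup>2 / c * (L\<^sup>2 * V2)) * (X + \<tau>)\<^sup>2 \<le> c / (8 * ?k\<^sup>2) * (2 * ?n\<^sup>2 + 2 * (?k\<^sup>2 * S))"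
      by (rule mult_mono[OF coef sq]) (use cpos in auto)
    also have "\<dots> = c / (4 * ?k\<^sup>2) * ?n\<^sup>2 + c / 4 * S"
      using tail_const_pos by (simp add: field_simps)
    finally show ?thesis by simp
  qed
  have "I Z \<le> (- B (y 0) (y 0) + c / (4 * ?k\<^sup>2) * ?n\<^sup>2 + c / 4 * S) / (c / 2)" if "0 \<le> Z" for Z
    using half[OF that] cpos by (simp add: pos_le_divide_eq mult.commute)
  then have "S \<le> (- B (y 0) (y 0) + c / (4 * ?k\<^sup>2) * ?n\<^sup>2 + c / 4 * S) / (c / 2)"
    unfolding S_def by (intro cSUP_least) auto
  then have "c / 2 * S \<le> - B (y 0) (y 0) + c / (4 * ?k\<^sup>2) * ?n\<^sup>2 + c / 4 * S"
    using cpos by (simp add: pos_le_divide_eq mult.commute)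
  then have "c / 4 * S \<le> - B (y 0) (y 0) + c / (4 * ?k\<^sup>2) * ?n\<^sup>2"
    by linarith
  moreover have "c / 4 * I Z \<le> c / 4 * S"
    using IS[OF Z] cpos by simp
  ultimately show ?thesis unfolding I_def by linarith
qed

end

text \<open>During a time \<open>1 / (4 * a)\<close> the derivative \<open>y\<close> hardly changes its size, so that \<open>v\<close> moves by about
  \<open>norm (y t) / (4 * a)\<close>.\<close>

lemma bounded_derivative_of_bounded:
  fixes v :: "real \<Rightarrow> 'v::euclidean_space"
  assumes v: "\<And>t. 0 \<le> t \<Longrightarrow> (v has_vector_derivative y t) (at t within {0..})"
    and y: "\<And>t. 0 \<le> t \<Longrightarrow> (y has_vector_derivative y' t) (at t within {0..})"
    and y': "\<And>t. 0 \<le> t \<Longrightarrow> norm (y' t) \<le> a * norm (y t) + b"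
    and vM: "\<And>t. 0 \<le> t \<Longrightarrow> norm (v t) \<le> M" and ab: "a > 0" "b \<ge> 0" and t: "0 \<le> t"
  shows "norm (y t) \<le> 12 * a * M + b / (2 * a)"
proof -
  define h where "h = 1 / (4 * a)"
  have h: "h > 0" unfolding h_def using ab by simp
  have yc: "continuous_on {0..} y"
    using y by (auto simp: continuous_on_eq_continuous_within intro: has_vector_derivative_continuous)
  let ?I = "{t..t+h}"
  have "compact ?I" "?I \<noteq> {}" using h by auto
  moreover have "continuous_on ?I (\<lambda>s. norm (y s))"
    by (intro continuous_intros continuous_on_subset[OF yc]) (use t in auto)
  ultimately obtain s0 where s0: "s0 \<in> ?I" "\<And>s. s \<in> ?I \<Longrightarrow> norm (y s) \<le> norm (y s0)"
    using continuous_attains_sup[of ?I "\<lambda>s. norm (y s)"] by blast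
  let ?\<mu> = "norm (y s0)"
  have lip: "norm (y s - y t) \<le> ?\<mu> / 4 + b / (4 * a)" if s: "s \<in> ?I" for s
  proof -
    have "norm (y s - y t) \<le> (a * ?\<mu> + b) * norm (s - t)"
    proof (rule differentiable_bound[of ?I y "\<lambda>s k. k *\<^sub>R y' s"])
      fix r assume r: "r \<in> ?I"
      then have r0: "0 \<le> r" using t by simp
      show "(y has_derivative (\<lambda>k. k *\<^sub>R y' r)) (at r within ?I)"
        using has_vector_derivative_within_subset[OF y[OF r0], of ?I] t
        by (auto simp: has_vector_derivative_def)
      have "norm (y' r) \<le> a * ?\<mu> + b"
        using y'[OF r0] s0(2)[OF r] ab by (smt (verit) mult_left_mono)
      moreover have "onorm (\<lambda>k. k *\<^sub>R y' r) = norm (y' r)"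
        using onorm_scaleR_left[OF bounded_linear_ident, of "y' r"] by (simp add: onorm_id)
      ultimately show "onorm (\<lambda>k. k *\<^sub>R y' r) \<le> a * ?\<mu> + b" by simp
    qed (use s h in auto)
    also have "\<dots> \<le> (a * ?\<mu> + b) * h"
      using s ab by (intro mult_left_mono) auto
    also have "\<dots> = ?\<mu> / 4 + b / (4 * a)"
      unfolding h_def using ab by (simp add: field_simps)
    finally show ?thesis .
  qed
  have \<mu>: "?\<mu> \<le> norm (y t) + ?\<mu> / 4 + b / (4 * a)"
    using lip[OF s0(1)] norm_triangle_sub[of "y s0" "y t"] by linarith
  have "norm ((v (t + h) - (t + h) *\<^sub>R y t) - (v t - t *\<^sub>R y t)) \<le> (?\<mu> / 4 + b / (4 * a)) * norm ((t + h) - t)"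
  proof (rule differentiable_bound[of ?I "\<lambda>s. v s - s *\<^sub>R y t" "\<lambda>s k. k *\<^sub>R (y s - y t)"])
    fix r assume r: "r \<in> ?I"
    then have r0: "0 \<le> r" using t by simp
    have "((\<lambda>s. v s - s *\<^sub>R y t) has_vector_derivative (y r - y t)) (at r within ?I)"
      by (rule derivative_eq_intros has_vector_derivative_within_subset[OF v[OF r0]] refl | use t in force)+
    then show "((\<lambda>s. v s - s *\<^sub>R y t) has_derivative (\<lambda>k. k *\<^sub>R (y r - y t))) (at r within ?I)"
      by (simp add: has_vector_derivative_def)
    have "onorm (\<lambda>k. k *\<^sub>R (y r - y t)) = norm (y r - y t)"
      using onorm_scaleR_left[OF bounded_linear_ident, of "y r - y t"] by (simp add: onorm_id)
    then show "onorm (\<lambda>k. k *\<^sub>R (y r - y t)) \<le> ?\<mu> / 4 + b / (4 * a)"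
      using lip[OF r] by simp
  qed (use h in auto)
  then have "norm ((v (t + h) - v t) - h *\<^sub>R y t) \<le> (?\<mu> / 4 + b / (4 * a)) * h"
    using h by (simp add: algebra_simps)
  moreover have "norm (h *\<^sub>R y t) \<le> norm (v (t + h)) + norm (v t) + norm ((v (t + h) - v t) - h *\<^sub>R y t)"
  proof -
    have "norm (h *\<^sub>R y t) \<le> norm (v (t + h) - v t) + norm ((v (t + h) - v t) - h *\<^sub>R y t)"
      using norm_triangle_ineq4[of "v (t + h) - v t" "(v (t + h) - v t) - h *\<^sub>R y t"] by simp
    then show ?thesis
      using norm_triangle_ineq4[of "v (t + h)" "v t"] by linarith
  qed
  ultimately have "h * norm (y t) \<le> 2 * M + (?\<mu> / 4 + b / (4 * a)) * h"
    using vM[of t] vM[of "t + h"] t h by simp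
  moreover have "(?\<mu> / 4 + b / (4 * a)) * h \<le> (norm (y t) / 3 + b / (3 * a)) * h"
  proof (rule mult_right_mono)
    have "b / (4 * a) = (b / a) / 4" "b / (3 * a) = (b / a) / 3" by simp_all
    moreover have "0 \<le> b / a" using ab by simp
    ultimately show "?\<mu> / 4 + b / (4 * a) \<le> norm (y t) / 3 + b / (3 * a)"
      using \<mu> by linarith
  qed (use h in simp)
  ultimately have "h * norm (y t) \<le> 2 * M + (norm (y t) / 3 + b / (3 * a)) * h"
    by linarith
  then show ?thesis
    unfolding h_def using ab by (simp add: field_simps)
qed

text \<open>Gronwall's inequality, backwards in time.\<close>

lemma backward_uniqueness:
  fixes v :: "real \<Rightarrow> 'v::euclidean_space"
  assumes v: "\<And>t. t \<in> {a..b} \<Longrightarrow> (v has_vector_derivative y t) (at t within {a..b})"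
    and y: "\<And>t. t \<in> {a..b} \<Longrightarrow> (y has_vector_derivative y' t) (at t within {a..b})"
    and y': "\<And>t. t \<in> {a..b} \<Longrightarrow> norm (y' t) \<le> C * (norm (v t) + norm (y t))"
    and 0: "v b = 0" "y b = 0" and t: "t \<in> {a..b}"
  shows "v t = 0 \<and> y t = 0"
proof -
  define D where "D = max C 0"
  define k where "k = 1 + 3 * D"
  define E where "E s = (v s \<bullet> v s + y s \<bullet> y s) * exp (k * s)" for s
  define E' where "E' s = (2 * (v s \<bullet> y s) + 2 * (y s \<bullet> y' s)) * exp (k * s) + (v s \<bullet> v s + y s \<bullet> y s) * (k * exp (k * s))" for s
  have "E t \<le> E b"
  proof (rule nondecreasing_on_interval[where f = E and f' = E'])
    fix s assume "s \<in> {t..b}"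
    then have s: "s \<in> {a..b}" using t by simp
    have "(E has_vector_derivative E' s) (at s within {a..b})"
      unfolding E_def E'_def
      by (rule derivative_eq_intros v y s refl has_vector_derivative_mult
            bounded_bilinear.has_vector_derivative[OF bounded_bilinear_inner] | simp add: algebra_simps inner_commute
           | simp flip: has_real_derivative_iff_has_vector_derivative)+
    then show "(E has_vector_derivative E' s) (at s within {t..b})"
      by (rule has_vector_derivative_within_subset) (use t in auto)
    let ?v = "norm (v s)" and ?y = "norm (y s)"
    have sq: "2 * (?v * ?y) \<le> ?v\<^sup>2 + ?y\<^sup>2"
      using sum_squares_bound[of ?v ?y] by simp
    have "\<bar>v s \<bullet> y s\<bar> \<le> ?v * ?y"
      by (rule Cauchy_Schwarz_ineq2)
    moreover have "\<bar>y s \<bullet> y' s\<bar> \<le> ?y * (D * (?v + ?y))"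
    proof -
      have "\<bar>y s \<bullet> y' s\<bar> \<le> ?y * norm (y' s)"
        by (rule Cauchy_Schwarz_ineq2)
      moreover have "norm (y' s) \<le> D * (?v + ?y)"
        using y'[OF s] mult_right_mono[of C D "?v + ?y"] unfolding D_def by fastforce
      ultimately show ?thesis by (meson mult_left_mono norm_ge_zero order_trans)
    qed
    moreover have "2 * (?y * (D * (?v + ?y))) \<le> D * (?v\<^sup>2 + ?y\<^sup>2) + 2 * D * (?v\<^sup>2 + ?y\<^sup>2)"
    proof -
      have "D * (2 * (?v * ?y)) \<le> D * (?v\<^sup>2 + ?y\<^sup>2)"
        using sq by (intro mult_left_mono) (auto simp: D_def)
      moreover have "0 \<le> 2 * D * ?v\<^sup>2" by (simp add: D_def)
      ultimately show ?thesis by (simp add: algebra_simps power2_eq_square)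
    qed
    ultimately have "0 \<le> 2 * (v s \<bullet> y s) + 2 * (y s \<bullet> y' s) + k * (?v\<^sup>2 + ?y\<^sup>2)"
      using sq unfolding k_def by (simp add: algebra_simps)
    then have "0 \<le> (2 * (v s \<bullet> y s) + 2 * (y s \<bullet> y' s) + k * (v s \<bullet> v s + y s \<bullet> y s)) * exp (k * s)"
      by (simp add: power2_norm_eq_inner)
    then show "0 \<le> E' s"
      unfolding E'_def by (simp add: algebra_simps)
  qed (use t in auto)
  then have "v t \<bullet> v t + y t \<bullet> y t \<le> 0"
    unfolding E_def using 0 by (simp add: mult_le_0_iff)
  then have "v t \<bullet> v t = 0" "y t \<bullet> y t = 0"
    using inner_ge_zero[of "v t"] inner_ge_zero[of "y t"] by linarith+
  then show ?thesis by simp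
qed

section \<open>Smooth maps on arbitrary sets\<close>

lemma Ck_on_cong:
  "\<lbrakk>open S; \<And>x. x \<in> S \<Longrightarrow> f x = g x; Ck_on k S f\<rbrakk> \<Longrightarrow> Ck_on k S g"
proof (induction k arbitrary: f g)
  case 0
  then show ?case by (simp cong: continuous_on_cong)
next
  case (Suc k)
  have der: "(g has_derivative frechet_derivative f (at x)) (at x)" if "x \<in> S" for x
  proof (rule has_derivative_transform_within_open)
    show "(f has_derivative frechet_derivative f (at x)) (at x)"
      using Suc.prems(3) that unfolding frechet_derivative_works[symmetric] by simp
  qed (use Suc.prems that in auto)
  have eq: "frechet_derivative g (at x) = frechet_derivative f (at x)" if "x \<in> S" for x
    using frechet_derivative_at[OF der[OF that]] by (rule sym)
  have "Ck_on k S (\<lambda>x. frechet_derivative g (at x) v)" for v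
  proof (rule Suc.IH)
    show "open S" by fact
    show "Ck_on k S (\<lambda>x. frechet_derivative f (at x) v)" using Suc.prems(3) by simp
  qed (simp add: eq)
  moreover have "g differentiable (at x)" if "x \<in> S" for x
    using der[OF that] unfolding differentiable_def by blast
  ultimately show ?case by simp
qed

lemma Ck_on_compose_affine:
  fixes L :: "'a::real_normed_vector \<Rightarrow> 'b::real_normed_vector"
  assumes L: "bounded_linear L" and S: "open S"
  shows "Ck_on k S f \<Longrightarrow> Ck_on k {x. b + L x \<in> S} (\<lambda>x. f (b + L x))"
proof (induction k arbitrary: f)
  case 0
  then show ?case
    by (auto intro!: continuous_on_compose2[of S f] continuous_intros bounded_linear.continuous_on[OF L])
next
  case (Suc k)
  let ?T = "{x. b + L x \<in> S}"
  have h: "((\<lambda>x. b + L x) has_derivative L) (at x)" for x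
    by (rule derivative_eq_intros bounded_linear_imp_has_derivative[OF L] refl | simp)+
  have "continuous_on UNIV (\<lambda>x. b + L x)"
    by (intro continuous_intros bounded_linear.continuous_on[OF L])
  then have T: "open ?T"
    using open_vimage[OF S, of "\<lambda>x. b + L x"] by (simp add: vimage_def)
  have der: "((\<lambda>x. f (b + L x)) has_derivative (\<lambda>v. frechet_derivative f (at (b + L x)) (L v))) (at x)"
    if "x \<in> ?T" for x
  proof -
    have "(f has_derivative frechet_derivative f (at (b + L x))) (at (b + L x))"
      using Suc.prems that unfolding frechet_derivative_works[symmetric] by simp
    from has_derivative_compose[OF h this] show ?thesis .
  qed
  have "Ck_on k ?T (\<lambda>x. frechet_derivative (\<lambda>x. f (b + L x)) (at x) v)" for v
  proof (rule Ck_on_cong[OF T])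
    show "Ck_on k ?T (\<lambda>x. frechet_derivative f (at (b + L x)) (L v))"
      by (rule Suc.IH[of "\<lambda>y. frechet_derivative f (at y) (L v)"]) (use Suc.prems in simp)
    show "frechet_derivative f (at (b + L x)) (L v) = frechet_derivative (\<lambda>x. f (b + L x)) (at x) v"
      if "x \<in> ?T" for x
      using frechet_derivative_at[OF der[OF that]] by metis
  qed
  moreover have "(\<lambda>x. f (b + L x)) differentiable (at x)" if "x \<in> ?T" for x
    using der[OF that] unfolding differentiable_def by blast
  ultimately show ?case by simp
qed

lemma smooth_onE:
  assumes "smooth_on S f" "x \<in> S"
  obtains U g where "open U" "x \<in> U" "\<And>k. Ck_on k U g" "\<And>y. \<lbrakk>y \<in> U; y \<in> S\<rbrakk> \<Longrightarrow> g y = f y"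
proof -
  from assms have "\<exists>U g. open U \<and> x \<in> U \<and> (\<forall>k. Ck_on k U g) \<and> (\<forall>y\<in>U \<inter> S. g y = f y)"
    by (simp add: smooth_on_def)
  then obtain U g where "open U" "x \<in> U" "\<forall>k. Ck_on k U g" "\<forall>y\<in>U \<inter> S. g y = f y"
    by (elim exE conjE)
  then show thesis by (intro that[of U g]) simp_all
qed

lemma smooth_on_localI:
  assumes "\<And>x. x \<in> S \<Longrightarrow> \<exists>U g. open U \<and> x \<in> U \<and> (\<forall>k. Ck_on k U g) \<and> (\<forall>y. y \<in> U \<longrightarrow> y \<in> S \<longrightarrow> g y = f y)"
  shows "smooth_on S f"
  unfolding smooth_on_def
proof
  fix x assume "x \<in> S"
  from assms[OF this] obtain U g where "open U" "x \<in> U" "\<forall>k. Ck_on k U g" "\<forall>y. y \<in> U \<longrightarrow> y \<in> S \<longrightarrow> g y = f y"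
    by (elim exE conjE)
  then show "\<exists>U g. open U \<and> x \<in> U \<and> (\<forall>k. Ck_on k U g) \<and> (\<forall>y\<in>U \<inter> S. g y = f y)"
    by (intro exI[of _ U] exI[of _ g]) simp
qed

lemma smooth_on_compose_affine:
  fixes L :: "'a::real_normed_vector \<Rightarrow> 'b::real_normed_vector"
  assumes f: "smooth_on S f" and L: "bounded_linear L" and T: "\<And>x. x \<in> T \<Longrightarrow> b + L x \<in> S"
  shows "smooth_on T (\<lambda>x. f (b + L x))"
proof (rule smooth_on_localI)
  fix x assume "x \<in> T"
  then obtain U g where U: "open U" "b + L x \<in> U" "\<And>k. Ck_on k U g" "\<And>y. \<lbrakk>y \<in> U; y \<in> S\<rbrakk> \<Longrightarrow> g y = f y"
    using smooth_onE[OF f T] by metis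
  have "continuous_on UNIV (\<lambda>x. b + L x)"
    by (intro continuous_intros bounded_linear.continuous_on[OF L])
  then have "open {x. b + L x \<in> U}"
    using open_vimage[OF U(1), of "\<lambda>x. b + L x"] by (simp add: vimage_def)
  moreover have "Ck_on k {x. b + L x \<in> U} (\<lambda>x. g (b + L x))" for k
    by (rule Ck_on_compose_affine[OF L U(1) U(3)])
  moreover have "g (b + L y) = f (b + L y)" if "b + L y \<in> U" "y \<in> T" for y
    using U(4) T that by blast
  ultimately show "\<exists>U g. open U \<and> x \<in> U \<and> (\<forall>k. Ck_on k U g) \<and> (\<forall>y. y \<in> U \<longrightarrow> y \<in> T \<longrightarrow> g y = f (b + L y))"
    using U(2) by (intro exI[of _ "{x. b + L x \<in> U}"] exI[of _ "\<lambda>x. g (b + L x)"]) simp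
qed

lemma smooth_on_has_derivative:
  assumes f: "smooth_on S f" and x: "x \<in> S"
  obtains D where "(f has_derivative D) (at x within S)"
proof -
  obtain U g where U: "open U" "x \<in> U" "\<And>k. Ck_on k U g" "\<And>y. \<lbrakk>y \<in> U; y \<in> S\<rbrakk> \<Longrightarrow> g y = f y"
    using smooth_onE[OF f x] by metis
  have "g differentiable (at x)"
    using U(2) U(3)[of "Suc 0"] by simp
  then have "(g has_derivative frechet_derivative g (at x)) (at x within S)"
    unfolding frechet_derivative_works by (rule has_derivative_at_withinI)
  moreover have "eventually (\<lambda>y. g y = f y) (at x within S)"
    unfolding eventually_at_topological using U(1,2,4) by metis
  ultimately have "(f has_derivative frechet_derivative g (at x)) (at x within S)"
    by (rule has_derivative_transform_eventually) (use U x in auto)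
  then show ?thesis by (rule that)
qed

lemma smooth_on_imp_continuous_on:
  assumes "smooth_on S f" shows "continuous_on S f"
  unfolding continuous_on_eq_continuous_within
proof
  fix x assume "x \<in> S"
  then obtain D where "(f has_derivative D) (at x within S)"
    using smooth_on_has_derivative[OF assms] by metis
  then show "continuous (at x within S) f"
    by (rule has_derivative_continuous)
qed

lemma has_vector_derivative_along:
  assumes f: "(f has_derivative D) (at x within S)"
    and \<gamma>: "(\<gamma> has_vector_derivative v) (at t within I)" and "\<gamma> t = x" "\<gamma> ` I \<subseteq> S"
  shows "((\<lambda>t. f (\<gamma> t)) has_vector_derivative D v) (at t within I)"
proof -
  have "(f has_derivative D) (at (\<gamma> t) within \<gamma> ` I)"
    using f assms(3,4) has_derivative_subset by metis
  from has_derivative_in_compose[OF \<gamma>[unfolded has_vector_derivative_def] this]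
  show ?thesis
    using linear_scale[OF has_derivative_linear[OF f]] by (simp add: has_vector_derivative_def)
qed

text \<open>The directional derivative of a local smooth extension is smooth.  At a point of \<open>S\<close> it is
  determined by \<open>f\<close> alone as soon as the point can be approached inside \<open>S\<close> along the direction.\<close>

lemma smooth_on_directional_derivative:
  assumes f: "smooth_on S f" and lim: "\<And>x. x \<in> S \<Longrightarrow> 0 islimpt {t. x + t *\<^sub>R v \<in> S}"
    and f': "\<And>x. x \<in> S \<Longrightarrow> ((\<lambda>t. f (x + t *\<^sub>R v)) has_vector_derivative f' x) (at 0 within {t. x + t *\<^sub>R v \<in> S})"
  shows "smooth_on S f'"
proof (rule smooth_on_localI)
  fix x assume "x \<in> S"
  then obtain U g where U: "open U" "x \<in> U" "\<And>k. Ck_on k U g" "\<And>y. \<lbrakk>y \<in> U; y \<in> S\<rbrakk> \<Longrightarrow> g y = f y"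
    using smooth_onE[OF f] by metis
  have "frechet_derivative g (at y) v = f' y" if y: "y \<in> U \<inter> S" for y
  proof -
    let ?I = "{t. y + t *\<^sub>R v \<in> S}"
    have "(g has_derivative frechet_derivative g (at y)) (at y)"
      using y U(3)[of "Suc 0"] unfolding frechet_derivative_works[symmetric] by simp
    moreover have line: "((\<lambda>t. y + t *\<^sub>R v) has_vector_derivative v) (at 0 within ?I)"
      by (rule derivative_eq_intros refl | simp)+
    ultimately have "((\<lambda>t. g (y + t *\<^sub>R v)) has_vector_derivative frechet_derivative g (at y) v) (at 0 within ?I)"
      by (rule has_vector_derivative_along) auto
    moreover have "eventually (\<lambda>t. g (y + t *\<^sub>R v) = f (y + t *\<^sub>R v)) (at 0 within ?I)"
    proof -
      have "((\<lambda>t. y + t *\<^sub>R v) \<longlongrightarrow> y + 0 *\<^sub>R v) (at 0 within ?I)"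
        by (intro tendsto_intros)
      then have "eventually (\<lambda>t. y + t *\<^sub>R v \<in> U) (at 0 within ?I)"
        by (rule topological_tendstoD[OF _ U(1)]) (use y in simp)
      moreover have "eventually (\<lambda>t. t \<in> ?I) (at 0 within ?I)"
        by (auto simp: eventually_at_filter)
      ultimately show ?thesis
        by eventually_elim (use U(4) in auto)
    qed
    ultimately have "((\<lambda>t. f (y + t *\<^sub>R v)) has_vector_derivative frechet_derivative g (at y) v) (at 0 within ?I)"
      unfolding has_vector_derivative_def
      by (rule has_derivative_transform_eventually) (use y U(4) in auto)
    moreover have "at 0 within ?I \<noteq> bot"
      using lim[of y] y by (simp add: trivial_limit_within)
    moreover have "((\<lambda>t. f (y + t *\<^sub>R v)) has_vector_derivative f' y) (at 0 within ?I)"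
      by (rule f') (use y in simp)
    ultimately show ?thesis
      using vector_derivative_unique_within by metis
  qed
  moreover have "Ck_on k U (\<lambda>y. frechet_derivative g (at y) v)" for k
    using U(3)[of "Suc k"] by simp
  ultimately show "\<exists>U g. open U \<and> x \<in> U \<and> (\<forall>k. Ck_on k U g) \<and> (\<forall>y. y \<in> U \<longrightarrow> y \<in> S \<longrightarrow> g y = f' y)"
    using U(1,2) by (intro exI[of _ U] exI[of _ "\<lambda>y. frechet_derivative g (at y) v"]) simp
qed

lemma has_vector_derivative_shift_origin:
  assumes "(f has_vector_derivative d) (at t within J)"
  shows "((\<lambda>s. f (t + s)) has_vector_derivative d) (at 0 within {s. t + s \<in> J})"
proof -
  have "((\<lambda>s. t + s) has_vector_derivative 1) (at 0 within {s. t + s \<in> J})"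
    by (rule derivative_eq_intros refl | simp)+
  moreover have "(f has_vector_derivative d) (at (t + 0) within (\<lambda>s. t + s) ` {s. t + s \<in> J})"
    by (rule has_vector_derivative_within_subset[of _ _ _ J]) (use assms in auto)
  ultimately have "(f \<circ> (\<lambda>s. t + s) has_vector_derivative 1 *\<^sub>R d) (at 0 within {s. t + s \<in> J})"
    by (rule vector_diff_chain_within)
  then show ?thesis by (simp add: o_def)
qed

lemma islimpt_shift_origin:
  fixes t :: real
  assumes "t islimpt J" shows "0 islimpt {s. t + s \<in> J}"
  unfolding islimpt_approachable
proof (intro allI impI)
  fix e :: real assume "e > 0"
  then obtain r where "r \<in> J" "r \<noteq> t" "dist r t < e"
    using assms by (auto simp: islimpt_approachable)
  then show "\<exists>x'\<in>{s. t + s \<in> J}. x' \<noteq> 0 \<and> dist x' 0 < e"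
    by (intro bexI[of _ "r - t"]) (auto simp: dist_real_def)
qed

lemma smooth_on_partial_fst:
  fixes F :: "real \<times> 'p::real_normed_vector \<Rightarrow> 'b::real_normed_vector"
  assumes F: "smooth_on (J \<times> P) F" and J: "\<And>t. t \<in> J \<Longrightarrow> t islimpt J"
    and F': "\<And>t p. \<lbrakk>t \<in> J; p \<in> P\<rbrakk> \<Longrightarrow> ((\<lambda>t. F (t, p)) has_vector_derivative F' (t, p)) (at t within J)"
  shows "smooth_on (J \<times> P) F'"
proof (rule smooth_on_directional_derivative[OF F, where v = "(1, 0)"])
  fix x assume "x \<in> J \<times> P"
  then obtain t p where x: "x = (t, p)" "t \<in> J" "p \<in> P" by auto
  show "0 islimpt {s. x + s *\<^sub>R (1, 0) \<in> J \<times> P}"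
    using islimpt_shift_origin[OF J[OF x(2)]] x by simp
  show "((\<lambda>s. F (x + s *\<^sub>R (1, 0))) has_vector_derivative F' x) (at 0 within {s. x + s *\<^sub>R (1, 0) \<in> J \<times> P})"
    using has_vector_derivative_shift_origin[OF F'[OF x(2,3)]] x by simp
qed

lemma smooth_on_partial_snd:
  fixes F :: "'p::real_normed_vector \<times> real \<Rightarrow> 'b::real_normed_vector"
  assumes F: "smooth_on (P \<times> J) F" and J: "\<And>t. t \<in> J \<Longrightarrow> t islimpt J"
    and F': "\<And>t p. \<lbrakk>t \<in> J; p \<in> P\<rbrakk> \<Longrightarrow> ((\<lambda>t. F (p, t)) has_vector_derivative F' (p, t)) (at t within J)"
  shows "smooth_on (P \<times> J) F'"
proof (rule smooth_on_directional_derivative[OF F, where v = "(0, 1)"])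
  fix x assume "x \<in> P \<times> J"
  then obtain t p where x: "x = (p, t)" "t \<in> J" "p \<in> P" by auto
  show "0 islimpt {s. x + s *\<^sub>R (0, 1) \<in> P \<times> J}"
    using islimpt_shift_origin[OF J[OF x(2)]] x by simp
  show "((\<lambda>s. F (x + s *\<^sub>R (0, 1))) has_vector_derivative F' x) (at 0 within {s. x + s *\<^sub>R (0, 1) \<in> P \<times> J})"
    using has_vector_derivative_shift_origin[OF F'[OF x(2,3)]] x by simp
qed

lemma smooth_on_slice_differentiable:
  fixes F :: "real \<times> 'p::real_normed_vector \<Rightarrow> 'b::real_normed_vector"
  assumes F: "smooth_on (J \<times> P) F" and "t \<in> J" "p \<in> P"
  shows "((\<lambda>t. F (t, p)) has_vector_derivative vector_derivative (\<lambda>t. F (t, p)) (at t within J)) (at t within J)"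
proof -
  obtain D where "(F has_derivative D) (at (t, p) within J \<times> P)"
    using smooth_on_has_derivative[OF F] assms(2,3) by blast
  moreover have "((\<lambda>t. (t, p)) has_vector_derivative (1, 0)) (at t within J)"
    by (rule derivative_eq_intros has_vector_derivative_Pair refl | simp)+
  ultimately have "((\<lambda>t. F (t, p)) has_vector_derivative D (1, 0)) (at t within J)"
    by (rule has_vector_derivative_along) (use assms in auto)
  then show ?thesis
    by (simp add: differentiableI_vector vector_derivative_works[symmetric])
qed

text \<open>Write \<open>F (t, \<theta>)\<close> as \<open>F (a, \<theta>)\<close> plus the integral of \<open>F1\<close>, and differentiate under the integral
  sign.  The interval is closed at \<open>a\<close>, where the derivatives are one-sided.\<close>

lemma mixed_partials_commute:
  fixes F :: "real \<times> real \<Rightarrow> 'b::euclidean_space"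
  assumes I: "open I" "convex I"
    and F1: "\<And>t \<theta>. \<lbrakk>t \<in> {a..}; \<theta> \<in> I\<rbrakk> \<Longrightarrow> ((\<lambda>t. F (t, \<theta>)) has_vector_derivative F1 (t, \<theta>)) (at t within {a..})"
    and F2: "\<And>t \<theta>. \<lbrakk>t \<in> {a..}; \<theta> \<in> I\<rbrakk> \<Longrightarrow> ((\<lambda>\<theta>. F (t, \<theta>)) has_vector_derivative F2 (t, \<theta>)) (at \<theta>)"
    and F12: "\<And>t \<theta>. \<lbrakk>t \<in> {a..}; \<theta> \<in> I\<rbrakk> \<Longrightarrow> ((\<lambda>\<theta>. F1 (t, \<theta>)) has_vector_derivative F12 (t, \<theta>)) (at \<theta>)"
    and c1: "continuous_on ({a..} \<times> I) F1" and c12: "continuous_on ({a..} \<times> I) F12"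
    and t: "t \<in> {a..}" and \<theta>: "\<theta> \<in> I"
  shows "((\<lambda>t. F2 (t, \<theta>)) has_vector_derivative F12 (t, \<theta>)) (at t within {a..})"
proof -
  have c1s: "continuous_on {a..s} (\<lambda>r. F1 (r, \<eta>))" if "\<eta> \<in> I" for \<eta> s
    by (rule continuous_on_compose2[OF c1]) (use that in \<open>auto intro!: continuous_intros\<close>)
  have c12s: "continuous_on {a..s} (\<lambda>r. F12 (r, \<theta>))" for s
    by (rule continuous_on_compose2[OF c12]) (use \<theta> in \<open>auto intro!: continuous_intros\<close>)
  have int: "F2 (s, \<theta>) = F2 (a, \<theta>) + integral {a..s} (\<lambda>r. F12 (r, \<theta>))" if s: "a \<le> s" for s
  proof -
    have FTC: "F (s, \<eta>) = F (a, \<eta>) + integral {a..s} (\<lambda>r. F1 (r, \<eta>))" if "\<eta> \<in> I" for \<eta>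
    proof -
      have "((\<lambda>r. F1 (r, \<eta>)) has_integral F (s, \<eta>) - F (a, \<eta>)) {a..s}"
        by (rule fundamental_theorem_of_calculus[OF s])
           (rule has_vector_derivative_within_subset[OF F1], use that in auto)
      then show ?thesis by (simp add: integral_unique)
    qed
    have "((\<lambda>\<eta>. integral (cbox a s) (\<lambda>r. F1 (r, \<eta>))) has_vector_derivative integral (cbox a s) (\<lambda>r. F12 (r, \<theta>))) (at \<theta> within I)"
    proof (rule leibniz_rule_vector_derivative)
      show "((\<lambda>\<eta>. F1 (r, \<eta>)) has_vector_derivative F12 (r, \<eta>)) (at \<eta> within I)"
        if "\<eta> \<in> I" "r \<in> cbox a s" for \<eta> r
        using F12[of r \<eta>] that by (auto intro: has_vector_derivative_at_within)
      show "(\<lambda>r. F1 (r, \<eta>)) integrable_on cbox a s" if "\<eta> \<in> I" for \<eta>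
        using c1s[OF that] by (auto intro: integrable_continuous_interval)
      show "continuous_on (I \<times> cbox a s) (\<lambda>(\<eta>, r). F12 (r, \<eta>))"
        unfolding split_beta
        by (rule continuous_on_compose2[OF c12]) (auto intro!: continuous_intros)
    qed (use \<theta> I in auto)
    then have "((\<lambda>\<eta>. integral {a..s} (\<lambda>r. F1 (r, \<eta>))) has_vector_derivative integral {a..s} (\<lambda>r. F12 (r, \<theta>))) (at \<theta>)"
      using at_within_open[OF \<theta> I(1)] by simp
    then have "((\<lambda>\<eta>. F (a, \<eta>) + integral {a..s} (\<lambda>r. F1 (r, \<eta>))) has_vector_derivative F2 (a, \<theta>) + integral {a..s} (\<lambda>r. F12 (r, \<theta>))) (at \<theta>)"
      by (intro has_vector_derivative_add F2) (use \<theta> in auto)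
    then have "((\<lambda>\<eta>. F (s, \<eta>)) has_vector_derivative F2 (a, \<theta>) + integral {a..s} (\<lambda>r. F12 (r, \<theta>))) (at \<theta>)"
      by (rule has_vector_derivative_transform_within_open[OF _ I(1) \<theta>]) (simp add: FTC)
    with F2[of s \<theta>] s \<theta> show ?thesis
      using vector_derivative_unique_at by fastforce
  qed
  have "((\<lambda>s. integral {a..s} (\<lambda>r. F12 (r, \<theta>))) has_vector_derivative F12 (t, \<theta>)) (at t within {a..t+1})"
    by (rule integral_has_vector_derivative[OF c12s[of "t + 1"]]) (use t in auto)
  then have "((\<lambda>s. F2 (a, \<theta>) + integral {a..s} (\<lambda>r. F12 (r, \<theta>))) has_vector_derivative 0 + F12 (t, \<theta>)) (at t within {a..t+1})"
    by (intro has_vector_derivative_add has_vector_derivative_const)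
  then have "((\<lambda>s. F2 (a, \<theta>) + integral {a..s} (\<lambda>r. F12 (r, \<theta>))) has_vector_derivative F12 (t, \<theta>)) (at t within {a..t+1})"
    by simp
  then have "((\<lambda>s. F2 (s, \<theta>)) has_vector_derivative F12 (t, \<theta>)) (at t within {a..t+1})"
  proof (rule has_vector_derivative_transform[rotated 2])
    show "F2 (s, \<theta>) = F2 (a, \<theta>) + integral {a..s} (\<lambda>r. F12 (r, \<theta>))" if "s \<in> {a..t+1}" for s
      by (rule int) (use that in simp)
  qed (use t in simp)
  moreover have "at t within {a..t+1} = at t within {a..}"
    by (rule at_within_nhd[where S = "{..<t+1}"]) auto
  ultimately show ?thesis by simp
qed

text \<open>The inverse chart maps straight segments in the model space to curves in \<open>C\<close>.\<close>

lemma submanifold_tangent_directions: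
  fixes C :: "'a::euclidean_space set"
  assumes C: "smooth_submanifold m C" and x: "x \<in> C"
  obtains X where "subspace X" "dim X = m" "X \<subseteq> tangent_space C x"
proof -
  obtain U V :: "'a set" and f g T where UV: "open U" "open V" "x \<in> U" "homeomorphism U V f g"
      and f: "smooth_on U f" and g: "smooth_on V g" and T: "subspace T" "dim T = m" "f ` (C \<inter> U) = V \<inter> T"
    using C x unfolding smooth_submanifold_def by metis
  have fx: "f x \<in> V" "f x \<in> T" using T(3) x UV(3) by auto
  have gf: "g (f y) = y" if "y \<in> U" for y
    using UV(4) that by (simp add: homeomorphism_def)
  have fg: "f (g y) = y" if "y \<in> V" for y
    using UV(4) that by (simp add: homeomorphism_def)
  obtain Dg where "(g has_derivative Dg) (at (f x) within V)"
    using smooth_on_has_derivative[OF g fx(1)] .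
  then have Dg: "(g has_derivative Dg) (at (f x))"
    using at_within_open[OF fx(1) UV(2)] by simp
  obtain Df where "(f has_derivative Df) (at x within U)"
    using smooth_on_has_derivative[OF f UV(3)] .
  then have Df: "(f has_derivative Df) (at (g (f x)))"
    using at_within_open[OF UV(3,1)] gf[OF UV(3)] by simp
  have "((\<lambda>y. f (g y)) has_derivative (\<lambda>v. Df (Dg v))) (at (f x))"
    using has_derivative_compose[OF Dg Df] .
  then have "((\<lambda>y. y) has_derivative (\<lambda>v. Df (Dg v))) (at (f x))"
    by (rule has_derivative_transform_within_open[OF _ UV(2) fx(1)]) (simp add: fg)
  then have inv: "(\<lambda>v. Df (Dg v)) = (\<lambda>v. v)"
    using has_derivative_unique has_derivative_ident by blast
  have lin: "linear Dg" using Dg by (rule has_derivative_linear)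
  show ?thesis
  proof (rule that[of "Dg ` T"])
    show "subspace (Dg ` T)" using lin T(1) by (rule linear_subspace_image)
    have "inj_on Dg (span T)" by (metis inv inj_on_inverseI)
    then show "dim (Dg ` T) = m" using dim_image_eq[OF lin] T(2) by simp
    show "Dg ` T \<subseteq> tangent_space C x"
    proof (rule image_subsetI)
      fix v assume v: "v \<in> T"
      have "((\<lambda>t::real. f x + t *\<^sub>R v) \<longlongrightarrow> f x + 0 *\<^sub>R v) (at 0)"
        by (intro tendsto_intros)
      then have "eventually (\<lambda>t::real. f x + t *\<^sub>R v \<in> V) (at 0)"
        by (rule topological_tendstoD[OF _ UV(2)]) (use fx(1) in simp)
      then obtain c where c: "c > 0" "\<And>t::real. \<lbrakk>t \<noteq> 0; dist t 0 < c\<rbrakk> \<Longrightarrow> f x + t *\<^sub>R v \<in> V"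
        by (auto simp: eventually_at)
      then have cV: "f x + t *\<^sub>R v \<in> V" if "t \<in> {-c<..<c}" for t :: real
        using that fx(1) by (cases "t = 0") (auto simp: dist_real_def)
      let ?\<gamma> = "\<lambda>t. g (f x + t *\<^sub>R v)"
      have "smooth_on {-c<..<c} ?\<gamma>"
        by (rule smooth_on_compose_affine[OF g bounded_linear_scaleR_left]) (rule cV)
      moreover have "?\<gamma> t \<in> C" if "t \<in> {-c<..<c}" for t
      proof -
        have "f x + t *\<^sub>R v \<in> f ` (C \<inter> U)"
          unfolding T(3) using cV[OF that] fx(2) v T(1) by (simp add: subspace_add subspace_scale)
        then show ?thesis using gf by auto
      qed
      moreover have "((\<lambda>t::real. f x + t *\<^sub>R v) has_vector_derivative v) (at 0)"
        by (rule derivative_eq_intros refl | simp)+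
      then have "(?\<gamma> has_vector_derivative Dg v) (at 0)"
        by (rule has_vector_derivative_along[OF Dg]) auto
      ultimately show "Dg v \<in> tangent_space C x"
        unfolding tangent_space_def using c(1) gf[OF UV(3)]
        by (intro CollectI exI[of _ c] conjI exI[of _ ?\<gamma>]) auto
    qed
  qed
qed

text \<open>Derivatives within a subspace are arbitrary transversally to it, but not along it.\<close>

lemma derivative_within_subspace_unique:
  assumes Q: "subspace Q" "x \<in> Q" "v \<in> Q"
    and D: "(f has_derivative D) (at x within Q)" "(f has_derivative D') (at x within Q)"
  shows "D v = D' v"
proof -
  have "((\<lambda>t::real. x + t *\<^sub>R v) has_vector_derivative v) (at 0)"
    by (rule derivative_eq_intros refl | simp)+
  moreover have "range (\<lambda>t::real. x + t *\<^sub>R v) \<subseteq> Q"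
    using Q by (auto intro: subspace_add subspace_scale)
  ultimately have "((\<lambda>t::real. f (x + t *\<^sub>R v)) has_vector_derivative D v) (at 0)"
      "((\<lambda>t::real. f (x + t *\<^sub>R v)) has_vector_derivative D' v) (at 0)"
    using has_vector_derivative_along[OF D(1)] has_vector_derivative_along[OF D(2)] by auto
  then show ?thesis by (rule vector_derivative_unique_at)
qed

lemma dim_kernel_of_linear:
  fixes f :: "'a::euclidean_space \<Rightarrow> 'b::euclidean_space"
  assumes f: "linear f" and S: "subspace S"
  shows "dim {x \<in> S. f x = 0} + dim (f ` S) = dim S"
proof -
  let ?K = "{x \<in> S. f x = 0}"
  have K: "subspace ?K"
    using S linear_0[OF f] linear_add[OF f] linear_scale[OF f]
    by (auto simp: subspace_def)
  let ?O = "{x \<in> S. \<forall>y\<in>?K. orthogonal y x}"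
  have O: "subspace ?O"
    using S by (auto simp: subspace_def orthogonal_clauses)
  have "dim ?O + dim ?K = dim S"
    by (rule dim_subspace_orthogonal_to_vectors[OF K S]) auto
  moreover have "f ` S = f ` ?O"
  proof (intro equalityI image_subsetI)
    fix x assume x: "x \<in> S"
    obtain a b where ab: "a \<in> span ?K" "\<And>w. w \<in> span ?K \<Longrightarrow> orthogonal b w" "x = a + b"
      using orthogonal_subspace_decomp_exists[of ?K x] by blast
    have a: "a \<in> ?K" using ab(1) K by (simp add: span_eq_iff[THEN iffD2])
    then have "b \<in> S" using x ab(3) S by (metis (mono_tags, lifting) add_diff_cancel_left' mem_Collect_eq subspace_diff)
    moreover have "orthogonal y b" if "y \<in> ?K" for y
      using ab(2)[OF span_base[OF that]] by (simp add: orthogonal_commute)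
    ultimately have "b \<in> ?O" by blast
    moreover have "f x = f b" using a ab(3) linear_add[OF f] by simp
    ultimately show "f x \<in> f ` ?O" by blast
  qed auto
  moreover have "inj_on f (span ?O)"
  proof -
    have "x = 0" if "x \<in> ?O" "f x = 0" for x
    proof -
      have "x \<in> ?K" using that by simp
      then have "orthogonal x x" using that by auto
      then show ?thesis by (simp add: orthogonal_self)
    qed
    then have "inj_on f ?O"
      using linear_injective_on_subspace_0[OF f O] by auto
    then show ?thesis using O by (simp add: span_eq_iff[THEN iffD2])
  qed
  then have "dim (f ` ?O) = dim ?O" by (rule dim_image_eq[OF f])
  ultimately show ?thesis by simp
qed

section \<open>Hyperbolicity near the end states\<close>

lemma bounded_bilinear_matrix_vector: "bounded_bilinear ((*v) :: real^'n^'m \<Rightarrow> real^'n \<Rightarrow> real^'m)"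
  unfolding bilinear_conv_bounded_bilinear[symmetric] bilinear_def
  by (intro conjI allI linearI)
     (simp_all add: vec_eq_iff matrix_vector_mult_def sum.distrib distrib_left distrib_right sum_distrib_left mult_ac)

interpretation mv: bounded_bilinear "(*v) :: real^'n^'m \<Rightarrow> real^'n \<Rightarrow> real^'m"
  by (rule bounded_bilinear_matrix_vector)

definition lipschitz_near :: "'a::real_normed_vector \<Rightarrow> ('a \<Rightarrow> 'b::real_normed_vector) \<Rightarrow> bool" where
  "lipschitz_near a f \<longleftrightarrow> (\<exists>e>0. \<exists>L\<ge>0. \<forall>x\<in>ball a e. \<forall>y\<in>ball a e. norm (f x - f y) \<le> L * norm (x - y))"

lemma lipschitz_nearE:
  assumes "lipschitz_near a f"
  obtains e L where "e > 0" "0 \<le> L" "\<And>x y. \<lbrakk>x \<in> ball a e; y \<in> ball a e\<rbrakk> \<Longrightarrow> norm (f x - f y) \<le> L * norm (x - y)"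
  using assms unfolding lipschitz_near_def by (elim exE conjE) simp

lemma lipschitz_nearI:
  assumes "e > 0" "0 \<le> L" "\<And>x y. \<lbrakk>x \<in> ball a e; y \<in> ball a e\<rbrakk> \<Longrightarrow> norm (f x - f y) \<le> L * norm (x - y)"
  shows "lipschitz_near a f"
  unfolding lipschitz_near_def using assms by (intro exI[of _ e] exI[of _ L] conjI) simp_all

lemma lipschitz_near_const: "lipschitz_near a (\<lambda>_. k)"
  by (rule lipschitz_nearI[of 1 0]) auto

lemma lipschitz_near_linear:
  assumes "bounded_linear f" shows "lipschitz_near a f"
proof -
  obtain K where K: "K > 0" "\<And>x. norm (f x) \<le> norm x * K"
    using bounded_linear.pos_bounded[OF assms] by metis
  have "norm (f x - f y) \<le> K * norm (x - y)" for x y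
    using K(2)[of "x - y"] linear_diff[OF bounded_linear.linear[OF assms]] by (simp add: mult.commute)
  then show ?thesis
    using K(1) by (intro lipschitz_nearI[of 1 K]) simp_all
qed

lemma lipschitz_near_add:
  assumes "lipschitz_near a f" "lipschitz_near a g"
  shows "lipschitz_near a (\<lambda>x. f x + g x)"
proof -
  obtain e1 L1 where 1: "e1 > 0" "0 \<le> L1" "\<And>x y. \<lbrakk>x \<in> ball a e1; y \<in> ball a e1\<rbrakk> \<Longrightarrow> norm (f x - f y) \<le> L1 * norm (x - y)"
    using lipschitz_nearE[OF assms(1)] by metis
  obtain e2 L2 where 2: "e2 > 0" "0 \<le> L2" "\<And>x y. \<lbrakk>x \<in> ball a e2; y \<in> ball a e2\<rbrakk> \<Longrightarrow> norm (g x - g y) \<le> L2 * norm (x - y)"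
    using lipschitz_nearE[OF assms(2)] by metis
  have "norm (f x + g x - (f y + g y)) \<le> (L1 + L2) * norm (x - y)"
    if "x \<in> ball a (min e1 e2)" "y \<in> ball a (min e1 e2)" for x y
    using 1(3)[of x y] 2(3)[of x y] that norm_triangle_ineq[of "f x - f y" "g x - g y"]
    by (simp add: algebra_simps)
  from this show ?thesis
    by (rule lipschitz_nearI[rotated 2, where e = "min e1 e2"]) (use 1(1,2) 2(1,2) in simp_all)
qed

lemma lipschitz_near_bilinear:
  assumes p: "bounded_bilinear prd" and "lipschitz_near a f" "lipschitz_near a g"
  shows "lipschitz_near a (\<lambda>x. prd (f x) (g x))"
proof -
  obtain e1 L1 where 1: "e1 > 0" "0 \<le> L1" "\<And>x y. \<lbrakk>x \<in> ball a e1; y \<in> ball a e1\<rbrakk> \<Longrightarrow> norm (f x - f y) \<le> L1 * norm (x - y)"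
    using lipschitz_nearE[OF assms(2)] by metis
  obtain e2 L2 where 2: "e2 > 0" "0 \<le> L2" "\<And>x y. \<lbrakk>x \<in> ball a e2; y \<in> ball a e2\<rbrakk> \<Longrightarrow> norm (g x - g y) \<le> L2 * norm (x - y)"
    using lipschitz_nearE[OF assms(3)] by metis
  obtain K where K: "K > 0" "\<And>u v. norm (prd u v) \<le> norm u * norm v * K"
    using bounded_bilinear.pos_bounded[OF p] by metis
  define M where "M = norm (f a) + L1 * e1 + norm (g a) + L2 * e2"
  have M: "M \<ge> 0" unfolding M_def using 1 2 by simp
  let ?e = "min e1 e2"
  have fM: "norm (f x) \<le> M" and gM: "norm (g x) \<le> M" if "x \<in> ball a ?e" for x
  proof -
    have "norm (f x - f a) \<le> L1 * e1"
      using 1(1,2) 1(3)[of x a] that mult_left_mono[of "norm (x - a)" e1 L1]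
      by (simp add: dist_norm norm_minus_commute)
    moreover have "norm (g x - g a) \<le> L2 * e2"
      using 2(1,2) 2(3)[of x a] that mult_left_mono[of "norm (x - a)" e2 L2]
      by (simp add: dist_norm norm_minus_commute)
    moreover have "0 \<le> L1 * e1" "0 \<le> L2 * e2" using 1 2 by auto
    moreover note norm_triangle_sub[of "f x" "f a"] norm_triangle_sub[of "g x" "g a"]
      norm_ge_zero[of "f a"] norm_ge_zero[of "g a"]
    ultimately show "norm (f x) \<le> M" "norm (g x) \<le> M"
      unfolding M_def by linarith+
  qed
  have "norm (prd (f x) (g x) - prd (f y) (g y)) \<le> (K * M * (L1 + L2)) * norm (x - y)"
    if xy: "x \<in> ball a ?e" "y \<in> ball a ?e" for x y
  proof -
    have "prd (f x) (g x) - prd (f y) (g y) = prd (f x - f y) (g x) + prd (f y) (g x - g y)"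
      using bounded_bilinear.diff_left[OF p] bounded_bilinear.diff_right[OF p] by simp
    then have "norm (prd (f x) (g x) - prd (f y) (g y))
        \<le> norm (f x - f y) * norm (g x) * K + norm (f y) * norm (g x - g y) * K"
      by (simp only:) (rule order_trans[OF norm_triangle_ineq add_mono[OF K(2) K(2)]])
    also have "\<dots> \<le> (L1 * norm (x - y)) * M * K + M * (L2 * norm (x - y)) * K"
      using 1(3)[of x y] 2(3)[of x y] xy fM[OF xy(2)] gM[OF xy(1)] K(1) M 1(2)
      by (intro add_mono mult_right_mono mult_mono) auto
    finally show ?thesis by (simp add: algebra_simps)
  qed
  from this show ?thesis
    by (rule lipschitz_nearI[rotated 2, where e = "min e1 e2"]) (use 1(1,2) 2(1,2) K(1) M in simp_all)
qed

lemma lipschitz_near_sum: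
  "(\<And>i. i \<in> S \<Longrightarrow> lipschitz_near a (f i)) \<Longrightarrow> lipschitz_near a (\<lambda>x. \<Sum>i\<in>S. f i x)"
  by (induction S rule: infinite_finite_induct)
     (simp_all add: lipschitz_near_const lipschitz_near_add)

lemma lipschitz_near_reciprocal:
  fixes f :: "'a::real_normed_vector \<Rightarrow> real"
  assumes "lipschitz_near a f" and f: "\<And>x. 0 \<le> f x"
  shows "lipschitz_near a (\<lambda>x. 1 / (1 + f x))"
proof -
  obtain e L where 1: "e > 0" "0 \<le> L" "\<And>x y. \<lbrakk>x \<in> ball a e; y \<in> ball a e\<rbrakk> \<Longrightarrow> norm (f x - f y) \<le> L * norm (x - y)"
    using lipschitz_nearE[OF assms(1)] by metis
  have rec: "norm (1 / (1 + f x) - 1 / (1 + f y)) \<le> norm (f x - f y)" for x y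
  proof -
    have pos: "1 + f x \<ge> 1" "1 + f y \<ge> 1" using f[of x] f[of y] by auto
    then have "1 / (1 + f x) - 1 / (1 + f y) = (f y - f x) / ((1 + f x) * (1 + f y))"
      by (simp add: field_simps)
    moreover have "1 \<le> (1 + f x) * (1 + f y)"
      using pos mult_mono[of 1 "1 + f x" 1 "1 + f y"] by simp
    ultimately show ?thesis
      by (simp add: abs_minus_commute divide_le_eq mult_le_cancel_left1)
  qed
  have "norm (1 / (1 + f x) - 1 / (1 + f y)) \<le> L * norm (x - y)" if "x \<in> ball a e" "y \<in> ball a e" for x y
    by (rule order_trans[OF rec 1(3)[OF that]])
  from this show ?thesis
    by (rule lipschitz_nearI[rotated 2]) (use 1(1,2) in simp_all)
qed

lemma lipschitz_near_compose_fst: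
  assumes "lipschitz_near (fst a) f" shows "lipschitz_near a (\<lambda>x. f (fst x))"
proof -
  obtain e L where 1: "e > 0" "0 \<le> L" "\<And>x y. \<lbrakk>x \<in> ball (fst a) e; y \<in> ball (fst a) e\<rbrakk> \<Longrightarrow> norm (f x - f y) \<le> L * norm (x - y)"
    using lipschitz_nearE[OF assms(1)] by metis
  have "norm (f (fst x) - f (fst y)) \<le> L * norm (x - y)" if "x \<in> ball a e" "y \<in> ball a e" for x y
  proof -
    have "norm (f (fst x) - f (fst y)) \<le> L * norm (fst x - fst y)"
      using that dist_fst_le[of a x] dist_fst_le[of a y] by (intro 1(3)) auto
    also have "\<dots> \<le> L * norm (x - y)"
    proof (rule mult_left_mono[OF _ 1(2)])
      show "norm (fst x - fst y) \<le> norm (x - y)"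
        using norm_fst_le[of "fst (x - y)" "snd (x - y)"] unfolding prod.collapse by simp
    qed
    finally show ?thesis .
  qed
  from this show ?thesis
    by (rule lipschitz_nearI[rotated 2]) (use 1(1,2) in simp_all)
qed

lemma bounded_linear_family:
  fixes T :: "'s::metric_space \<Rightarrow> 'a::euclidean_space \<Rightarrow> 'b::real_normed_vector"
  assumes S: "compact S" and lin: "\<And>t. t \<in> S \<Longrightarrow> linear (T t)"
    and cont: "\<And>b. continuous_on S (\<lambda>t. T t b)"
  obtains C where "0 \<le> C" "\<And>t v. t \<in> S \<Longrightarrow> norm (T t v) \<le> C * norm v"
proof -
  have "\<exists>M. \<forall>t\<in>S. norm (T t b) \<le> M" for b
  proof -
    have "bounded ((\<lambda>t. T t b) ` S)"
      by (rule compact_imp_bounded[OF compact_continuous_image[OF cont S]])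
    then show ?thesis unfolding bounded_iff by simp
  qed
  then obtain M where M: "\<And>b t. t \<in> S \<Longrightarrow> norm (T t b) \<le> M b" by metis
  have bd: "norm (T t v) \<le> (\<Sum>b\<in>Basis. \<bar>M b\<bar>) * norm v" if t: "t \<in> S" for t v
  proof -
    have "T t v = T t (\<Sum>b\<in>Basis. (v \<bullet> b) *\<^sub>R b)" by (simp add: euclidean_representation)
    also have "\<dots> = (\<Sum>b\<in>Basis. (v \<bullet> b) *\<^sub>R T t b)"
      by (simp add: linear_sum[OF lin[OF t]] linear_scale[OF lin[OF t]])
    finally have "norm (T t v) \<le> (\<Sum>b\<in>Basis. \<bar>v \<bullet> b\<bar> * norm (T t b))"
      using norm_sum[of "\<lambda>b. (v \<bullet> b) *\<^sub>R T t b" Basis] by simp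
    also have "\<dots> \<le> (\<Sum>b\<in>Basis. norm v * \<bar>M b\<bar>)"
    proof (intro sum_mono mult_mono)
      show "norm (T t b) \<le> \<bar>M b\<bar>" for b
        by (rule order_trans[OF M abs_ge_self]) (rule t)
    qed (auto simp: Basis_le_norm)
    finally show ?thesis by (simp add: sum_distrib_left mult.commute)
  qed
  show ?thesis by (rule that[OF _ bd]) (simp_all add: sum_nonneg)
qed

lemma lipschitz_near_C1:
  fixes f :: "'a::euclidean_space \<Rightarrow> 'b::real_normed_vector"
  assumes S: "open S" "a \<in> S" and f: "\<And>x. x \<in> S \<Longrightarrow> (f has_derivative D x) (at x)"
    and cont: "\<And>v. continuous_on S (\<lambda>x. D x v)"
  shows "lipschitz_near a f"
proof -
  obtain e where e: "e > 0" "cball a e \<subseteq> S"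
    using open_contains_cball_eq[OF S(1)] S(2) by metis
  obtain L where L: "0 \<le> L" "\<And>x v. x \<in> cball a e \<Longrightarrow> norm (D x v) \<le> L * norm v"
  proof (rule bounded_linear_family[of "cball a e" D])
    show "linear (D x)" if "x \<in> cball a e" for x
      by (rule has_derivative_linear[OF f]) (use e(2) that in auto)
    show "continuous_on (cball a e) (\<lambda>x. D x v)" for v
      by (rule continuous_on_subset[OF cont e(2)])
  qed auto
  have on: "onorm (D x) \<le> L" if "x \<in> ball a e" for x
    by (rule onorm_le) (use L(2) that in auto)
  have "norm (f x - f y) \<le> L * norm (x - y)" if "x \<in> ball a e" "y \<in> ball a e" for x y
  proof (rule differentiable_bound[of "ball a e" f D])
    show "(f has_derivative D z) (at z within ball a e)" if "z \<in> ball a e" for z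
      by (rule has_derivative_at_withinI[OF f]) (use e(2) that in auto)
  qed (use on that in auto)
  from this show ?thesis
    by (rule lipschitz_nearI[rotated 2]) (use e(1) L(1) in simp_all)
qed

lemma hsq_nonneg: "0 \<le> hsq dd \<sigma>"
  unfolding hsq_def by (simp add: sum_nonneg)

lemma hsq_pos: "0 < 1 + hsq dd \<sigma>"
  using hsq_nonneg[of dd \<sigma>] by simp

lemma Acal_zero: "Acal A dd u 0 = A dd u"
  by (simp add: Acal_def)

lemma Gd_zero: "Gd A dd (u, 0) = A dd u"
  by (simp add: Gd_def Acal_zero hsq_def)

text \<open>The derivative of \<open>u \<mapsto> Acal A dd u \<sigma>\<close> at \<open>u\<close> in the direction \<open>w\<close>.\<close>

definition D_Acal :: "('n::finite, 'd::finite) coeffs \<Rightarrow> 'd \<Rightarrow> real^'n \<Rightarrow> real^'d \<Rightarrow> real^'n \<Rightarrow> real^'n^'n" where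
  "D_Acal A dd u \<sigma> w = frechet_derivative (A dd) (at u) w
     - (\<Sum>j\<in>UNIV - {dd}. (\<sigma> $ j) *\<^sub>R frechet_derivative (A j) (at u) w)"

lemma sg_sg [simp]: "sg e * sg e = 1" by (cases e) auto
lemma sg_sg_mult [simp]: "sg e * (sg e * x) = x" by (cases e) auto
lemma sg_scaleR [simp]: "sg e *\<^sub>R sg e *\<^sub>R v = (v::'a::real_vector)" by (cases e) auto
lemma abs_sg [simp]: "\<bar>sg e\<bar> = 1" by (cases e) auto
lemma sg_nonzero [simp]: "sg e \<noteq> 0" by (cases e) auto

context viscous_shock begin

lemma A_has_derivative:
  assumes "u \<in> Us" shows "(A j has_derivative frechet_derivative (A j) (at u)) (at u)"
proof -
  obtain D where "(A j has_derivative D) (at u within Us)"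
    using smooth_on_has_derivative[OF A_smooth assms] by metis
  then have "A j differentiable (at u)"
    unfolding differentiable_def using at_within_open[OF assms Us(1)] by auto
  then show ?thesis by (simp only: frechet_derivative_works)
qed

lemma A_derivative_continuous: "continuous_on Us (\<lambda>u. frechet_derivative (A j) (at u) v)"
proof (rule smooth_on_imp_continuous_on, rule smooth_on_directional_derivative[OF A_smooth[of j], where v = v])
  fix u assume u: "u \<in> Us"
  let ?I = "{t::real. u + t *\<^sub>R v \<in> Us}"
  have "continuous_on UNIV (\<lambda>t::real. u + t *\<^sub>R v)" by (intro continuous_intros)
  then have "open ?I"
    using open_vimage[OF Us(1), of "\<lambda>t::real. u + t *\<^sub>R v"] by (simp add: vimage_def)
  then show "0 islimpt ?I"
    using u interior_limit_point[of 0 ?I] by (simp add: interior_open)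
  have "((\<lambda>t::real. u + t *\<^sub>R v) has_vector_derivative v) (at 0 within ?I)"
    by (rule derivative_eq_intros refl | simp)+
  then show "((\<lambda>t. A j (u + t *\<^sub>R v)) has_vector_derivative frechet_derivative (A j) (at u) v) (at 0 within ?I)"
    by (rule has_vector_derivative_along[OF A_has_derivative[OF u, of j]]) auto
qed

lemma Acal_has_derivative:
  assumes "u \<in> Us" shows "((\<lambda>u. Acal A dd u \<sigma>) has_derivative D_Acal A dd u \<sigma>) (at u)"
proof -
  have "((\<lambda>u. A dd u - (\<sigma> $ dd) *\<^sub>R mat 1 - (\<Sum>j\<in>UNIV - {dd}. (\<sigma> $ j) *\<^sub>R A j u)) has_derivative
      (\<lambda>w. frechet_derivative (A dd) (at u) w - 0
        - (\<Sum>j\<in>UNIV - {dd}. (\<sigma> $ j) *\<^sub>R frechet_derivative (A j) (at u) w))) (at u)"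
    by (intro has_derivative_diff has_derivative_sum has_derivative_const
        has_derivative_scaleR_right A_has_derivative assms)
  then show ?thesis unfolding Acal_def D_Acal_def[abs_def] by simp
qed

lemma frechet_derivative_Acal:
  "u \<in> Us \<Longrightarrow> frechet_derivative (\<lambda>u. Acal A dd u \<sigma>) (at u) = D_Acal A dd u \<sigma>"
  using frechet_derivative_at[OF Acal_has_derivative] by simp

lemma D_Acal_linear: "u \<in> Us \<Longrightarrow> linear (D_Acal A dd u \<sigma>)"
  by (rule has_derivative_linear[OF Acal_has_derivative])

lemma D_Acal_continuous: "continuous_on Us (\<lambda>u. D_Acal A dd u \<sigma> w)"
  unfolding D_Acal_def by (intro continuous_intros A_derivative_continuous)

lemma Gd_lipschitz:
  assumes "u \<in> Us" shows "lipschitz_near (u, \<sigma>) (Gd A dd)"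
proof -
  have A: "lipschitz_near (u, \<sigma>) (\<lambda>x. A j (fst x))" for j
    by (rule lipschitz_near_compose_fst)
       (use lipschitz_near_C1[OF Us(1) assms A_has_derivative A_derivative_continuous] in simp)
  have s: "lipschitz_near (u, \<sigma>) (\<lambda>x. snd x $ j)" for j
    by (rule lipschitz_near_linear)
       (rule bounded_linear_compose[OF bounded_linear_vec_nth bounded_linear_snd])
  have "lipschitz_near (u, \<sigma>) (\<lambda>x. A dd (fst x) + ((- 1) *\<^sub>R ((snd x $ dd) *\<^sub>R mat 1)
      + (- 1) *\<^sub>R (\<Sum>j\<in>UNIV - {dd}. (snd x $ j) *\<^sub>R A j (fst x))))"
    by (intro lipschitz_near_add lipschitz_near_bilinear[OF bounded_bilinear_scaleR]
        lipschitz_near_sum lipschitz_near_const A s)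
  then have Ac: "lipschitz_near (u, \<sigma>) (\<lambda>x. Acal A dd (fst x) (snd x))"
    unfolding Acal_def by (simp add: algebra_simps)
  have "lipschitz_near (u, \<sigma>) (\<lambda>x. hsq dd (snd x))"
    unfolding hsq_def power2_eq_square
    by (intro lipschitz_near_sum lipschitz_near_bilinear[OF bounded_bilinear_mult] s)
  then have "lipschitz_near (u, \<sigma>) (\<lambda>x. 1 / (1 + hsq dd (snd x)))"
    by (rule lipschitz_near_reciprocal) (rule hsq_nonneg)
  from lipschitz_near_bilinear[OF bounded_bilinear_scaleR this Ac]
  show ?thesis unfolding Gd_def[abs_def] .
qed

text \<open>Hyperbolicity in the direction of the last coordinate axis.\<close>

lemma A_normal_hyperbolic:
  assumes "complex_eigenvalue (A dd (pb e)) \<mu>" shows "\<mu> \<in> \<real>"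
proof (rule hyperbolic)
  show "pb e \<in> U Pl \<union> U Mi" using pb(1)[of e] by (cases e) auto
  show "axis dd 1 \<noteq> (0 :: real^'d)" by simp
  have "(\<Sum>j\<in>UNIV. (axis dd 1 $ j) *\<^sub>R A j (pb e)) = (\<Sum>j\<in>UNIV. if j = dd then A dd (pb e) else 0)"
    by (rule sum.cong) (auto simp: axis_def)
  then have "(\<Sum>j\<in>UNIV. (axis dd 1 $ j) *\<^sub>R A j (pb e)) = A dd (pb e)" by simp
  then show "complex_eigenvalue (\<Sum>j\<in>UNIV. (axis dd 1 $ j) *\<^sub>R A j (pb e)) \<mu>"
    using assms by simp
qed

text \<open>The Lyapunov form of \<open>A dd (pb e)\<close> is multiplied by \<open>sg e\<close>, so that on both sides it increases as one
  moves outwards.  By local Lipschitz continuity of \<open>Gd\<close> half of the coercivity survives for all nearby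
  states and parameters.  The radius in \<open>u\<close> is doubled because a profile may move by \<open>R \<le> \<epsilon>\<close> away from
  an end state that is itself only \<open>\<epsilon>\<close>-close to \<open>pb e\<close>.\<close>

lemma uniform_lyapunov_form:
  obtains B :: "real^'n \<Rightarrow> real^'n \<Rightarrow> real" and K c L \<epsilon> where
    "symmetric_form B K c" "0 \<le> L" "\<epsilon> > 0"
    "\<And>Y. \<lbrakk>subspace Y; \<And>v. \<lbrakk>v \<in> Y; v \<noteq> 0\<rbrakk> \<Longrightarrow> B v v < 0\<rbrakk> \<Longrightarrow> dim Y \<le> dim (decay_space A dd e (pb e, 0))"
    "\<And>u. norm (u - pb e) \<le> 2 * \<epsilon> \<Longrightarrow> u \<in> Us"
    "\<And>u \<sigma> v. \<lbrakk>norm (u - pb e) \<le> 2 * \<epsilon>; norm \<sigma> \<le> \<epsilon>\<rbrakk> \<Longrightarrow> c * (norm v)\<^sup>2 \<le> B v (sg e *\<^sub>R (Gd A dd (u, \<sigma>) *v v))"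
    "\<And>u \<sigma> u' \<sigma>' v. \<lbrakk>norm (u - pb e) \<le> 2 * \<epsilon>; norm \<sigma> \<le> \<epsilon>; norm (u' - pb e) \<le> 2 * \<epsilon>; norm \<sigma>' \<le> \<epsilon>\<rbrakk> \<Longrightarrow>
        norm (Gd A dd (u, \<sigma>) *v v - Gd A dd (u', \<sigma>') *v v) \<le> L * (norm (u - u') + norm (\<sigma> - \<sigma>')) * norm v"
proof -
  let ?M = "A dd (pb e)"
  obtain \<nu>s where \<nu>s: "0 \<notin> set \<nu>s" "\<And>v. shift_prod ?M \<nu>s v = 0"
    by (rule real_spectrum_annihilating_list[OF A_normal_hyperbolic[of e] pb(2)[of e]]) (assumption, rule that)
  obtain B0 :: "real^'n \<Rightarrow> real^'n \<Rightarrow> real" and c0 where B0: "bilinear B0" "\<And>v w. B0 v w = B0 w v"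
    "c0 > 0" "\<And>v. c0 * (norm v)\<^sup>2 \<le> B0 v (?M *v v)"
    "\<And>Y s. \<lbrakk>subspace Y; \<And>v. \<lbrakk>v \<in> Y; v \<noteq> 0\<rbrakk> \<Longrightarrow> s * B0 v v < 0\<rbrakk> \<Longrightarrow>
        dim Y \<le> dim (spectral_space ?M {\<mu>. s * \<mu> < 0})"
  proof (rule lyapunov_form[OF \<nu>s])
    fix B :: "real^'n \<Rightarrow> real^'n \<Rightarrow> real" and c
    assume "bilinear B" "\<And>v w. B v w = B w v" "c > 0" "\<And>v. c * (norm v)\<^sup>2 \<le> B v (?M *v v)"
      "\<And>Y s. \<lbrakk>subspace Y; \<And>v. \<lbrakk>v \<in> Y; v \<noteq> 0\<rbrakk> \<Longrightarrow> s * B v v < 0\<rbrakk> \<Longrightarrow>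
        dim Y \<le> dim (spectral_space ?M {\<mu>. s * \<mu> < 0})"
    then show thesis by (rule that)
  qed
  interpret b0: bounded_bilinear B0
    using B0(1) by (simp add: bilinear_conv_bounded_bilinear)
  define B where "B v w = sg e * B0 v w" for v w
  have bilB: "bilinear B"
    unfolding bilinear_def B_def
    by (intro conjI allI linearI) (simp_all add: b0.add_left b0.add_right b0.scaleR_left b0.scaleR_right distrib_left mult.left_commute)
  obtain K where K: "K > 0" "\<And>v w. norm (B0 v w) \<le> norm v * norm w * K"
    using b0.pos_bounded by metis
  have Bbound: "\<bar>B v w\<bar> \<le> K * (norm v * norm w)" for v w
    using K(2)[of v w] unfolding B_def by (simp add: abs_mult mult_ac)
  have form: "symmetric_form B K (c0 / 2)"
    by unfold_locales (use bilB B0(2,3) K(1) Bbound in \<open>auto simp: B_def\<close>)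
  then interpret symmetric_form B K "c0 / 2" .
  have decay: "decay_space A dd e (pb e, 0) = spectral_space ?M {\<mu>. sg e * \<mu> < 0}"
    unfolding decay_space_def Gd_zero decay_rates_def ..
  obtain KM where KM: "KM > 0" "\<And>(N::real^'n^'n) v. norm (N *v v) \<le> norm N * norm v * KM"
    using mv.pos_bounded by metis
  have pbU: "pb e \<in> Us" using pb(1) U(3) by blast
  obtain e1 L1 where e1: "e1 > 0" "0 \<le> L1"
    "\<And>x y. \<lbrakk>x \<in> ball (pb e, 0) e1; y \<in> ball (pb e, 0) e1\<rbrakk> \<Longrightarrow> norm (Gd A dd x - Gd A dd y) \<le> L1 * norm (x - y)"
    using lipschitz_nearE[OF Gd_lipschitz[OF pbU, of 0]] by metis
  obtain e2 where e2: "e2 > 0" "ball (pb e) e2 \<subseteq> Us"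
    using Us(1) pbU open_contains_ball by blast
  define L where "L = L1 * KM"
  have L: "0 \<le> L" unfolding L_def using e1(2) KM(1) by simp
  define \<epsilon> where "\<epsilon> = min (e1 / 4) (min (e2 / 3) (c0 / (2 * (K * (L * 3 + 1)))))"
  have den: "0 < K * (L * 3 + 1)" using K(1) L by (intro mult_pos_pos) auto
  have \<epsilon>: "\<epsilon> > 0" "4 * \<epsilon> \<le> e1" "3 * \<epsilon> \<le> e2" "\<epsilon> \<le> c0 / (2 * (K * (L * 3 + 1)))"
    unfolding \<epsilon>_def using e1(1) e2(1) B0(3) den by (auto simp: min_le_iff_disj)
  have Pair_norm: "norm (u - u', \<sigma> - \<sigma>') \<le> norm (u - u') + norm (\<sigma> - \<sigma>')" for u u' :: "real^'n" and \<sigma> \<sigma>' :: "real^'d"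
    unfolding norm_Pair by (rule sqrt_sum_squares_le_sum) auto
  have inball: "(u, \<sigma>) \<in> ball (pb e, 0) e1" if "norm (u - pb e) \<le> 2 * \<epsilon>" "norm \<sigma> \<le> \<epsilon>" for u and \<sigma> :: "real^'d"
  proof -
    have "dist (pb e, 0) (u, \<sigma>) = norm (u - pb e, \<sigma> - 0)"
      by (simp add: dist_norm norm_Pair norm_minus_commute)
    then show ?thesis
      using Pair_norm[of u "pb e" \<sigma> 0] that \<epsilon>(1,2) by simp
  qed
  have lip: "norm (Gd A dd (u, \<sigma>) *v v - Gd A dd (u', \<sigma>') *v v) \<le> L * (norm (u - u') + norm (\<sigma> - \<sigma>')) * norm v"
    if "norm (u - pb e) \<le> 2 * \<epsilon>" "norm \<sigma> \<le> \<epsilon>" "norm (u' - pb e) \<le> 2 * \<epsilon>" "norm \<sigma>' \<le> \<epsilon>" for u \<sigma> u' \<sigma>' v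
  proof -
    have "norm (Gd A dd (u, \<sigma>) *v v - Gd A dd (u', \<sigma>') *v v) \<le> norm (Gd A dd (u, \<sigma>) - Gd A dd (u', \<sigma>')) * norm v * KM"
      using KM(2) by (simp add: mv.diff_left[symmetric])
    also have "\<dots> \<le> (L1 * (norm (u - u') + norm (\<sigma> - \<sigma>'))) * norm v * KM"
    proof (intro mult_right_mono)
      have "norm (Gd A dd (u, \<sigma>) - Gd A dd (u', \<sigma>')) \<le> L1 * norm ((u, \<sigma>) - (u', \<sigma>'))"
        by (rule e1(3)) (use inball that in auto)
      also have "\<dots> \<le> L1 * (norm (u - u') + norm (\<sigma> - \<sigma>'))"
        using Pair_norm e1(2) by (intro mult_left_mono) auto
      finally show "norm (Gd A dd (u, \<sigma>) - Gd A dd (u', \<sigma>')) \<le> L1 * (norm (u - u') + norm (\<sigma> - \<sigma>'))" .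
    qed (use KM in auto)
    finally show ?thesis unfolding L_def by (simp add: mult_ac)
  qed
  have coer: "c0 / 2 * (norm v)\<^sup>2 \<le> B v (sg e *\<^sub>R (Gd A dd (u, \<sigma>) *v v))"
    if u: "norm (u - pb e) \<le> 2 * \<epsilon>" "norm \<sigma> \<le> \<epsilon>" for u \<sigma> v
  proof -
    let ?d = "Gd A dd (u, \<sigma>) *v v - ?M *v v"
    have "norm ?d \<le> L * (norm (u - pb e) + norm (\<sigma> - 0)) * norm v"
      using lip[of u \<sigma> "pb e" 0 v] u \<epsilon>(1) by (simp add: Gd_zero)
    also have "\<dots> \<le> L * (3 * \<epsilon>) * norm v"
      using u L by (intro mult_right_mono mult_left_mono) auto
    finally have d: "norm ?d \<le> L * (3 * \<epsilon>) * norm v" .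
    have "\<bar>B0 v ?d\<bar> \<le> norm v * norm ?d * K"
      using K(2)[of v ?d] by simp
    also have "\<dots> \<le> norm v * (L * (3 * \<epsilon>) * norm v) * K"
      using d K(1) by (intro mult_right_mono mult_left_mono) auto
    also have "\<dots> = (K * (L * 3) * \<epsilon>) * (norm v)\<^sup>2"
      by (simp add: power2_eq_square mult_ac)
    also have "\<dots> \<le> c0 / 2 * (norm v)\<^sup>2"
    proof (rule mult_right_mono)
      have "K * (L * 3) * \<epsilon> \<le> K * (L * 3 + 1) * \<epsilon>"
        using K(1) \<epsilon>(1) by (intro mult_right_mono mult_left_mono) auto
      also have "\<dots> \<le> c0 / 2"
        using \<epsilon>(4) den by (simp add: field_simps)
      finally show "K * (L * 3) * \<epsilon> \<le> c0 / 2" .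
    qed simp
    finally have "\<bar>B0 v ?d\<bar> \<le> c0 / 2 * (norm v)\<^sup>2" .
    moreover have "B v (sg e *\<^sub>R (Gd A dd (u, \<sigma>) *v v)) = B0 v (?M *v v) + B0 v ?d"
      unfolding B_def by (simp add: b0.scaleR_right b0.diff_right)
    ultimately show ?thesis using B0(4)[of v] by linarith
  qed
  show ?thesis
  proof (rule that[OF form L \<epsilon>(1)])
    show "dim Y \<le> dim (decay_space A dd e (pb e, 0))"
      if "subspace Y" "\<And>v. \<lbrakk>v \<in> Y; v \<noteq> 0\<rbrakk> \<Longrightarrow> B v v < 0" for Y
      unfolding decay by (rule B0(5)[OF that(1)]) (use that(2) in \<open>simp add: B_def\<close>)
    show "u \<in> Us" if "norm (u - pb e) \<le> 2 * \<epsilon>" for u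
      using e2(2) \<epsilon>(1,3) that by (auto simp: dist_norm norm_minus_commute)
  qed (use coer lip in auto)
qed

end

section \<open>Half-line profiles and their variations\<close>

lemma smooth_on_partial_snd_open:
  fixes F :: "'p::real_normed_vector \<times> real \<Rightarrow> 'b::real_normed_vector"
  assumes F: "smooth_on (P \<times> I) F" and I: "open I"
  defines "F' \<equiv> \<lambda>(p, t). vector_derivative (\<lambda>t. F (p, t)) (at t)"
  shows "\<And>p t. \<lbrakk>p \<in> P; t \<in> I\<rbrakk> \<Longrightarrow> ((\<lambda>t. F (p, t)) has_vector_derivative F' (p, t)) (at t)"
    and "smooth_on (P \<times> I) F'"
proof -
  show der: "((\<lambda>t. F (p, t)) has_vector_derivative F' (p, t)) (at t)" if pt: "p \<in> P" "t \<in> I" for p t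
  proof -
    obtain D where D: "(F has_derivative D) (at (p, t) within P \<times> I)"
      using smooth_on_has_derivative[OF F SigmaI[OF pt]] by metis
    have "((\<lambda>t. (p, t)) has_vector_derivative (0, 1)) (at t within I)"
      by (rule derivative_eq_intros has_vector_derivative_Pair refl | simp)+
    with D have "((\<lambda>t. F (p, t)) has_vector_derivative D (0, 1)) (at t within I)"
      by (rule has_vector_derivative_along) (use pt in auto)
    then have "((\<lambda>t. F (p, t)) has_vector_derivative D (0, 1)) (at t)"
      using at_within_open[OF pt(2) I] by simp
    then show ?thesis
      unfolding F'_def by (simp add: vector_derivative_at)
  qed
  show "smooth_on (P \<times> I) F'"
  proof (rule smooth_on_partial_snd[OF F])
    show "t islimpt I" if "t \<in> I" for t
      using interior_limit_point[of t I] I that by (simp add: interior_open)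
  qed (rule has_vector_derivative_at_within[OF der])
qed

lemma segment_in_open:
  fixes p d :: "'a::real_normed_vector"
  assumes "open S" "p \<in> S"
  obtains \<delta> :: real where "\<delta> > 0" "\<And>\<theta>. \<theta> \<in> {-\<delta><..<\<delta>} \<Longrightarrow> p + \<theta> *\<^sub>R d \<in> S"
proof -
  have "((\<lambda>\<theta>::real. p + \<theta> *\<^sub>R d) \<longlongrightarrow> p + 0 *\<^sub>R d) (at 0)"
    by (intro tendsto_intros)
  then have "eventually (\<lambda>\<theta>::real. p + \<theta> *\<^sub>R d \<in> S) (at 0)"
    by (rule topological_tendstoD[OF _ assms(1)]) (use assms(2) in simp)
  then obtain \<delta> where d: "\<delta> > 0" "\<And>\<theta>::real. \<lbrakk>\<theta> \<noteq> 0; dist \<theta> 0 < \<delta>\<rbrakk> \<Longrightarrow> p + \<theta> *\<^sub>R d \<in> S"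
    by (auto simp: eventually_at)
  have "p + \<theta> *\<^sub>R d \<in> S" if "\<theta> \<in> {-\<delta><..<\<delta>}" for \<theta>
    using d(2)[of \<theta>] assms(2) that by (cases "\<theta> = 0") (auto simp: dist_real_def)
  with d(1) show ?thesis by (rule that)
qed

lemma islimpt_atLeast: "t \<in> {a..} \<Longrightarrow> t islimpt {a::real..}"
proof (rule connected_imp_perfect)
  show "{a..} \<noteq> {x}" for x
  proof
    assume "{a..} = {x}"
    then have "a \<in> {x}" "a + 1 \<in> {x}" by (metis atLeast_iff order_refl less_add_one less_imp_le)+
    then show False by simp
  qed
qed auto

lemma islimpt_atMost: "t \<in> {..a} \<Longrightarrow> t islimpt {..a::real}"
proof (rule connected_imp_perfect)
  show "{..a} \<noteq> {x}" for x
  proof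
    assume "{..a} = {x}"
    then have "a \<in> {x}" "a - 1 \<in> {x}" by (metis atMost_iff order_refl diff_le_eq le_add_same_cancel1 zero_le_one)+
    then show False by simp
  qed
qed auto

lemma half_Pl: "half Pl = {0..}" and half_Mi: "half Mi = {..0}"
  by (auto simp: half_def)

lemma filterlim_far: "filterlim (\<lambda>t. sg e * t) (far e) at_top"
  by (cases e) (simp_all add: filterlim_ident filterlim_uminus_at_bot_at_top)

context half_line_solutions begin

abbreviation amplitudes :: "side \<Rightarrow> (real^'n) set" where
  "amplitudes e \<equiv> decay_space A dd e (pb e, 0)"

text \<open>Parameters for which the profile exists up to the point \<open>sg e * zb\<close>, which is where \<open>Psi\<close> evaluates
  it.\<close>

definition admissible :: "side \<Rightarrow> ('n, 'd) side_state \<Rightarrow> real^'n \<Rightarrow> bool" where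
  "admissible e x a \<longleftrightarrow> x \<in> om e \<and> a \<in> amplitudes e \<and> norm a < r \<and>
     sg e * zb \<in> max_dom A dd Us (snd x) e (\<lambda>z. Phi e z x a)"

text \<open>Both sides are described in the outgoing variable \<open>t = sg e * z\<close>: the end state is approached as
  \<open>t \<rightarrow> \<infinity>\<close>, and the shifted profiles \<open>phi e\<close> live on \<open>t \<ge> zb\<close>.\<close>

definition prof :: "side \<Rightarrow> ('n, 'd) side_state \<Rightarrow> real^'n \<Rightarrow> real \<Rightarrow> real^'n" where
  "prof e x a t = Phi e (sg e * t) x a"

definition prof' :: "side \<Rightarrow> ('n, 'd) side_state \<Rightarrow> real^'n \<Rightarrow> real \<Rightarrow> real^'n" where
  "prof' e x a t = vector_derivative (prof e x a) (at t)"

lemma max_dom_facts: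
  assumes "admissible e x a"
  defines "D \<equiv> max_dom A dd Us (snd x) e (\<lambda>z. Phi e z x a)"
  shows "open D" "half e \<subseteq> D" "\<And>t. zb \<le> t \<Longrightarrow> sg e * t \<in> D"
proof -
  show "open D" unfolding D_def max_dom_def by (intro open_Union) auto
  have "sg e * zb \<in> D" using assms by (simp add: admissible_def)
  then obtain J where J: "sg e * zb \<in> J" "is_interval J" "half e \<subseteq> J" "J \<subseteq> D"
    unfolding D_def max_dom_def by auto
  show "half e \<subseteq> D" using J(3,4) by (rule order_trans)
  show "sg e * t \<in> D" if "zb \<le> t" for t
  proof (cases "0 \<le> t")
    case True
    then have "sg e * t \<in> half e" by (simp add: half_def)
    then show ?thesis using J(3,4) by auto
  next
    case False
    have "0 \<in> J" using J(3) by (auto simp: half_def)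
    then have "sg e * t \<in> J"
      using mem_is_interval_1_I[OF J(2) J(1), of 0 "sg e * t"] mem_is_interval_1_I[OF J(2) _ J(1), of 0 "sg e * t"]
        that False by (cases e) auto
    then show ?thesis using J(4) by auto
  qed
qed

lemma prof_ode:
  assumes adm: "admissible e x a" and t: "zb \<le> t"
  shows "(prof e x a has_vector_derivative prof' e x a t) (at t)" (is ?A)
    and "(prof' e x a has_vector_derivative sg e *\<^sub>R (Gd A dd (prof e x a t, snd x) *v prof' e x a t)) (at t)" (is ?B)
    and "prof e x a t \<in> Us" (is ?C)
    and "((\<lambda>z. Phi e z x a) has_vector_derivative sg e *\<^sub>R prof' e x a t) (at (sg e * t))" (is ?E)
proof -
  let ?f = "\<lambda>z. Phi e z x a"
  define D where "D = max_dom A dd Us (snd x) e ?f"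
  note D = max_dom_facts[OF adm, folded D_def]
  define d1 where "d1 = deriv_in D ?f"
  define d2 where "d2 = deriv_in D d1"
  have "profile_on A dd Us (snd x) D ?f"
    using Phi_extension[of x e a] adm unfolding admissible_def D_def by simp
  then have diff: "?f differentiable_on D" "d1 differentiable_on D"
    and ode: "\<And>z. z \<in> D \<Longrightarrow> ?f z \<in> Us \<and> (1 + hsq dd (snd x)) *\<^sub>R d2 z = Acal A dd (?f z) (snd x) *v d1 z"
    unfolding profile_on_def twice_differentiable_on_def d1_def d2_def by auto
  have f': "(?f has_vector_derivative d1 z) (at z)" if "z \<in> D" for z
    using diff(1) that at_within_open[OF that D(1)] unfolding d1_def differentiable_on_def
    by (metis vector_derivative_works)
  have d1': "(d1 has_vector_derivative d2 z) (at z)" if "z \<in> D" for z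
    using diff(2) that at_within_open[OF that D(1)] unfolding d2_def differentiable_on_def
    by (metis vector_derivative_works)
  have flip: "((\<lambda>s. sg e * s) has_vector_derivative sg e) (at s)" for s
    by (rule derivative_eq_intros refl | simp)+
  have u': "(prof e x a has_vector_derivative sg e *\<^sub>R d1 (sg e * s)) (at s)" if "sg e * s \<in> D" for s
    using vector_diff_chain_at[OF flip f'[OF that]] unfolding prof_def[abs_def] o_def .
  have v: "prof' e x a s = sg e *\<^sub>R d1 (sg e * s)" if "sg e * s \<in> D" for s
    unfolding prof'_def using u'[OF that] by (rule vector_derivative_at)
  have tD: "sg e * t \<in> D" using D(3)[OF t] .
  show ?A using u'[OF tD] v[OF tD] by simp
  show ?C using ode[OF tD] by (simp add: prof_def)
  show ?E using f'[OF tD] v[OF tD] by simp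
  have "((\<lambda>s. d1 (sg e * s)) has_vector_derivative sg e *\<^sub>R d2 (sg e * t)) (at t)"
    using vector_diff_chain_at[OF flip d1'[OF tD]] unfolding o_def .
  then have "((\<lambda>s. sg e *\<^sub>R d1 (sg e * s)) has_vector_derivative sg e *\<^sub>R sg e *\<^sub>R d2 (sg e * t)) (at t)"
    by (rule bounded_linear.has_vector_derivative[OF bounded_linear_scaleR_right])
  then have "((\<lambda>s. sg e *\<^sub>R d1 (sg e * s)) has_vector_derivative d2 (sg e * t)) (at t)"
    by simp
  moreover have "continuous_on UNIV (\<lambda>s. sg e * s)" by (intro continuous_intros)
  then have "open {s. sg e * s \<in> D}"
    using open_vimage[OF D(1), of "\<lambda>s. sg e * s"] by (simp add: vimage_def)
  ultimately have "(prof' e x a has_vector_derivative d2 (sg e * t)) (at t)"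
    by (rule has_vector_derivative_transform_within_open) (use tD v in auto)
  moreover have "d2 (sg e * t) = sg e *\<^sub>R (Gd A dd (prof e x a t, snd x) *v prof' e x a t)"
  proof -
    have "(1 + hsq dd (snd x)) *\<^sub>R d2 (sg e * t) = Acal A dd (prof e x a t) (snd x) *v d1 (sg e * t)"
      using ode[OF tD] by (simp add: prof_def)
    then have "d2 (sg e * t) = (1 / (1 + hsq dd (snd x))) *\<^sub>R (Acal A dd (prof e x a t) (snd x) *v d1 (sg e * t))"
      using hsq_pos[of dd "snd x"] by (metis less_irrefl nonzero_divide_eq_eq scaleR_scaleR scaleR_one divide_self times_divide_eq_left mult.left_neutral)
    then show ?thesis
      unfolding v[OF tD] Gd_def by (simp add: mv.scaleR_left mv.scaleR_right)
  qed
  ultimately show ?B by simp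
qed

text \<open>The distance to the end state is at most the \<open>L\<^sup>1\<close> norm of the derivative.\<close>

lemma prof_half_line:
  assumes adm: "admissible e x a"
  shows "0 \<le> t \<Longrightarrow> norm (prof' e x a t) \<le> R"
    and "(prof e x a \<longlongrightarrow> fst x) at_top"
    and "0 \<le> t \<Longrightarrow> norm (prof e x a t - fst x) \<le> R"
proof -
  let ?f = "\<lambda>z. Phi e z x a"
  have sol: "half_sol R e x a ?f"
    using Phi_sol[of x e a] adm by (simp add: admissible_def)
  define d where "d = deriv_in (half e) ?f"
  have f': "(?f has_vector_derivative sg e *\<^sub>R prof' e x a s) (at (sg e * s))" if "0 \<le> s" for s
    using prof_ode(4)[OF adm, of s] that zb by simp
  have bot: "at z within half e \<noteq> bot" if "z \<in> half e" for z
  proof -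
    have "z islimpt half e"
      using that islimpt_atLeast[of z 0] islimpt_atMost[of z 0]
      by (cases e) (simp_all add: half_Pl half_Mi)
    then show ?thesis by (simp add: trivial_limit_within)
  qed
  have d: "d (sg e * s) = sg e *\<^sub>R prof' e x a s" if "0 \<le> s" for s
    unfolding d_def
    by (rule vector_derivative_within[OF bot has_vector_derivative_at_within[OF f'[OF that]]])
       (use that in \<open>simp add: half_def\<close>)
  have R: "norm (prof' e x a s) \<le> R" if "0 \<le> s" for s
  proof -
    have "norm (d (sg e * s)) \<le> R"
      using sol that unfolding half_sol_def d_def by (simp add: half_def)
    then show ?thesis using d[OF that] by simp
  qed
  then show "0 \<le> t \<Longrightarrow> norm (prof' e x a t) \<le> R" .
  have "(?f \<longlongrightarrow> fst x) (far e)" using sol unfolding half_sol_def by simp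
  from filterlim_compose[OF this filterlim_far]
  show lim: "(prof e x a \<longlongrightarrow> fst x) at_top" unfolding prof_def[abs_def] .
  have int: "d absolutely_integrable_on half e" "integral (half e) (\<lambda>z. norm (d z)) \<le> R"
    using sol unfolding half_sol_def d_def by auto
  have diff: "norm (?f q - ?f p) \<le> R" if pq: "p \<le> q" "{p..q} \<subseteq> half e" for p q
  proof -
    have der: "(?f has_vector_derivative d z) (at z within {p..q})" if "z \<in> {p..q}" for z
    proof -
      have "0 \<le> sg e * z" using pq that by (auto simp: half_def)
      from f'[OF this] d[OF this] show ?thesis by (simp add: has_vector_derivative_at_within)
    qed
    have "(d has_integral ?f q - ?f p) {p..q}"
      by (rule fundamental_theorem_of_calculus[OF pq(1) der])
    then have "norm (?f q - ?f p) = norm (integral {p..q} d)"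
      by (simp add: integral_unique)
    also have "d absolutely_integrable_on {p..q}"
      using absolutely_integrable_on_subinterval[OF int(1), of p q] pq(2) by simp
    then have "norm (integral {p..q} d) \<le> integral {p..q} (\<lambda>z. norm (d z))"
      by (intro integral_norm_bound_integral) (auto simp: absolutely_integrable_on_def)
    also have "\<dots> \<le> integral (half e) (\<lambda>z. norm (d z))"
      using int(1) \<open>d absolutely_integrable_on {p..q}\<close>
      by (intro integral_subset_le[OF pq(2)]) (auto simp: absolutely_integrable_on_def)
    finally show ?thesis using int(2) by simp
  qed
  have inc: "norm (prof e x a T - prof e x a t) \<le> R" if "0 \<le> t" "t \<le> T" for t T
  proof (cases e)
    case Pl
    then show ?thesis using diff[of t T] that by (simp add: prof_def half_Pl subset_iff)
  next
    case Mi
    then show ?thesis using diff[of "-T" "-t"] that by (simp add: prof_def half_Mi subset_iff norm_minus_commute)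
  qed
  show "norm (prof e x a t - fst x) \<le> R" if "0 \<le> t"
  proof -
    have "((\<lambda>T. norm (prof e x a T - prof e x a t)) \<longlongrightarrow> norm (fst x - prof e x a t)) at_top"
      by (intro tendsto_intros lim)
    moreover have "eventually (\<lambda>T. norm (prof e x a T - prof e x a t) \<le> R) at_top"
      using eventually_ge_at_top[of t] by eventually_elim (rule inc[OF that])
    ultimately have "norm (fst x - prof e x a t) \<le> R"
      by (rule tendsto_upperbound) simp
    then show ?thesis by (simp add: norm_minus_commute)
  qed
qed

text \<open>The linearized profile equation in the outgoing variable, solved for the term with the second
  derivative; \<open>\<tau>\<close> is the variation of the parameters \<open>(s, h)\<close>.\<close>

definition mode_rhs :: "side \<Rightarrow> ('n, 'd) side_state \<Rightarrow> real^'n \<Rightarrow> real \<Rightarrow> real^'d \<Rightarrow> real^'n \<Rightarrow> real^'n \<Rightarrow> real^'n" where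
  "mode_rhs e x a t \<tau> v y =
     sg e *\<^sub>R (D_Acal A dd (prof e x a t) (snd x) v *v prof' e x a t + Acal A dd (prof e x a t) (snd x) *v y
        - (\<tau> $ dd) *\<^sub>R prof' e x a t - (\<Sum>j\<in>UNIV - {dd}. (\<tau> $ j) *\<^sub>R (A j (prof e x a t) *v prof' e x a t)))
     - (2 * (\<Sum>j\<in>UNIV - {dd}. snd x $ j * \<tau> $ j)) *\<^sub>R (sg e *\<^sub>R (Gd A dd (prof e x a t, snd x) *v prof' e x a t))"

definition linear_mode :: "side \<Rightarrow> ('n, 'd) side_state \<Rightarrow> real^'n \<Rightarrow> real^'d \<Rightarrow> (real \<Rightarrow> real^'n) \<Rightarrow> (real \<Rightarrow> real^'n) \<Rightarrow> bool" where
  "linear_mode e x a \<tau> v y \<longleftrightarrow> (\<forall>t\<ge>zb. (v has_vector_derivative y t) (at t within {zb..}) \<and>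
     (y has_vector_derivative (1 / (1 + hsq dd (snd x))) *\<^sub>R mode_rhs e x a t \<tau> (v t) (y t)) (at t within {zb..}))"

lemma mode_rhs_add:
  assumes "prof e x a t \<in> Us"
  shows "mode_rhs e x a t (\<tau> + \<tau>') (v + v') (y + y') = mode_rhs e x a t \<tau> v y + mode_rhs e x a t \<tau>' v' y'"
proof -
  have D: "D_Acal A dd (prof e x a t) (snd x) (v + v') = D_Acal A dd (prof e x a t) (snd x) v + D_Acal A dd (prof e x a t) (snd x) v'"
    by (rule linear_add[OF D_Acal_linear[OF assms]])
  show ?thesis
    unfolding mode_rhs_def D
    by (simp add: mv.add_left mv.add_right scaleR_add_left sum.distrib distrib_left scaleR_diff_right scaleR_add_right
        distrib_right)
qed

lemma mode_rhs_scaleR: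
  assumes "prof e x a t \<in> Us"
  shows "mode_rhs e x a t (\<kappa> *\<^sub>R \<tau>) (\<kappa> *\<^sub>R v) (\<kappa> *\<^sub>R y) = \<kappa> *\<^sub>R mode_rhs e x a t \<tau> v y"
proof -
  have D: "D_Acal A dd (prof e x a t) (snd x) (\<kappa> *\<^sub>R v) = \<kappa> *\<^sub>R D_Acal A dd (prof e x a t) (snd x) v"
    by (rule linear_scale[OF D_Acal_linear[OF assms]])
  have S: "(\<Sum>j\<in>UNIV - {dd}. snd x $ j * (\<kappa> *\<^sub>R \<tau>) $ j) = \<kappa> * (\<Sum>j\<in>UNIV - {dd}. snd x $ j * \<tau> $ j)"
    by (simp add: sum_distrib_left mult_ac)
  have S': "(\<Sum>j\<in>UNIV - {dd}. ((\<kappa> *\<^sub>R \<tau>) $ j) *\<^sub>R (A j (prof e x a t) *v prof' e x a t)) =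
      \<kappa> *\<^sub>R (\<Sum>j\<in>UNIV - {dd}. (\<tau> $ j) *\<^sub>R (A j (prof e x a t) *v prof' e x a t))"
    by (simp add: scaleR_sum_right)
  show ?thesis
    unfolding mode_rhs_def D S S'
    by (simp add: mv.scaleR_left mv.scaleR_right scaleR_diff_right scaleR_add_right mult_ac)
qed

lemma linear_mode_add:
  assumes adm: "admissible e x a" and m: "linear_mode e x a \<tau> v y" "linear_mode e x a \<tau>' v' y'"
  shows "linear_mode e x a (\<tau> + \<tau>') (\<lambda>t. v t + v' t) (\<lambda>t. y t + y' t)"
  unfolding linear_mode_def
proof (intro allI impI conjI)
  fix t assume t: "zb \<le> t"
  show "((\<lambda>t. v t + v' t) has_vector_derivative y t + y' t) (at t within {zb..})"
    using m t unfolding linear_mode_def by (intro has_vector_derivative_add) auto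
  have "((\<lambda>t. y t + y' t) has_vector_derivative
     (1 / (1 + hsq dd (snd x))) *\<^sub>R mode_rhs e x a t \<tau> (v t) (y t) + (1 / (1 + hsq dd (snd x))) *\<^sub>R mode_rhs e x a t \<tau>' (v' t) (y' t)) (at t within {zb..})"
    using m t unfolding linear_mode_def by (intro has_vector_derivative_add) auto
  then show "((\<lambda>t. y t + y' t) has_vector_derivative (1 / (1 + hsq dd (snd x))) *\<^sub>R mode_rhs e x a t (\<tau> + \<tau>') (v t + v' t) (y t + y' t)) (at t within {zb..})"
    unfolding mode_rhs_add[OF prof_ode(3)[OF adm t]] scaleR_add_right .
qed

lemma linear_mode_scaleR:
  assumes adm: "admissible e x a" and m: "linear_mode e x a \<tau> v y"
  shows "linear_mode e x a (\<kappa> *\<^sub>R \<tau>) (\<lambda>t. \<kappa> *\<^sub>R v t) (\<lambda>t. \<kappa> *\<^sub>R y t)"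
  unfolding linear_mode_def
proof (intro allI impI conjI)
  fix t assume t: "zb \<le> t"
  show "((\<lambda>t. \<kappa> *\<^sub>R v t) has_vector_derivative \<kappa> *\<^sub>R y t) (at t within {zb..})"
    using m t unfolding linear_mode_def
    by (intro bounded_linear.has_vector_derivative[OF bounded_linear_scaleR_right]) auto
  have "((\<lambda>t. \<kappa> *\<^sub>R y t) has_vector_derivative
     \<kappa> *\<^sub>R (1 / (1 + hsq dd (snd x))) *\<^sub>R mode_rhs e x a t \<tau> (v t) (y t)) (at t within {zb..})"
    using m t unfolding linear_mode_def
    by (intro bounded_linear.has_vector_derivative[OF bounded_linear_scaleR_right]) auto
  then show "((\<lambda>t. \<kappa> *\<^sub>R y t) has_vector_derivative (1 / (1 + hsq dd (snd x))) *\<^sub>R mode_rhs e x a t (\<kappa> *\<^sub>R \<tau>) (\<kappa> *\<^sub>R v t) (\<kappa> *\<^sub>R y t)) (at t within {zb..})"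
    unfolding mode_rhs_scaleR[OF prof_ode(3)[OF adm t]] by (simp add: mult.commute)
qed

lemma linear_mode_diff:
  assumes adm: "admissible e x a" and m: "linear_mode e x a \<tau> v y" "linear_mode e x a \<tau>' v' y'"
  shows "linear_mode e x a (\<tau> - \<tau>') (\<lambda>t. v t - v' t) (\<lambda>t. y t - y' t)"
  using linear_mode_add[OF adm m(1) linear_mode_scaleR[OF adm m(2), where \<kappa> = "-1"]] by simp

text \<open>Only amplitudes in the decay space are meaningful, so an open set of parameters has to be intersected
  with \<open>params e\<close> below, and derivatives are taken within it.\<close>

definition admissible_nbhd :: "side \<Rightarrow> (('n, 'd) side_state \<times> (real^'n)) set \<Rightarrow> bool" where
  "admissible_nbhd e S \<longleftrightarrow> open S \<and> (\<forall>x a. (x, a) \<in> S \<longrightarrow> a \<in> amplitudes e \<longrightarrow> admissible e x a)"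

lemma admissible_nbhdD:
  "\<lbrakk>admissible_nbhd e S; (x, a) \<in> S; a \<in> amplitudes e\<rbrakk> \<Longrightarrow> admissible e x a"
  unfolding admissible_nbhd_def by blast

abbreviation params :: "side \<Rightarrow> (('n, 'd) side_state \<times> (real^'n)) set" where
  "params e \<equiv> UNIV \<times> amplitudes e"

lemma subspace_decay_space: "subspace (decay_space A dd e x)"
  unfolding decay_space_def spectral_space_def by (rule subspace_span)

text \<open>By the profile equation the third map is the derivative of the second one in \<open>t\<close>, and derivatives of
  smooth maps in \<open>t\<close> are smooth.\<close>

lemma prof_smooth:
  assumes S: "admissible_nbhd e S"
  shows "smooth_on ({zb..} \<times> (S \<inter> params e)) (\<lambda>(t, p). prof e (fst p) (snd p) t)" (is ?A)
    and "smooth_on ({zb..} \<times> (S \<inter> params e)) (\<lambda>(t, p). prof' e (fst p) (snd p) t)" (is ?B)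
    and "smooth_on ({zb..} \<times> (S \<inter> params e))
       (\<lambda>(t, p). sg e *\<^sub>R (Gd A dd (prof e (fst p) (snd p) t, snd (fst p)) *v prof' e (fst p) (snd p) t))" (is ?C)
proof -
  let ?P = "S \<inter> params e"
  have adm: "admissible e (fst p) (snd p)" if "p \<in> ?P" for p
    using S that unfolding admissible_nbhd_def by (cases p) auto
  have lin: "bounded_linear (\<lambda>y :: real \<times> ('n, 'd) side_state \<times> (real^'n). (sg e * fst y, snd y))"
    by (intro bounded_linear_Pair bounded_linear_snd
        bounded_linear_compose[OF bounded_linear_mult_right bounded_linear_fst])
  have "smooth_on ({zb..} \<times> ?P)
     (\<lambda>y. (\<lambda>(z, x, a). Phi e z x a) (0 + (sg e * fst y, snd y)))"
  proof (rule smooth_on_compose_affine[OF Phi_smooth[of e] lin])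
    fix y assume y: "y \<in> {zb..} \<times> ?P"
    obtain t x a where y': "y = (t, x, a)" by (cases y)
    have ad: "admissible e x a" using adm[of "(x, a)"] y y' by auto
    have "sg e * t \<in> max_dom A dd Us (snd x) e (\<lambda>z. Phi e z x a)"
      using max_dom_facts(3)[OF ad] y y' by simp
    then show "0 + (sg e * fst y, snd y) \<in> {(z, x, a). x \<in> om e \<and> a \<in> amplitudes e \<and> norm a \<le> r \<and>
              z \<in> half e \<union> max_dom A dd Us (snd x) e (\<lambda>z. Phi e z x a)}"
      using ad y' by (simp add: admissible_def)
  qed
  then show A: ?A by (simp add: prof_def case_prod_unfold)
  have lim: "t islimpt {zb..}" if "t \<in> {zb..}" for t using islimpt_atLeast[OF that] .
  show B: ?B
    by (rule smooth_on_partial_fst[OF A lim])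
       (use prof_ode(1)[OF adm] in \<open>auto intro: has_vector_derivative_at_within\<close>)
  show ?C
    by (rule smooth_on_partial_fst[OF B lim])
       (use prof_ode(2)[OF adm] in \<open>auto intro: has_vector_derivative_at_within\<close>)
qed

text \<open>Differentiate the profile equation in \<open>\<theta>\<close> and exchange the derivatives in \<open>t\<close> and \<open>\<theta>\<close>.\<close>

lemma variation_along_line:
  assumes S: "admissible_nbhd e S" and p: "(x, a) \<in> S" "a \<in> amplitudes e"
    and da: "da \<in> amplitudes e"
    and w: "\<And>t. zb \<le> t \<Longrightarrow> ((\<lambda>\<theta>. prof e (x + \<theta> *\<^sub>R dx) (a + \<theta> *\<^sub>R da) t) has_vector_derivative w t) (at 0)"
    and y: "\<And>t. zb \<le> t \<Longrightarrow> ((\<lambda>\<theta>. prof' e (x + \<theta> *\<^sub>R dx) (a + \<theta> *\<^sub>R da) t) has_vector_derivative y t) (at 0)"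
  shows "linear_mode e x a (snd dx) w y"
proof -
  have "open S" using S by (simp add: admissible_nbhd_def)
  then obtain \<delta> :: real where \<delta>: "\<delta> > 0" "\<And>\<theta>. \<theta> \<in> {-\<delta><..<\<delta>} \<Longrightarrow> (x, a) + \<theta> *\<^sub>R (dx, da) \<in> S"
    using segment_in_open[OF _ p(1), of "(dx, da)"] by metis
  define I where "I = {-\<delta><..<\<delta>}"
  have I: "open I" "convex I" "0 \<in> I" unfolding I_def using \<delta>(1) by auto
  have seg: "(x, a) + \<theta> *\<^sub>R (dx, da) \<in> S \<inter> params e" if "\<theta> \<in> I" for \<theta>
    using \<delta>(2) that p(2) da unfolding I_def
    by (auto intro!: subspace_add[OF subspace_decay_space] subspace_scale[OF subspace_decay_space])
  have adm: "admissible e (x + \<theta> *\<^sub>R dx) (a + \<theta> *\<^sub>R da)" if "\<theta> \<in> I" for \<theta>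
    by (rule admissible_nbhdD[OF S]) (use seg[OF that] in simp_all)
  have lin: "bounded_linear (\<lambda>q :: real \<times> real. (fst q, snd q *\<^sub>R (dx, da)))"
    by (intro bounded_linear_Pair bounded_linear_fst
        bounded_linear_compose[OF bounded_linear_scaleR_left bounded_linear_snd])
  have line: "smooth_on ({zb..} \<times> I) (\<lambda>q. F ((0, (x, a)) + (fst q, snd q *\<^sub>R (dx, da))))"
    if "smooth_on ({zb..} \<times> (S \<inter> params e)) F" for F :: "real \<times> ('n, 'd) side_state \<times> (real^'n) \<Rightarrow> real^'n"
    by (rule smooth_on_compose_affine[OF that lin]) (use seg in auto)
  define F where "F = (\<lambda>(t, \<theta>). prof e (x + \<theta> *\<^sub>R dx) (a + \<theta> *\<^sub>R da) t)"
  define F1 where "F1 = (\<lambda>(t, \<theta>). prof' e (x + \<theta> *\<^sub>R dx) (a + \<theta> *\<^sub>R da) t)"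
  define F11 where "F11 = (\<lambda>(t, \<theta>). sg e *\<^sub>R (Gd A dd (F (t, \<theta>), snd x + \<theta> *\<^sub>R snd dx) *v F1 (t, \<theta>)))"
  have sm: "smooth_on ({zb..} \<times> I) F" "smooth_on ({zb..} \<times> I) F1" "smooth_on ({zb..} \<times> I) F11"
    using line[OF prof_smooth(1)[OF S]] line[OF prof_smooth(2)[OF S]] line[OF prof_smooth(3)[OF S]]
    by (simp_all add: F_def F1_def F11_def case_prod_unfold)
  define F2 where "F2 = (\<lambda>(p, t). vector_derivative (\<lambda>t. F (p, t)) (at t))"
  define F12 where "F12 = (\<lambda>(p, t). vector_derivative (\<lambda>t. F1 (p, t)) (at t))"
  define F112 where "F112 = (\<lambda>(p, t). vector_derivative (\<lambda>t. F11 (p, t)) (at t))"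
  note s2 = smooth_on_partial_snd_open[OF sm(1) I(1), folded F2_def]
  note s12 = smooth_on_partial_snd_open[OF sm(2) I(1), folded F12_def]
  note s112 = smooth_on_partial_snd_open[OF sm(3) I(1), folded F112_def]
  have d1: "((\<lambda>t. F (t, \<theta>)) has_vector_derivative F1 (t, \<theta>)) (at t within {zb..})" if "t \<in> {zb..}" "\<theta> \<in> I" for t \<theta>
    using prof_ode(1)[OF adm[OF that(2)], of t] that(1)
    by (simp add: F_def F1_def has_vector_derivative_at_within)
  have d11: "((\<lambda>t. F1 (t, \<theta>)) has_vector_derivative F11 (t, \<theta>)) (at t within {zb..})" if "t \<in> {zb..}" "\<theta> \<in> I" for t \<theta>
    using prof_ode(2)[OF adm[OF that(2)], of t] that(1)
    by (simp add: F_def F1_def F11_def has_vector_derivative_at_within)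
  have w_eq: "F2 (t, 0) = w t" if "t \<in> {zb..}" for t
    using w[of t] that unfolding F2_def F_def by (simp add: vector_derivative_at)
  have y_eq: "F12 (t, 0) = y t" if "t \<in> {zb..}" for t
    using y[of t] that unfolding F12_def F1_def by (simp add: vector_derivative_at)
  have F112_eq: "F112 (t, 0) = (1 / (1 + hsq dd (snd x))) *\<^sub>R mode_rhs e x a t (snd dx) (w t) (y t)" if t: "t \<in> {zb..}" for t
  proof -
    let ?\<sigma> = "snd x" and ?\<tau> = "snd dx" and ?u = "prof e x a t" and ?V = "prof' e x a t"
    let ?s = "\<lambda>\<theta>::real. ?\<sigma> + \<theta> *\<^sub>R ?\<tau>"
    define DX where "DX = D_Acal A dd ?u ?\<sigma> (w t) - (?\<tau> $ dd) *\<^sub>R mat 1 - (\<Sum>j\<in>UNIV - {dd}. (?\<tau> $ j) *\<^sub>R A j ?u)"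
    have adm0: "admissible e x a" using adm[OF I(3)] by simp
    have u: "?u \<in> Us" using prof_ode(3)[OF adm0] t by simp
    have F': "((\<lambda>\<theta>. F (t, \<theta>)) has_vector_derivative w t) (at 0)"
      using w[of t] t by (simp add: F_def)
    have F1': "((\<lambda>\<theta>. F1 (t, \<theta>)) has_vector_derivative y t) (at 0)"
      using y[of t] t by (simp add: F1_def)
    have F11': "((\<lambda>\<theta>. F11 (t, \<theta>)) has_vector_derivative F112 (t, 0)) (at 0)"
      using s112(1)[OF t I(3)] .
    have Aj: "((\<lambda>\<theta>. A j (F (t, \<theta>))) has_vector_derivative frechet_derivative (A j) (at ?u) (w t)) (at 0)" for j
      by (rule has_vector_derivative_along[OF A_has_derivative[OF u] F']) (auto simp: F_def)
    have comp: "((\<lambda>\<theta>. ?s \<theta> $ j) has_real_derivative ?\<tau> $ j) (at 0)" for j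
      by (rule derivative_eq_intros refl | simp)+
    have sA: "((\<lambda>\<theta>. (?s \<theta> $ j) *\<^sub>R A j (F (t, \<theta>))) has_vector_derivative
        (?s 0 $ j) *\<^sub>R frechet_derivative (A j) (at ?u) (w t) + (?\<tau> $ j) *\<^sub>R A j (F (t, 0))) (at 0)" for j
      by (rule has_vector_derivative_scaleR[OF comp Aj])
    have sI: "((\<lambda>\<theta>. (?s \<theta> $ dd) *\<^sub>R (mat 1 :: real^'n^'n)) has_vector_derivative
        (?s 0 $ dd) *\<^sub>R 0 + (?\<tau> $ dd) *\<^sub>R mat 1) (at 0)"
      by (rule has_vector_derivative_scaleR[OF comp has_vector_derivative_const])
    have "((\<lambda>\<theta>. Acal A dd (F (t, \<theta>)) (?s \<theta>)) has_vector_derivative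
        frechet_derivative (A dd) (at ?u) (w t) - ((?s 0 $ dd) *\<^sub>R 0 + (?\<tau> $ dd) *\<^sub>R mat 1)
        - (\<Sum>j\<in>UNIV - {dd}. (?s 0 $ j) *\<^sub>R frechet_derivative (A j) (at ?u) (w t) + (?\<tau> $ j) *\<^sub>R A j (F (t, 0)))) (at 0)"
      unfolding Acal_def
      by (intro has_vector_derivative_diff has_vector_derivative_sum Aj sA sI)
    also have "frechet_derivative (A dd) (at ?u) (w t) - ((?s 0 $ dd) *\<^sub>R 0 + (?\<tau> $ dd) *\<^sub>R mat 1)
        - (\<Sum>j\<in>UNIV - {dd}. (?s 0 $ j) *\<^sub>R frechet_derivative (A j) (at ?u) (w t) + (?\<tau> $ j) *\<^sub>R A j (F (t, 0))) = DX"
      unfolding DX_def D_Acal_def by (simp add: F_def sum.distrib algebra_simps)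
    finally have X: "((\<lambda>\<theta>. Acal A dd (F (t, \<theta>)) (?s \<theta>)) has_vector_derivative DX) (at 0)" .
    have "((\<lambda>\<theta>. sg e *\<^sub>R (Acal A dd (F (t, \<theta>)) (?s \<theta>) *v F1 (t, \<theta>))) has_vector_derivative
        sg e *\<^sub>R (Acal A dd (F (t, 0)) (?s 0) *v y t + DX *v F1 (t, 0))) (at 0)"
      by (rule bounded_linear.has_vector_derivative[OF bounded_linear_scaleR_right mv.has_vector_derivative[OF X F1']])
    then have rhs: "((\<lambda>\<theta>. sg e *\<^sub>R (Acal A dd (F (t, \<theta>)) (?s \<theta>) *v F1 (t, \<theta>))) has_vector_derivative
        sg e *\<^sub>R (Acal A dd ?u ?\<sigma> *v y t + DX *v ?V)) (at 0)"
      by (simp add: F_def F1_def)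
    define n' where "n' = 2 * (\<Sum>j\<in>UNIV - {dd}. ?\<sigma> $ j * ?\<tau> $ j)"
    have "((\<lambda>\<theta>. 1 + (\<Sum>j\<in>UNIV - {dd}. (?s \<theta> $ j)\<^sup>2)) has_real_derivative
        0 + (\<Sum>j\<in>UNIV - {dd}. of_nat 2 * (?\<tau> $ j * ?s 0 $ j ^ (2 - Suc 0)))) (at 0)"
      by (intro DERIV_add DERIV_const DERIV_sum DERIV_power comp)
    then have "((\<lambda>\<theta>. 1 + hsq dd (?s \<theta>)) has_real_derivative n') (at 0)"
      unfolding hsq_def n'_def by (simp add: sum_distrib_left mult_ac)
    from has_vector_derivative_scaleR[OF this F11']
    have lhs: "((\<lambda>\<theta>. (1 + hsq dd (?s \<theta>)) *\<^sub>R F11 (t, \<theta>)) has_vector_derivative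
        (1 + hsq dd ?\<sigma>) *\<^sub>R F112 (t, 0) + n' *\<^sub>R F11 (t, 0)) (at 0)"
      by simp
    (* Multiplied by 1 + |h|^2, the profile equation is polynomial in the parameters. *)
    have eq: "(1 + hsq dd (?s \<theta>)) *\<^sub>R F11 (t, \<theta>) = sg e *\<^sub>R (Acal A dd (F (t, \<theta>)) (?s \<theta>) *v F1 (t, \<theta>))" for \<theta>
      using hsq_pos[of dd "?s \<theta>"] unfolding F11_def Gd_def by (simp add: mv.scaleR_left)
    have "(1 + hsq dd ?\<sigma>) *\<^sub>R F112 (t, 0) + n' *\<^sub>R F11 (t, 0) = sg e *\<^sub>R (Acal A dd ?u ?\<sigma> *v y t + DX *v ?V)"
      using vector_derivative_unique_at[OF lhs[unfolded eq] rhs] .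
    moreover have "F11 (t, 0) = sg e *\<^sub>R (Gd A dd (?u, ?\<sigma>) *v ?V)"
      by (simp add: F11_def F_def F1_def)
    moreover have "DX *v ?V = D_Acal A dd ?u ?\<sigma> (w t) *v ?V - (?\<tau> $ dd) *\<^sub>R ?V - (\<Sum>j\<in>UNIV - {dd}. (?\<tau> $ j) *\<^sub>R (A j ?u *v ?V))"
      unfolding DX_def by (simp add: mv.diff_left mv.sum_left mv.scaleR_left)
    ultimately have "(1 + hsq dd ?\<sigma>) *\<^sub>R F112 (t, 0) = mode_rhs e x a t ?\<tau> (w t) (y t)"
      unfolding mode_rhs_def n'_def by (simp add: algebra_simps)
    then show ?thesis
      using hsq_pos[of dd ?\<sigma>] by (metis less_irrefl scaleR_scaleR scaleR_one nonzero_divide_eq_eq divide_self mult.left_neutral times_divide_eq_left)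
  qed
  show ?thesis
    unfolding linear_mode_def
  proof (intro allI impI conjI)
    fix t assume "zb \<le> t"
    then have t: "t \<in> {zb..}" by simp
    have "((\<lambda>t. F2 (t, 0)) has_vector_derivative F12 (t, 0)) (at t within {zb..})"
      by (rule mixed_partials_commute[OF I(1,2) d1 s2(1) s12(1) smooth_on_imp_continuous_on[OF sm(2)]
            smooth_on_imp_continuous_on[OF s12(2)] t I(3)])
    then show "(w has_vector_derivative y t) (at t within {zb..})"
      unfolding y_eq[OF t] by (rule has_vector_derivative_transform[OF t, rotated]) (simp add: w_eq)
    have "((\<lambda>t. F12 (t, 0)) has_vector_derivative F112 (t, 0)) (at t within {zb..})"
      by (rule mixed_partials_commute[OF I(1,2) d11 s12(1) s112(1) smooth_on_imp_continuous_on[OF sm(3)]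
            smooth_on_imp_continuous_on[OF s112(2)] t I(3)])
    then show "(y has_vector_derivative (1 / (1 + hsq dd (snd x))) *\<^sub>R mode_rhs e x a t (snd dx) (w t) (y t)) (at t within {zb..})"
      unfolding F112_eq[OF t] by (rule has_vector_derivative_transform[OF t, rotated]) (simp add: y_eq)
  qed
qed

lemma variation:
  assumes S: "admissible_nbhd e S" and p: "(x, a) \<in> S" "a \<in> amplitudes e"
  obtains Dw Dy where
    "\<And>t. zb \<le> t \<Longrightarrow> ((\<lambda>p. prof e (fst p) (snd p) t) has_derivative Dw t) (at (x, a) within params e)"
    "\<And>t. zb \<le> t \<Longrightarrow> ((\<lambda>p. prof' e (fst p) (snd p) t) has_derivative Dy t) (at (x, a) within params e)"
    "\<And>dx da. da \<in> amplitudes e \<Longrightarrow> linear_mode e x a (snd dx) (\<lambda>t. Dw t (dx, da)) (\<lambda>t. Dy t (dx, da))"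
proof -
  have "open S" using S by (simp add: admissible_nbhd_def)
  have at: "at (x, a) within S \<inter> params e = at (x, a) within params e"
    by (rule at_within_nhd[OF p(1) \<open>open S\<close>]) auto
  have mem: "(t, x, a) \<in> {zb..} \<times> (S \<inter> params e)" if "zb \<le> t" for t using p that by auto
  have slice: "\<exists>D. ((\<lambda>p. F (t, p)) has_derivative D) (at (x, a) within params e)"
    if that': "zb \<le> t" "smooth_on ({zb..} \<times> (S \<inter> params e)) F" for t and F :: "real \<times> ('n, 'd) side_state \<times> (real^'n) \<Rightarrow> real^'n"
  proof -
    obtain D where D: "(F has_derivative D) (at (t, x, a) within {zb..} \<times> (S \<inter> params e))"
      using smooth_on_has_derivative[OF that'(2) mem[OF that'(1)]] by metis
    have "((\<lambda>p. (t, p)) has_derivative (\<lambda>h. (0, h))) (at (x, a) within S \<inter> params e)"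
      by (intro has_derivative_Pair has_derivative_const has_derivative_ident)
    moreover have "(F has_derivative D) (at (t, x, a) within (\<lambda>p. (t, p)) ` (S \<inter> params e))"
      by (rule has_derivative_subset[OF D]) (use that'(1) in auto)
    ultimately have "((\<lambda>p. F (t, p)) has_derivative (\<lambda>h. D (0, h))) (at (x, a) within S \<inter> params e)"
      by (rule has_derivative_in_compose)
    then show ?thesis unfolding at by blast
  qed
  define Dw where "Dw t = (SOME D. ((\<lambda>p. prof e (fst p) (snd p) t) has_derivative D) (at (x, a) within params e))" for t
  define Dy where "Dy t = (SOME D. ((\<lambda>p. prof' e (fst p) (snd p) t) has_derivative D) (at (x, a) within params e))" for t
  have Dw: "((\<lambda>p. prof e (fst p) (snd p) t) has_derivative Dw t) (at (x, a) within params e)" if "zb \<le> t" for t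
  proof -
    have "\<exists>D. ((\<lambda>p. prof e (fst p) (snd p) t) has_derivative D) (at (x, a) within params e)"
      using slice[OF that prof_smooth(1)[OF S]] by (simp only: prod.case)
    from someI_ex[OF this] show ?thesis unfolding Dw_def .
  qed
  have Dy: "((\<lambda>p. prof' e (fst p) (snd p) t) has_derivative Dy t) (at (x, a) within params e)" if "zb \<le> t" for t
  proof -
    have "\<exists>D. ((\<lambda>p. prof' e (fst p) (snd p) t) has_derivative D) (at (x, a) within params e)"
      using slice[OF that prof_smooth(2)[OF S]] by (simp only: prod.case)
    from someI_ex[OF this] show ?thesis unfolding Dy_def .
  qed
  have "linear_mode e x a (snd dx) (\<lambda>t. Dw t (dx, da)) (\<lambda>t. Dy t (dx, da))"
    if da: "da \<in> amplitudes e" for dx da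
  proof (rule variation_along_line[OF S p da])
    fix t assume t: "zb \<le> t"
    have line: "((\<lambda>\<theta>::real. (x, a) + \<theta> *\<^sub>R (dx, da)) has_vector_derivative (dx, da)) (at 0)"
      by (rule derivative_eq_intros refl | simp)+
    have range: "range (\<lambda>\<theta>::real. (x, a) + \<theta> *\<^sub>R (dx, da)) \<subseteq> params e"
      using p(2) da by (auto intro!: subspace_add[OF subspace_decay_space] subspace_scale[OF subspace_decay_space])
    show "((\<lambda>\<theta>. prof e (x + \<theta> *\<^sub>R dx) (a + \<theta> *\<^sub>R da) t) has_vector_derivative Dw t (dx, da)) (at 0)"
      using has_vector_derivative_along[OF Dw[OF t] line _ range] by simp
    show "((\<lambda>\<theta>. prof' e (x + \<theta> *\<^sub>R dx) (a + \<theta> *\<^sub>R da) t) has_vector_derivative Dy t (dx, da)) (at 0)"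
      using has_vector_derivative_along[OF Dy[OF t] line _ range] by simp
  qed
  with Dw Dy show ?thesis by (rule that)
qed

end

section \<open>Decay of variations and of homogeneous modes\<close>

lemma difference_quotient_tendsto:
  fixes f :: "real \<Rightarrow> 'a::real_normed_vector"
  assumes "(f has_vector_derivative d) (at 0)"
  shows "((\<lambda>\<theta>. (1 / \<theta>) *\<^sub>R (f \<theta> - f 0)) \<longlongrightarrow> d) (at 0)"
proof -
  have lim: "((\<lambda>h. norm (f (0 + h) - f 0 - h *\<^sub>R d) / norm h) \<longlongrightarrow> 0) (at 0)"
    using assms unfolding has_vector_derivative_def has_derivative_at by blast
  have ev: "eventually (\<lambda>h. norm (f (0 + h) - f 0 - h *\<^sub>R d) / norm h = norm ((1 / h) *\<^sub>R (f h - f 0) - d)) (at 0)"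
    unfolding eventually_at_filter
  proof (rule always_eventually, intro allI impI)
    fix h :: real assume "h \<noteq> 0"
    then have "(1 / h) *\<^sub>R (f h - f 0) - d = (1 / h) *\<^sub>R (f h - f 0 - h *\<^sub>R d)"
      by (simp add: scaleR_diff_right)
    then show "norm (f (0 + h) - f 0 - h *\<^sub>R d) / norm h = norm ((1 / h) *\<^sub>R (f h - f 0) - d)"
      by (simp add: divide_inverse mult.commute)
  qed
  have "((\<lambda>h. norm ((1 / h) *\<^sub>R (f h - f 0) - d)) \<longlongrightarrow> 0) (at 0)"
    using tendsto_cong[OF ev] lim by simp
  then have "((\<lambda>h. (1 / h) *\<^sub>R (f h - f 0) - d) \<longlongrightarrow> 0) (at 0)"
    by (rule tendsto_norm_zero_cancel)
  then show ?thesis by (rule LIM_zero_cancel)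
qed

text \<open>One side of the shock, together with a Lyapunov form and smallness constants as in
  \<open>uniform_lyapunov_form\<close>.  The last assumption is the condition under which \<open>coupled_estimate\<close> applies to
  profiles whose derivative is bounded by \<open>R\<close>.\<close>

locale small_side =
  half_line_solutions A dd Us U pb wb k Om alpha R r om Phi zb ab + symmetric_form B K c
  for A :: "('n::finite, 'd::finite) coeffs" and dd Us U pb wb k Om alpha R r om Phi zb ab
    and B :: "real^'n \<Rightarrow> real^'n \<Rightarrow> real" and K c +
  fixes e :: side and L \<epsilon> :: real
  assumes L: "0 \<le> L" and \<epsilon>: "\<epsilon> > 0"
    and neg_dim: "\<And>Y. \<lbrakk>subspace Y; \<And>v. \<lbrakk>v \<in> Y; v \<noteq> 0\<rbrakk> \<Longrightarrow> B v v < 0\<rbrakk> \<Longrightarrow> dim Y \<le> dim (amplitudes e)"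
    and near_Us: "\<And>u. norm (u - pb e) \<le> 2 * \<epsilon> \<Longrightarrow> u \<in> Us"
    and coercive: "\<And>u \<sigma> v. \<lbrakk>norm (u - pb e) \<le> 2 * \<epsilon>; norm \<sigma> \<le> \<epsilon>\<rbrakk> \<Longrightarrow> c * (norm v)\<^sup>2 \<le> B v (sg e *\<^sub>R (Gd A dd (u, \<sigma>) *v v))"
    and Gd_lip: "\<And>u \<sigma> u' \<sigma>' v. \<lbrakk>norm (u - pb e) \<le> 2 * \<epsilon>; norm \<sigma> \<le> \<epsilon>; norm (u' - pb e) \<le> 2 * \<epsilon>; norm \<sigma>' \<le> \<epsilon>\<rbrakk> \<Longrightarrow>
        norm (Gd A dd (u, \<sigma>) *v v - Gd A dd (u', \<sigma>') *v v) \<le> L * (norm (u - u') + norm (\<sigma> - \<sigma>')) * norm v"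
    and R_le: "R \<le> \<epsilon>" and om_ball: "om e \<subseteq> ball (pb e, 0) \<epsilon>"
    and small: "32 * K ^ 3 * L\<^sup>2 * tail_const\<^sup>2 * R\<^sup>2 \<le> c ^ 3"
begin

lemma om_near:
  assumes "x \<in> om e" shows "norm (fst x - pb e) < \<epsilon>" "norm (snd x) < \<epsilon>"
proof -
  have "dist (pb e, 0) x < \<epsilon>" using om_ball assms by auto
  then show "norm (fst x - pb e) < \<epsilon>" "norm (snd x) < \<epsilon>"
    using dist_fst_le[of "(pb e, 0)" x] dist_snd_le[of "(pb e, 0)" x]
    by (simp_all add: dist_norm norm_minus_commute)
qed

lemma prof_near:
  assumes adm: "admissible e x a" and t: "0 \<le> t"
  shows "norm (prof e x a t - pb e) < 2 * \<epsilon>" "norm (snd x) < \<epsilon>"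
proof -
  have x: "x \<in> om e" using adm by (simp add: admissible_def)
  show "norm (snd x) < \<epsilon>" by (rule om_near(2)[OF x])
  have "norm (prof e x a t - pb e) \<le> norm (prof e x a t - fst x) + norm (fst x - pb e)"
    using norm_triangle_ineq[of "prof e x a t - fst x" "fst x - pb e"] by simp
  then show "norm (prof e x a t - pb e) < 2 * \<epsilon>"
    using prof_half_line(3)[OF adm t] om_near(1)[OF x] R_le by linarith
qed

lemma prof_coercive:
  assumes "admissible e x a" "0 \<le> t"
  shows "c * (norm v)\<^sup>2 \<le> B v (sg e *\<^sub>R (Gd A dd (prof e x a t, snd x) *v v))"
  using prof_near[OF assms] by (intro coercive) auto

lemma prof_derivs_half:
  assumes "admissible e x a" "0 \<le> t"
  shows "(prof e x a has_vector_derivative prof' e x a t) (at t within {0..})"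
    "(prof' e x a has_vector_derivative sg e *\<^sub>R (Gd A dd (prof e x a t, snd x) *v prof' e x a t)) (at t within {0..})"
  using prof_ode(1,2)[OF assms(1), of t] assms(2) zb by (auto intro: has_vector_derivative_at_within)

text \<open>The difference quotients \<open>D \<theta>\<close> of the profiles tend to \<open>fst dx\<close> as \<open>t \<rightarrow> \<infinity>\<close> for every \<open>\<theta>\<close>, since the
  profiles tend to their end states.  The coupled estimate makes this uniform in \<open>\<theta>\<close>: the constant
  only involves \<open>Y \<theta> 0\<close>, which converges.\<close>

lemma variation_limit:
  assumes S: "admissible_nbhd e S" and p: "(x, a) \<in> S" "a \<in> amplitudes e"
    and da: "da \<in> amplitudes e"
    and w: "\<And>t. 0 \<le> t \<Longrightarrow> ((\<lambda>\<theta>. prof e (x + \<theta> *\<^sub>R dx) (a + \<theta> *\<^sub>R da) t) has_vector_derivative w t) (at 0)"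
    and y: "((\<lambda>\<theta>. prof' e (x + \<theta> *\<^sub>R dx) (a + \<theta> *\<^sub>R da) 0) has_vector_derivative y) (at 0)"
  shows "(w \<longlongrightarrow> fst dx) at_top"
proof -
  have "open S" using S by (simp add: admissible_nbhd_def)
  then obtain \<delta> :: real where \<delta>: "\<delta> > 0" "\<And>\<theta>. \<theta> \<in> {-\<delta><..<\<delta>} \<Longrightarrow> (x, a) + \<theta> *\<^sub>R (dx, da) \<in> S"
    using segment_in_open[OF _ p(1), of "(dx, da)"] by metis
  define X where "X \<theta> = x + \<theta> *\<^sub>R dx" for \<theta>
  define a' where "a' \<theta> = a + \<theta> *\<^sub>R da" for \<theta>
  have adm: "admissible e (X \<theta>) (a' \<theta>)" if "\<theta> \<in> {-\<delta><..<\<delta>}" for \<theta>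
    by (rule admissible_nbhdD[OF S])
       (use \<delta>(2)[OF that] p(2) da in \<open>auto simp: X_def a'_def intro!: subspace_add[OF subspace_decay_space] subspace_scale[OF subspace_decay_space]\<close>)
  have adm0: "admissible e x a" using adm[of 0] \<delta>(1) by (simp add: X_def a'_def)
  define D where "D \<theta> t = (1 / \<theta>) *\<^sub>R (prof e (X \<theta>) (a' \<theta>) t - prof e x a t)" for \<theta> t
  define Y where "Y \<theta> t = (1 / \<theta>) *\<^sub>R (prof' e (X \<theta>) (a' \<theta>) t - prof' e x a t)" for \<theta> t
  define l where "l = fst dx"
  define \<tau> where "\<tau> = norm (snd dx)"
  define bnd where "bnd q = 4 / c * (K * q\<^sup>2 + c / (4 * tail_const\<^sup>2) * (norm l + \<tau>)\<^sup>2)" for q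
  have estimate: "norm (D \<theta> t - l) \<le> tail_const * sqrt (bnd (norm (Y \<theta> 0))) * exp (- rate * t)"
    if \<theta>: "\<theta> \<in> {-\<delta><..<\<delta>}" "\<theta> \<noteq> 0" and t: "0 \<le> t" for \<theta> t
  proof -
    note ad = adm[OF \<theta>(1)]
    let ?G = "\<lambda>t. Gd A dd (prof e (X \<theta>) (a' \<theta>) t, snd (X \<theta>))" and ?Gb = "\<lambda>t. Gd A dd (prof e x a t, snd x)"
    let ?V = "prof' e (X \<theta>) (a' \<theta>)" and ?Vb = "prof' e x a"
    define Y' where "Y' t = (1 / \<theta>) *\<^sub>R (sg e *\<^sub>R (?G t *v ?V t) - sg e *\<^sub>R (?Gb t *v ?Vb t))" for t
    have D': "(D \<theta> has_vector_derivative Y \<theta> s) (at s within {0..})" if "0 \<le> s" for s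
      unfolding D_def Y_def
      by (rule bounded_linear.has_vector_derivative[OF bounded_linear_scaleR_right
            has_vector_derivative_diff[OF prof_derivs_half(1)[OF ad that] prof_derivs_half(1)[OF adm0 that]]])
    have Y_deriv: "(Y \<theta> has_vector_derivative Y' s) (at s within {0..})" if "0 \<le> s" for s
      unfolding Y_def Y'_def
      by (rule bounded_linear.has_vector_derivative[OF bounded_linear_scaleR_right
            has_vector_derivative_diff[OF prof_derivs_half(2)[OF ad that] prof_derivs_half(2)[OF adm0 that]]])
    have lim: "(D \<theta> \<longlongrightarrow> l) at_top"
    proof -
      have "(D \<theta> \<longlongrightarrow> (1 / \<theta>) *\<^sub>R (fst (X \<theta>) - fst x)) at_top"
        unfolding D_def by (intro tendsto_intros prof_half_line ad adm0)
      then show ?thesis using \<theta>(2) by (simp add: X_def l_def)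
    qed
    have By: "c * (norm (Y \<theta> s))\<^sup>2 - K * norm (Y \<theta> s) * (L * (norm (D \<theta> s) + \<tau>) * norm (?Vb s)) \<le> B (Y \<theta> s) (Y' s)"
      if s: "0 \<le> s" for s
    proof -
      define g where "g = (1 / \<theta>) *\<^sub>R (?G s *v ?Vb s - ?Gb s *v ?Vb s)"
      have "norm (?G s *v ?Vb s - ?Gb s *v ?Vb s)
          \<le> L * (norm (prof e (X \<theta>) (a' \<theta>) s - prof e x a s) + norm (snd (X \<theta>) - snd x)) * norm (?Vb s)"
        using prof_near[OF ad s] prof_near[OF adm0 s] by (intro Gd_lip) auto
      also have "prof e (X \<theta>) (a' \<theta>) s - prof e x a s = \<theta> *\<^sub>R D \<theta> s"
        using \<theta>(2) by (simp add: D_def)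
      also have "snd (X \<theta>) - snd x = \<theta> *\<^sub>R snd dx" by (simp add: X_def)
      also have "L * (norm (\<theta> *\<^sub>R D \<theta> s) + norm (\<theta> *\<^sub>R snd dx)) * norm (?Vb s)
          = \<bar>\<theta>\<bar> * (L * (norm (D \<theta> s) + \<tau>) * norm (?Vb s))"
        by (simp add: \<tau>_def algebra_simps)
      finally have g: "norm g \<le> L * (norm (D \<theta> s) + \<tau>) * norm (?Vb s)"
        using \<theta>(2) unfolding g_def by (simp add: divide_le_eq mult.commute)
      have "Y' s = sg e *\<^sub>R (?G s *v Y \<theta> s) + sg e *\<^sub>R g"
        unfolding Y'_def Y_def g_def by (simp add: mv.scaleR_right mv.diff_right algebra_simps)
      then have "B (Y \<theta> s) (Y' s) = B (Y \<theta> s) (sg e *\<^sub>R (?G s *v Y \<theta> s)) + sg e * B (Y \<theta> s) g"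
        by (simp add: bb.add_right bb.scaleR_right)
      moreover have "c * (norm (Y \<theta> s))\<^sup>2 \<le> B (Y \<theta> s) (sg e *\<^sub>R (?G s *v Y \<theta> s))"
        by (rule prof_coercive[OF ad s])
      moreover have "\<bar>sg e * B (Y \<theta> s) g\<bar> \<le> K * norm (Y \<theta> s) * (L * (norm (D \<theta> s) + \<tau>) * norm (?Vb s))"
      proof -
        have "\<bar>sg e * B (Y \<theta> s) g\<bar> \<le> K * (norm (Y \<theta> s) * norm g)"
          using bound[of "Y \<theta> s" g] by (simp add: abs_mult)
        also have "\<dots> \<le> K * (norm (Y \<theta> s) * (L * (norm (D \<theta> s) + \<tau>) * norm (?Vb s)))"
          using g Kpos by (intro mult_left_mono) auto
        finally show ?thesis by (simp add: mult_ac)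
      qed
      ultimately show ?thesis by linarith
    qed
    have Ybd: "norm (Y \<theta> s) \<le> (R + R) / \<bar>\<theta>\<bar>" if "0 \<le> s" for s
      unfolding Y_def using \<theta>(2) prof_half_line(1)[OF ad that] prof_half_line(1)[OF adm0 that]
        norm_triangle_ineq4[of "?V s" "?Vb s"]
      by (simp add: divide_inverse mult.commute mult_left_mono)
    have int: "integral {0..Z} (\<lambda>s. (exp (rate * s) * norm (Y \<theta> s))\<^sup>2) \<le> bnd (norm (Y \<theta> 0))" if Z: "0 \<le> Z" for Z
    proof -
      have "c / 4 * integral {0..Z} (\<lambda>s. (exp (rate * s) * norm (Y \<theta> s))\<^sup>2)
          \<le> - B (Y \<theta> 0) (Y \<theta> 0) + c / (4 * tail_const\<^sup>2) * (norm l + \<tau>)\<^sup>2"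
      proof (rule coupled_estimate[OF D' Y_deriv By prof_derivs_half(2)[OF adm0] prof_coercive[OF adm0]
              prof_half_line(1)[OF adm0] Ybd lim L _ small Z])
        show "0 \<le> \<tau>" by (simp add: \<tau>_def)
      qed
      moreover have "- B (Y \<theta> 0) (Y \<theta> 0) \<le> K * (norm (Y \<theta> 0))\<^sup>2"
        using bound[of "Y \<theta> 0" "Y \<theta> 0"] by (simp add: power2_eq_square abs_le_iff)
      ultimately show ?thesis
        unfolding bnd_def using cpos by (simp add: field_simps)
    qed
    have "continuous_on {0..} (Y \<theta>)"
      unfolding continuous_on_eq_continuous_within
      using has_vector_derivative_continuous[OF Y_deriv] by simp
    from tail_estimate[OF D' this lim int t] show ?thesis .
  qed
  define S1 where "S1 = bnd (norm y + 1)"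
  have final: "norm (w t - l) \<le> tail_const * sqrt S1 * exp (- rate * t)" if t: "0 \<le> t" for t
  proof -
    have Dw: "((\<lambda>\<theta>. D \<theta> t) \<longlongrightarrow> w t) (at 0)"
      using difference_quotient_tendsto[OF w[OF t]] unfolding D_def X_def a'_def by simp
    have "((\<lambda>\<theta>. Y \<theta> 0) \<longlongrightarrow> y) (at 0)"
      using difference_quotient_tendsto[OF y] unfolding Y_def X_def a'_def by simp
    then have "((\<lambda>\<theta>. norm (Y \<theta> 0)) \<longlongrightarrow> norm y) (at 0)" by (rule tendsto_norm)
    then have "eventually (\<lambda>\<theta>. norm (Y \<theta> 0) < norm y + 1) (at 0)"
      by (rule order_tendstoD) simp
    moreover have "eventually (\<lambda>\<theta>. \<theta> \<in> {-\<delta><..<\<delta>}) (at (0::real))"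
      by (rule eventually_at_in_open') (use \<delta>(1) in auto)
    moreover have "eventually (\<lambda>\<theta>. \<theta> \<noteq> 0) (at (0::real))"
      by (simp add: eventually_at_filter)
    ultimately have "eventually (\<lambda>\<theta>. norm (D \<theta> t - l) \<le> tail_const * sqrt S1 * exp (- rate * t)) (at 0)"
    proof eventually_elim
      case (elim \<theta>)
      have "bnd (norm (Y \<theta> 0)) \<le> S1"
        unfolding S1_def bnd_def using elim(1) Kpos cpos
        by (intro mult_left_mono add_right_mono power_mono) auto
      then have "tail_const * sqrt (bnd (norm (Y \<theta> 0))) * exp (- rate * t) \<le> tail_const * sqrt S1 * exp (- rate * t)"
        using tail_const_pos by (intro mult_right_mono mult_left_mono) auto
      then show ?case using estimate[OF elim(2,3) t] by linarith
    qed
    moreover have "((\<lambda>\<theta>. norm (D \<theta> t - l)) \<longlongrightarrow> norm (w t - l)) (at 0)"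
      by (intro tendsto_intros Dw)
    ultimately show ?thesis by (intro tendsto_upperbound) auto
  qed
  have "((\<lambda>t. tail_const * sqrt S1 * exp (- rate * t)) \<longlongrightarrow> tail_const * sqrt S1 * 0) at_top"
  proof (intro tendsto_mult_left filterlim_compose[OF exp_at_bot])
    show "filterlim (\<lambda>t. - rate * t) at_bot at_top"
      by (rule filterlim_tendsto_neg_mult_at_bot[OF tendsto_const _ filterlim_ident]) (use rate_pos in simp)
  qed
  then have exp0: "((\<lambda>t. tail_const * sqrt S1 * exp (- rate * t)) \<longlongrightarrow> 0) at_top" by simp
  have "((\<lambda>t. w t - l) \<longlongrightarrow> 0) at_top"
  proof (rule Lim_null_comparison[OF _ exp0])
    show "eventually (\<lambda>t. norm (w t - l) \<le> tail_const * sqrt S1 * exp (- rate * t)) at_top"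
      using eventually_ge_at_top[of 0] by eventually_elim (rule final)
  qed
  then show ?thesis unfolding l_def by (rule LIM_zero_cancel)
qed

text \<open>A derivative is bounded by the Lipschitz constant.\<close>

lemma D_Acal_bound:
  assumes u: "norm (u - pb e) < 2 * \<epsilon>" and \<sigma>: "norm \<sigma> \<le> \<epsilon>"
  shows "norm ((1 / (1 + hsq dd \<sigma>)) *\<^sub>R (D_Acal A dd u \<sigma> v *v V)) \<le> L * norm v * norm V"
proof -
  have uU: "u \<in> Us" using near_Us[of u] u by simp
  let ?f = "\<lambda>s::real. Gd A dd (u + s *\<^sub>R v, \<sigma>) *v V"
  have "((\<lambda>s::real. u + s *\<^sub>R v) has_vector_derivative v) (at 0)"
    by (rule derivative_eq_intros refl | simp)+
  from has_vector_derivative_along[OF Acal_has_derivative[OF uU] this]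
  have X: "((\<lambda>s. Acal A dd (u + s *\<^sub>R v) \<sigma>) has_vector_derivative D_Acal A dd u \<sigma> v) (at 0)"
    by simp
  have lin: "bounded_linear (\<lambda>N :: real^'n^'n. (1 / (1 + hsq dd \<sigma>)) *\<^sub>R (N *v V))"
    by (rule bounded_linear_compose[OF bounded_linear_scaleR_right mv.bounded_linear_left])
  have "((\<lambda>s. (1 / (1 + hsq dd \<sigma>)) *\<^sub>R (Acal A dd (u + s *\<^sub>R v) \<sigma> *v V)) has_vector_derivative
      (1 / (1 + hsq dd \<sigma>)) *\<^sub>R (D_Acal A dd u \<sigma> v *v V)) (at 0)"
    by (rule bounded_linear.has_vector_derivative[OF lin X])
  then have "(?f has_vector_derivative (1 / (1 + hsq dd \<sigma>)) *\<^sub>R (D_Acal A dd u \<sigma> v *v V)) (at 0)"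
    unfolding Gd_def by (simp add: mv.scaleR_left)
  from tendsto_norm[OF difference_quotient_tendsto[OF this]]
  have lim: "((\<lambda>s. norm ((1 / s) *\<^sub>R (?f s - ?f 0))) \<longlongrightarrow> norm ((1 / (1 + hsq dd \<sigma>)) *\<^sub>R (D_Acal A dd u \<sigma> v *v V))) (at 0)" .
  have "((\<lambda>s::real. norm (u + s *\<^sub>R v - pb e)) \<longlongrightarrow> norm (u + 0 *\<^sub>R v - pb e)) (at 0)"
    by (intro tendsto_intros)
  then have "eventually (\<lambda>s::real. norm (u + s *\<^sub>R v - pb e) < 2 * \<epsilon>) (at 0)"
    by (rule order_tendstoD) (use u in simp)
  moreover have "eventually (\<lambda>s. s \<noteq> 0) (at (0::real))"
    by (simp add: eventually_at_filter)
  ultimately have "eventually (\<lambda>s. norm ((1 / s) *\<^sub>R (?f s - ?f 0)) \<le> L * norm v * norm V) (at 0)"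
  proof eventually_elim
    case (elim s)
    have "norm (?f s - ?f 0) \<le> L * (norm ((u + s *\<^sub>R v) - (u + 0 *\<^sub>R v)) + norm (\<sigma> - \<sigma>)) * norm V"
      using elim u \<sigma> by (intro Gd_lip) auto
    also have "\<dots> = \<bar>s\<bar> * (L * norm v * norm V)" by (simp add: mult_ac)
    finally show ?case using elim(2) by (simp add: divide_le_eq mult.commute)
  qed
  then show ?thesis by (intro tendsto_upperbound[OF lim]) auto
qed

text \<open>For a decaying homogeneous mode the coupled estimate has \<open>- B (y 0) (y 0)\<close> as its right-hand side.  If
  this is not positive, the mode vanishes on \<open>t \<ge> 0\<close>, and then, by uniqueness for the linear equation,
  also on the remaining interval \<open>zb \<le> t \<le> 0\<close>, where the profile need not be small.\<close>

lemma homogeneous_mode_decay: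
  assumes adm: "admissible e x a" and m: "linear_mode e x a 0 v y" and lim: "(v \<longlongrightarrow> 0) at_top"
  shows "B (y 0) (y 0) < 0 \<or> (\<forall>t\<ge>zb. v t = 0 \<and> y t = 0)"
proof (cases "B (y 0) (y 0) < 0")
  case False
  let ?u = "prof e x a" and ?V = "prof' e x a" and ?\<sigma> = "snd x"
  define y' where "y' t = sg e *\<^sub>R (Gd A dd (?u t, ?\<sigma>) *v y t) + sg e *\<^sub>R ((1 / (1 + hsq dd ?\<sigma>)) *\<^sub>R (D_Acal A dd (?u t) ?\<sigma> (v t) *v ?V t))" for t
  have ode: "(v has_vector_derivative y t) (at t within {zb..})" "(y has_vector_derivative y' t) (at t within {zb..})"
    if "zb \<le> t" for t
  proof -
    have "(1 / (1 + hsq dd ?\<sigma>)) *\<^sub>R mode_rhs e x a t 0 (v t) (y t) = y' t"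
      unfolding mode_rhs_def y'_def Gd_def by (simp add: mv.scaleR_left scaleR_add_right add.commute mult.commute)
    then show "(v has_vector_derivative y t) (at t within {zb..})" "(y has_vector_derivative y' t) (at t within {zb..})"
      using m that unfolding linear_mode_def by auto
  qed
  have half: "(v has_vector_derivative y t) (at t within {0..})" "(y has_vector_derivative y' t) (at t within {0..})"
    if "0 \<le> t" for t
    using that zb by (auto intro!: has_vector_derivative_within_subset[OF ode(1)] has_vector_derivative_within_subset[OF ode(2)])
  have g: "norm ((1 / (1 + hsq dd ?\<sigma>)) *\<^sub>R (D_Acal A dd (?u t) ?\<sigma> (v t) *v ?V t)) \<le> L * norm (v t) * norm (?V t)" if "0 \<le> t" for t
    using prof_near[OF adm that] by (intro D_Acal_bound) auto
  have vc: "continuous_on {0..} v" and yc: "continuous_on {0..} y"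
    unfolding continuous_on_eq_continuous_within
    using has_vector_derivative_continuous[OF half(1)] has_vector_derivative_continuous[OF half(2)] by simp_all
  obtain M where M: "\<And>t. 0 \<le> t \<Longrightarrow> norm (v t) \<le> M"
    using bounded_of_limit_at_top[OF vc lim] by metis
  have M0: "0 \<le> M" using M[of 0] norm_ge_zero[of "v 0"] by linarith
  have R0: "0 \<le> R" using R_r(1) by simp
  obtain k0 where k0: "k0 > 0" "\<And>q. norm (Gd A dd (pb e, 0) *v q) \<le> norm q * k0"
    using bounded_linear.pos_bounded[OF mv.bounded_linear_right] by metis
  define \<alpha> where "\<alpha> = k0 + L * (3 * \<epsilon>)"
  have \<alpha>: "\<alpha> > 0" unfolding \<alpha>_def using k0(1) L \<epsilon> by (simp add: add_pos_nonneg)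
  have y'_bound: "norm (y' t) \<le> \<alpha> * norm (y t) + L * M * R" if t: "0 \<le> t" for t
  proof -
    have "norm (Gd A dd (?u t, ?\<sigma>) *v y t - Gd A dd (pb e, 0) *v y t) \<le> L * (norm (?u t - pb e) + norm (?\<sigma> - 0)) * norm (y t)"
      using prof_near[OF adm t] \<epsilon> by (intro Gd_lip) auto
    also have "\<dots> \<le> L * (3 * \<epsilon>) * norm (y t)"
      using prof_near[OF adm t] L by (intro mult_right_mono mult_left_mono) auto
    finally have "norm (Gd A dd (?u t, ?\<sigma>) *v y t) \<le> \<alpha> * norm (y t)"
      using k0(2)[of "y t"] norm_triangle_sub[of "Gd A dd (?u t, ?\<sigma>) *v y t" "Gd A dd (pb e, 0) *v y t"]
      unfolding \<alpha>_def by (simp add: algebra_simps)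
    moreover have "L * norm (v t) * norm (?V t) \<le> L * M * R"
      using M[OF t] M0 R0 L prof_half_line(1)[OF adm t] by (intro mult_mono) auto
    moreover have "norm (y' t) \<le> norm (Gd A dd (?u t, ?\<sigma>) *v y t) + norm ((1 / (1 + hsq dd ?\<sigma>)) *\<^sub>R (D_Acal A dd (?u t) ?\<sigma> (v t) *v ?V t))"
      unfolding y'_def by (rule norm_triangle_le) (simp del: scaleR_scaleR)
    ultimately show ?thesis using g[OF t] by linarith
  qed
  have "0 \<le> L * M * R" using L M0 R0 by simp
  from bounded_derivative_of_bounded[OF half y'_bound M \<alpha> this]
  have y_bd: "norm (y t) \<le> 12 * \<alpha> * M + L * M * R / (2 * \<alpha>)" if "0 \<le> t" for t using that by simp
  have By: "c * (norm (y t))\<^sup>2 - K * norm (y t) * (L * (norm (v t) + 0) * norm (?V t)) \<le> B (y t) (y' t)" if t: "0 \<le> t" for t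
  proof -
    let ?g = "(1 / (1 + hsq dd ?\<sigma>)) *\<^sub>R (D_Acal A dd (?u t) ?\<sigma> (v t) *v ?V t)"
    have "B (y t) (y' t) = B (y t) (sg e *\<^sub>R (Gd A dd (?u t, ?\<sigma>) *v y t)) + sg e * B (y t) ?g"
      unfolding y'_def by (simp add: bb.add_right bb.scaleR_right del: scaleR_scaleR)
    moreover have "c * (norm (y t))\<^sup>2 \<le> B (y t) (sg e *\<^sub>R (Gd A dd (?u t, ?\<sigma>) *v y t))"
      by (rule prof_coercive[OF adm t])
    moreover have "\<bar>sg e * B (y t) ?g\<bar> \<le> K * norm (y t) * (L * norm (v t) * norm (?V t))"
    proof -
      have "\<bar>sg e * B (y t) ?g\<bar> \<le> K * (norm (y t) * norm ?g)"
        using bound[of "y t" ?g] by (simp add: abs_mult)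
      also have "\<dots> \<le> K * (norm (y t) * (L * norm (v t) * norm (?V t)))"
        using g[OF t] Kpos by (intro mult_left_mono) auto
      finally show ?thesis by (simp add: mult_ac)
    qed
    ultimately show ?thesis by simp
  qed
  have int: "integral {0..Z} (\<lambda>s. (exp (rate * s) * norm (y s))\<^sup>2) \<le> 0" if Z: "0 \<le> Z" for Z
  proof -
    have "c / 4 * integral {0..Z} (\<lambda>s. (exp (rate * s) * norm (y s))\<^sup>2)
        \<le> - B (y 0) (y 0) + c / (4 * tail_const\<^sup>2) * (norm (0 :: real^'n) + 0)\<^sup>2"
      by (rule coupled_estimate[OF half By prof_derivs_half(2)[OF adm] prof_coercive[OF adm]
            prof_half_line(1)[OF adm] y_bd lim L _ small Z]) auto
    then have "c * integral {0..Z} (\<lambda>s. (exp (rate * s) * norm (y s))\<^sup>2) \<le> 0"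
      using False by simp
    then show ?thesis using cpos by (simp add: mult_le_0_iff)
  qed
  have v0: "v t = 0" if "0 \<le> t" for t
    using tail_estimate[OF half(1) yc lim int that] by simp
  have y0: "y t = 0" if t: "0 \<le> t" for t
  proof -
    have "((\<lambda>_. 0) has_vector_derivative y t) (at t within {0..})"
      by (rule has_vector_derivative_transform[OF _ _ half(1)[OF t]]) (use t v0 in auto)
    moreover have "((\<lambda>_. 0 :: real^'n) has_vector_derivative 0) (at t within {0..})"
      by (rule has_vector_derivative_const)
    moreover have "at t within {0..} \<noteq> bot"
      using islimpt_atLeast[of t 0] t by (simp add: trivial_limit_within)
    ultimately show ?thesis using vector_derivative_unique_within by metis
  qed
  have uU: "?u t \<in> Us" if "t \<in> {zb..0}" for t using prof_ode(3)[OF adm] that by simp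
  have uc: "continuous_on {zb..0} ?u"
    unfolding continuous_on_eq_continuous_within
    by (intro ballI has_vector_derivative_continuous[OF has_vector_derivative_at_within[OF prof_ode(1)[OF adm]]]) simp
  have Vc: "continuous_on {zb..0} ?V"
    unfolding continuous_on_eq_continuous_within
    by (intro ballI has_vector_derivative_continuous[OF has_vector_derivative_at_within[OF prof_ode(2)[OF adm]]]) simp
  have img: "?u ` {zb..0} \<subseteq> Us" using uU by auto
  have Ac: "continuous_on Us (\<lambda>u. Acal A dd u ?\<sigma>)"
    unfolding continuous_on_eq_continuous_within
    by (intro ballI has_derivative_continuous[OF has_derivative_at_withinI[OF Acal_has_derivative]])
  obtain C1 where C1: "0 \<le> C1" "\<And>t q. t \<in> {zb..0} \<Longrightarrow> norm (Gd A dd (?u t, ?\<sigma>) *v q) \<le> C1 * norm q"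
  proof (rule bounded_linear_family[of "{zb..0}" "\<lambda>t q. Gd A dd (?u t, ?\<sigma>) *v q"])
    show "continuous_on {zb..0} (\<lambda>t. Gd A dd (?u t, ?\<sigma>) *v b)" for b
      unfolding Gd_def fst_conv snd_conv
      by (intro mv.continuous_on continuous_intros continuous_on_compose2[OF Ac uc img])
  qed (auto intro: bounded_linear.linear[OF mv.bounded_linear_right])
  obtain C2 where C2: "0 \<le> C2" "\<And>t q. t \<in> {zb..0} \<Longrightarrow> norm ((1 / (1 + hsq dd ?\<sigma>)) *\<^sub>R (D_Acal A dd (?u t) ?\<sigma> q *v ?V t)) \<le> C2 * norm q"
  proof (rule bounded_linear_family[of "{zb..0}" "\<lambda>t q. (1 / (1 + hsq dd ?\<sigma>)) *\<^sub>R (D_Acal A dd (?u t) ?\<sigma> q *v ?V t)"])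
    show "continuous_on {zb..0} (\<lambda>t. (1 / (1 + hsq dd ?\<sigma>)) *\<^sub>R (D_Acal A dd (?u t) ?\<sigma> b *v ?V t))" for b
      by (intro mv.continuous_on continuous_intros continuous_on_compose2[OF D_Acal_continuous uc img] Vc)
    show "linear (\<lambda>q. (1 / (1 + hsq dd ?\<sigma>)) *\<^sub>R (D_Acal A dd (?u t) ?\<sigma> q *v ?V t))" if "t \<in> {zb..0}" for t
    proof -
      note D = D_Acal_linear[OF uU[OF that], of ?\<sigma>]
      show ?thesis
        by (rule linearI)
           (simp_all add: linear_add[OF D] linear_scale[OF D] mv.add_left mv.scaleR_left scaleR_add_right)
    qed
  qed auto
  have before: "v t = 0 \<and> y t = 0" if t: "t \<in> {zb..0}" for t
  proof (rule backward_uniqueness[where a = zb and b = 0 and y' = y' and C = "C1 + C2"])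
    fix s assume s: "s \<in> {zb..0}"
    show "(v has_vector_derivative y s) (at s within {zb..0})"
      by (rule has_vector_derivative_within_subset[OF ode(1)]) (use s in auto)
    show "(y has_vector_derivative y' s) (at s within {zb..0})"
      by (rule has_vector_derivative_within_subset[OF ode(2)]) (use s in auto)
    have "norm (y' s) \<le> norm (Gd A dd (?u s, ?\<sigma>) *v y s) + norm ((1 / (1 + hsq dd ?\<sigma>)) *\<^sub>R (D_Acal A dd (?u s) ?\<sigma> (v s) *v ?V s))"
      unfolding y'_def by (rule norm_triangle_le) (simp del: scaleR_scaleR)
    also have "\<dots> \<le> C1 * norm (y s) + C2 * norm (v s)"
      by (intro add_mono C1(2) C2(2) s)
    also have "\<dots> \<le> (C1 + C2) * (norm (v s) + norm (y s))"
      using C1(1) C2(1) by (simp add: algebra_simps)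
    finally show "norm (y' s) \<le> (C1 + C2) * (norm (v s) + norm (y s))" .
  qed (use v0 y0 t in auto)
  show ?thesis
  proof (intro disjI2 allI impI)
    fix t assume "zb \<le> t"
    then show "v t = 0 \<and> y t = 0"
      using before[of t] v0[of t] y0[of t] by (cases "0 \<le> t") auto
  qed
qed simp

text \<open>On the initial velocities \<open>y 0\<close> of the decaying modes \<open>B\<close> is negative definite, so that they form a
  space of at most the dimension of the decay space.  The variations in amplitude directions are decaying modes, and
  there are as many of them.\<close>

lemma decaying_modes_are_variations:
  assumes S: "admissible_nbhd e S" and p: "(x, a) \<in> S" "a \<in> amplitudes e"
    and Dy: "linear (Dy 0)"
    and modes: "\<And>da. da \<in> amplitudes e \<Longrightarrow> linear_mode e x a 0 (\<lambda>t. Dw t (0, da)) (\<lambda>t. Dy t (0, da))"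
    and lims: "\<And>da. da \<in> amplitudes e \<Longrightarrow> ((\<lambda>t. Dw t (0, da)) \<longlongrightarrow> 0) at_top"
    and inj: "\<And>da. \<lbrakk>da \<in> amplitudes e; Dw zb (0, da) = 0; Dy zb (0, da) = 0\<rbrakk> \<Longrightarrow> da = 0"
    and m: "linear_mode e x a 0 v y" and lim: "(v \<longlongrightarrow> 0) at_top"
  obtains da where "da \<in> amplitudes e" "\<And>t. zb \<le> t \<Longrightarrow> v t = Dw t (0, da) \<and> y t = Dy t (0, da)"
proof -
  let ?E = "amplitudes e"
  have adm: "admissible e x a" by (rule admissible_nbhdD[OF S p])
  define Y where "Y = {y 0 |v y. linear_mode e x a 0 v y \<and> (v \<longlongrightarrow> 0) at_top}"
  have Y_I: "y 0 \<in> Y" if "linear_mode e x a 0 v y" "(v \<longlongrightarrow> 0) at_top" for v y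
    unfolding Y_def using that by blast
  have "subspace Y"
  proof (rule subspaceI)
    have "linear_mode e x a (0 *\<^sub>R 0) (\<lambda>t. 0 *\<^sub>R v t) (\<lambda>t. 0 *\<^sub>R y t)"
      by (rule linear_mode_scaleR[OF adm m])
    from Y_I[of "\<lambda>t. 0 *\<^sub>R v t" "\<lambda>t. 0 *\<^sub>R y t"] this show "0 \<in> Y" by simp
    fix y1 y2 assume "y1 \<in> Y" "y2 \<in> Y"
    then obtain v1 z1 v2 z2 where 12: "linear_mode e x a 0 v1 z1" "(v1 \<longlongrightarrow> 0) at_top" "y1 = z1 0"
        "linear_mode e x a 0 v2 z2" "(v2 \<longlongrightarrow> 0) at_top" "y2 = z2 0"
      unfolding Y_def by blast
    have "linear_mode e x a 0 (\<lambda>t. v1 t + v2 t) (\<lambda>t. z1 t + z2 t)"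
      using linear_mode_add[OF adm 12(1,4)] by simp
    from Y_I[OF this] tendsto_add[OF 12(2,5)] show "y1 + y2 \<in> Y"
      using 12(3,6) by simp
  next
    fix \<kappa> y1 assume "y1 \<in> Y"
    then obtain v1 z1 where 1: "linear_mode e x a 0 v1 z1" "(v1 \<longlongrightarrow> 0) at_top" "y1 = z1 0"
      unfolding Y_def by blast
    have "linear_mode e x a 0 (\<lambda>t. \<kappa> *\<^sub>R v1 t) (\<lambda>t. \<kappa> *\<^sub>R z1 t)"
      using linear_mode_scaleR[OF adm 1(1), of \<kappa>] by simp
    from Y_I[OF this] tendsto_scaleR[OF tendsto_const[of \<kappa>] 1(2)] show "\<kappa> *\<^sub>R y1 \<in> Y"
      using 1(3) by simp
  qed
  have neg: "B q q < 0" if "q \<in> Y" "q \<noteq> 0" for q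
  proof -
    obtain v1 z1 where 1: "linear_mode e x a 0 v1 z1" "(v1 \<longlongrightarrow> 0) at_top" "q = z1 0"
      using \<open>q \<in> Y\<close> unfolding Y_def by blast
    then show ?thesis
      using homogeneous_mode_decay[OF adm 1(1,2)] zb that(2) by auto
  qed
  define \<Lambda> where "\<Lambda> da = Dy 0 (0, da)" for da
  have lin: "linear \<Lambda>"
  proof (rule linearI)
    show "\<Lambda> (b1 + b2) = \<Lambda> b1 + \<Lambda> b2" for b1 b2
      unfolding \<Lambda>_def using linear_add[OF Dy, of "(0, b1)" "(0, b2)"] by simp
    show "\<Lambda> (\<kappa> *\<^sub>R b) = \<kappa> *\<^sub>R \<Lambda> b" for \<kappa> b
      unfolding \<Lambda>_def using linear_scale[OF Dy, of \<kappa> "(0, b)"] by simp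
  qed
  have "inj_on \<Lambda> (span ?E)"
  proof -
    have "da = 0" if "da \<in> ?E" "\<Lambda> da = 0" for da
    proof -
      have "B (Dy 0 (0, da)) (Dy 0 (0, da)) = 0"
        using that(2) unfolding \<Lambda>_def by (simp add: bb.zero_left)
      then have "Dw zb (0, da) = 0 \<and> Dy zb (0, da) = 0"
        using homogeneous_mode_decay[OF adm modes[OF that(1)] lims[OF that(1)]] by auto
      then show ?thesis using inj[OF that(1)] by blast
    qed
    then have "inj_on \<Lambda> ?E"
      using linear_injective_on_subspace_0[OF lin subspace_decay_space] by blast
    then show ?thesis
      using span_eq_iff[THEN iffD2, OF subspace_decay_space] by metis
  qed
  then have "dim (\<Lambda> ` ?E) = dim ?E" by (rule dim_image_eq[OF lin])
  moreover have sub: "\<Lambda> ` ?E \<subseteq> Y"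
    unfolding \<Lambda>_def using Y_I[OF modes lims] by blast
  moreover have "dim Y \<le> dim ?E" by (rule neg_dim[OF \<open>subspace Y\<close> neg])
  ultimately have "\<Lambda> ` ?E = Y"
    using subspace_dim_equal[OF linear_subspace_image[OF lin subspace_decay_space] \<open>subspace Y\<close>] by metis
  then obtain da where da: "da \<in> ?E" "y 0 = Dy 0 (0, da)"
    using Y_I[OF m lim] unfolding \<Lambda>_def by blast
  have d: "linear_mode e x a 0 (\<lambda>t. v t - Dw t (0, da)) (\<lambda>t. y t - Dy t (0, da))"
    using linear_mode_diff[OF adm m modes[OF da(1)]] by simp
  have "((\<lambda>t. v t - Dw t (0, da)) \<longlongrightarrow> 0) at_top"
    using tendsto_diff[OF lim lims[OF da(1)]] by simp
  from homogeneous_mode_decay[OF adm d this] have "\<forall>t\<ge>zb. v t - Dw t (0, da) = 0 \<and> y t - Dy t (0, da) = 0"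
    using da(2) by (simp add: bb.zero_left)
  then show ?thesis by (intro that[OF da(1)]) auto
qed

end

section \<open>The linearized problem on the two half-lines\<close>

lemma derivative_in_subspace:
  fixes f :: "real \<Rightarrow> 'a::euclidean_space"
  assumes f: "(f has_vector_derivative d) (at 0)" and Q: "subspace Q"
    and mem: "eventually (\<lambda>t. f t \<in> Q) (at 0)" "f 0 \<in> Q"
  shows "d \<in> Q"
proof (rule Lim_in_closed_set[OF closed_subspace[OF Q] _ _ difference_quotient_tendsto[OF f]])
  show "eventually (\<lambda>t. (1 / t) *\<^sub>R (f t - f 0) \<in> Q) (at 0)"
    using mem(1) by eventually_elim (intro subspace_scale[OF Q] subspace_diff[OF Q] mem(2))
qed simp

lemma proj_along_eq_0_iff:
  assumes "complementary F P"
  shows "proj_along F P x = 0 \<longleftrightarrow> x \<in> P"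
proof -
  have F: "subspace F" "subspace P" "F \<inter> P = {0}" and UNIV: "{x + y |x y. x \<in> F \<and> y \<in> P} = UNIV"
    using assms by (auto simp: complementary_def)
  obtain f p where fp: "f \<in> F" "p \<in> P" "x = f + p" using UNIV by blast
  have "proj_along F P x = f"
    unfolding proj_along_def
  proof (rule the_equality)
    show "f \<in> F \<and> x - f \<in> P" using fp by simp
    fix u assume u: "u \<in> F \<and> x - u \<in> P"
    have "u - f \<in> F" using u fp(1) F(1) by (simp add: subspace_diff)
    moreover have eq: "u - f = p - (x - u)" using fp(3) by simp
    have "p - (x - u) \<in> P" by (rule subspace_diff[OF F(2) fp(2)]) (use u in simp)
    then have "u - f \<in> P" by (simp only: eq)
    ultimately have "u - f \<in> F \<inter> P" by (rule IntI)
    then have "u - f \<in> {0}" by (simp only: F(3))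
    then show "u = f" by simp
  qed
  moreover have "f = 0 \<longleftrightarrow> x \<in> P"
  proof
    assume "x \<in> P"
    then have "x - p \<in> P" by (rule subspace_diff[OF F(2) _ fp(2)])
    then have "f \<in> P" using fp(3) by simp
    with fp(1) have "f \<in> F \<inter> P" by (rule IntI)
    then have "f \<in> {0}" by (simp only: F(3))
    then show "f = 0" by simp
  qed (use fp in simp)
  ultimately show ?thesis by simp
qed

lemma at_half_neq_bot: "z \<in> half e \<Longrightarrow> at z within half e \<noteq> bot"
  using islimpt_atLeast[of z 0] islimpt_atMost[of z 0]
  by (cases e) (simp_all add: half_Pl half_Mi trivial_limit_within)

lemma deriv_in_half:
  "\<lbrakk>z \<in> half e; (f has_vector_derivative d) (at z within half e)\<rbrakk> \<Longrightarrow> deriv_in (half e) f z = d"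
  by (rule vector_derivative_within[OF at_half_neq_bot])

lemma has_deriv_in_half:
  "\<lbrakk>f differentiable_on half e; z \<in> half e\<rbrakk> \<Longrightarrow> (f has_vector_derivative deriv_in (half e) f z) (at z within half e)"
  unfolding differentiable_on_def by (simp flip: vector_derivative_works)

lemma half_0 [simp]: "0 \<in> half e" by (simp add: half_def)

lemma to_outgoing:
  assumes "(f has_vector_derivative d) (at (sg e * (t - b)) within half e)"
  shows "((\<lambda>t. f (sg e * (t - b))) has_vector_derivative sg e *\<^sub>R d) (at t within {b..})"
proof -
  have "((\<lambda>t. sg e * (t - b)) has_vector_derivative sg e) (at t within {b..})"
    by (rule derivative_eq_intros refl | simp)+
  moreover have "(f has_vector_derivative d) (at (sg e * (t - b)) within (\<lambda>t. sg e * (t - b)) ` {b..})"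
    by (rule has_vector_derivative_within_subset[OF assms]) (auto simp: half_def)
  ultimately show ?thesis
    using vector_diff_chain_within[of "\<lambda>t. sg e * (t - b)" "sg e" t "{b..}" f d] by (simp add: o_def)
qed

lemma from_outgoing:
  assumes "(g has_vector_derivative d) (at (sg e * z + b) within {b..})"
  shows "((\<lambda>z. g (sg e * z + b)) has_vector_derivative sg e *\<^sub>R d) (at z within half e)"
proof -
  have "((\<lambda>z. sg e * z + b) has_vector_derivative sg e) (at z within half e)"
    by (rule derivative_eq_intros refl | simp)+
  moreover have "(g has_vector_derivative d) (at (sg e * z + b) within (\<lambda>z. sg e * z + b) ` half e)"
    by (rule has_vector_derivative_within_subset[OF assms]) (auto simp: half_def)
  ultimately show ?thesis
    using vector_diff_chain_within[of "\<lambda>z. sg e * z + b" "sg e" z "half e" g d] by (simp add: o_def)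
qed

lemma filterlim_outgoing: "filterlim (\<lambda>z. sg e * z + b) at_top (far e)"
proof -
  have "filterlim (\<lambda>z. sg e * z) at_top (far e)"
    by (cases e) (simp_all add: filterlim_ident filterlim_uminus_at_top_at_bot)
  from filterlim_tendsto_add_at_top[OF tendsto_const[of b] this] show ?thesis
    by (simp add: add.commute)
qed

lemma filterlim_ingoing: "filterlim (\<lambda>t. sg e * (t - b)) (far e) at_top"
proof -
  have "filterlim (\<lambda>t. t - b) at_top at_top"
    using filterlim_tendsto_add_at_top[OF tendsto_const[of "-b"] filterlim_ident] by (simp add: algebra_simps)
  from filterlim_compose[OF filterlim_far this] show ?thesis .
qed

text \<open>The parameters on which the profile of one side depends.\<close>

definition side_params :: "side \<Rightarrow> ('n::finite, 'd::finite) state \<times> (real^'n) \<times> (real^'n) \<Rightarrow> ('n, 'd) side_state \<times> (real^'n)" where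
  "side_params e y = (restrict_side e (fst y), at_side e (snd y))"

lemma restrict_side_alt: "restrict_side e q = (at_side e (fst q, fst (snd q)), snd (snd q))"
  by (cases q) simp

lemma snd_restrict_side [simp]: "snd (restrict_side e q) = snd (snd q)"
  by (simp add: restrict_side_alt)

lemma bounded_linear_side_params: "bounded_linear (side_params e)"
proof (cases e)
  case Pl
  have "bounded_linear (\<lambda>y :: ('a, 'b) state \<times> (real^'a) \<times> (real^'a). ((fst (fst y), snd (snd (fst y))), fst (snd y)))"
    by (intro bounded_linear_Pair bounded_linear_fst bounded_linear_fst_comp bounded_linear_snd_comp bounded_linear_snd
        bounded_linear_compose[OF bounded_linear_fst] bounded_linear_compose[OF bounded_linear_snd])
  then show ?thesis unfolding side_params_def[abs_def] restrict_side_alt Pl by simp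
next
  case Mi
  have "bounded_linear (\<lambda>y :: ('a, 'b) state \<times> (real^'a) \<times> (real^'a). ((fst (snd (fst y)), snd (snd (fst y))), snd (snd y)))"
    by (intro bounded_linear_Pair bounded_linear_fst bounded_linear_fst_comp bounded_linear_snd_comp bounded_linear_snd
        bounded_linear_compose[OF bounded_linear_fst] bounded_linear_compose[OF bounded_linear_snd])
  then show ?thesis unfolding side_params_def[abs_def] restrict_side_alt Mi by simp
qed

context small_side begin

lemma variation_decay:
  assumes S: "admissible_nbhd e S" and p: "(x, a) \<in> S" "a \<in> amplitudes e"
    and da: "da \<in> amplitudes e"
    and Dw: "\<And>t. zb \<le> t \<Longrightarrow> ((\<lambda>p. prof e (fst p) (snd p) t) has_derivative Dw t) (at (x, a) within params e)"
    and Dy: "\<And>t. zb \<le> t \<Longrightarrow> ((\<lambda>p. prof' e (fst p) (snd p) t) has_derivative Dy t) (at (x, a) within params e)"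
  shows "((\<lambda>t. Dw t (dx, da)) \<longlongrightarrow> fst dx) at_top"
proof (rule variation_limit[OF S p da])
  have line: "((\<lambda>\<theta>::real. (x, a) + \<theta> *\<^sub>R (dx, da)) has_vector_derivative (dx, da)) (at 0)"
    by (rule derivative_eq_intros refl | simp)+
  have range: "range (\<lambda>\<theta>::real. (x, a) + \<theta> *\<^sub>R (dx, da)) \<subseteq> params e"
    using p(2) da by (auto intro!: subspace_add[OF subspace_decay_space] subspace_scale[OF subspace_decay_space])
  show "((\<lambda>\<theta>. prof e (x + \<theta> *\<^sub>R dx) (a + \<theta> *\<^sub>R da) t) has_vector_derivative Dw t (dx, da)) (at 0)" if "0 \<le> t" for t
    using has_vector_derivative_along[OF Dw line _ range, of t] that zb by simp
  show "((\<lambda>\<theta>. prof' e (x + \<theta> *\<^sub>R dx) (a + \<theta> *\<^sub>R da) 0) has_vector_derivative Dy 0 (dx, da)) (at 0)"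
    using has_vector_derivative_along[OF Dy line _ range, of 0] zb by simp
qed

end

context viscous_shock begin

text \<open>The threshold depends only on the data of the problem, as the form and the Lipschitz constant do;
  neither of them sees \<open>R\<close>, \<open>r\<close>, \<open>om\<close> or \<open>Phi\<close>.\<close>

lemma small_side_threshold:
  "\<exists>\<epsilon>>0. \<forall>R r om Phi zb ab. half_line_solutions A dd Us U pb wb k Om alpha R r om Phi zb ab \<longrightarrow>
     R \<le> \<epsilon> \<longrightarrow> om e \<subseteq> ball (pb e, 0) \<epsilon> \<longrightarrow>
     (\<exists>B K c L \<epsilon>'. small_side A dd Us U pb wb k Om alpha R r om Phi zb ab B K c e L \<epsilon>')"
proof -
  obtain B :: "real^'n \<Rightarrow> real^'n \<Rightarrow> real" and K c L \<epsilon> where *: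
    "symmetric_form B K c" "0 \<le> L" "\<epsilon> > 0"
    "\<And>Y. \<lbrakk>subspace Y; \<And>v. \<lbrakk>v \<in> Y; v \<noteq> 0\<rbrakk> \<Longrightarrow> B v v < 0\<rbrakk> \<Longrightarrow> dim Y \<le> dim (decay_space A dd e (pb e, 0))"
    "\<And>u. norm (u - pb e) \<le> 2 * \<epsilon> \<Longrightarrow> u \<in> Us"
    "\<And>u \<sigma> v. \<lbrakk>norm (u - pb e) \<le> 2 * \<epsilon>; norm \<sigma> \<le> \<epsilon>\<rbrakk> \<Longrightarrow> c * (norm v)\<^sup>2 \<le> B v (sg e *\<^sub>R (Gd A dd (u, \<sigma>) *v v))"
    "\<And>u \<sigma> u' \<sigma>' v. \<lbrakk>norm (u - pb e) \<le> 2 * \<epsilon>; norm \<sigma> \<le> \<epsilon>; norm (u' - pb e) \<le> 2 * \<epsilon>; norm \<sigma>' \<le> \<epsilon>\<rbrakk> \<Longrightarrow>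
        norm (Gd A dd (u, \<sigma>) *v v - Gd A dd (u', \<sigma>') *v v) \<le> L * (norm (u - u') + norm (\<sigma> - \<sigma>')) * norm v"
  proof (rule uniform_lyapunov_form[of e])
    fix B :: "real^'n \<Rightarrow> real^'n \<Rightarrow> real" and K c L \<epsilon>
    assume "symmetric_form B K c" "0 \<le> L" "\<epsilon> > 0"
      "\<And>Y. \<lbrakk>subspace Y; \<And>v. \<lbrakk>v \<in> Y; v \<noteq> 0\<rbrakk> \<Longrightarrow> B v v < 0\<rbrakk> \<Longrightarrow> dim Y \<le> dim (decay_space A dd e (pb e, 0))"
      "\<And>u. norm (u - pb e) \<le> 2 * \<epsilon> \<Longrightarrow> u \<in> Us"
      "\<And>u \<sigma> v. \<lbrakk>norm (u - pb e) \<le> 2 * \<epsilon>; norm \<sigma> \<le> \<epsilon>\<rbrakk> \<Longrightarrow> c * (norm v)\<^sup>2 \<le> B v (sg e *\<^sub>R (Gd A dd (u, \<sigma>) *v v))"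
      "\<And>u \<sigma> u' \<sigma>' v. \<lbrakk>norm (u - pb e) \<le> 2 * \<epsilon>; norm \<sigma> \<le> \<epsilon>; norm (u' - pb e) \<le> 2 * \<epsilon>; norm \<sigma>' \<le> \<epsilon>\<rbrakk> \<Longrightarrow>
          norm (Gd A dd (u, \<sigma>) *v v - Gd A dd (u', \<sigma>') *v v) \<le> L * (norm (u - u') + norm (\<sigma> - \<sigma>')) * norm v"
    then show thesis by (rule that)
  qed
  interpret form: symmetric_form B K c by (rule *(1))
  define M where "M = 32 * K ^ 3 * L\<^sup>2 * form.tail_const\<^sup>2"
  have M: "0 \<le> M" unfolding M_def using form.Kpos by simp
  (* For R <= 1 the smallness condition, quadratic in R, follows from a linear one. *)
  define \<epsilon>0 where "\<epsilon>0 = min \<epsilon> (min 1 (c ^ 3 / (M + 1)))"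
  have c3: "c ^ 3 / (M + 1) > 0" using form.cpos M by simp
  have \<epsilon>0: "\<epsilon>0 > 0" "\<epsilon>0 \<le> \<epsilon>" "\<epsilon>0 \<le> 1" "\<epsilon>0 \<le> c ^ 3 / (M + 1)"
    unfolding \<epsilon>0_def using *(3) c3 by (auto simp: min_le_iff_disj)
  have thr: "\<exists>B K c L \<epsilon>'. small_side A dd Us U pb wb k Om alpha R r om Phi zb ab B K c e L \<epsilon>'"
    if hls: "half_line_solutions A dd Us U pb wb k Om alpha R r om Phi zb ab" and R: "R \<le> \<epsilon>0"
      and om: "om e \<subseteq> ball (pb e, 0) \<epsilon>0" for R r om Phi zb ab
  proof -
    interpret h: half_line_solutions A dd Us U pb wb k Om alpha R r om Phi zb ab by (rule hls)
    have R0: "0 < R" using h.R_r by simp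
    have "R\<^sup>2 \<le> R" using R R0 \<epsilon>0(3) by (simp add: power2_eq_square mult_left_le)
    then have "M * R\<^sup>2 \<le> (M + 1) * R"
      using M R0 by (intro mult_mono) auto
    also have "\<dots> \<le> (M + 1) * (c ^ 3 / (M + 1))"
      using R \<epsilon>0(4) M by (intro mult_left_mono) auto
    also have "\<dots> = c ^ 3" using M by simp
    finally have small: "32 * K ^ 3 * L\<^sup>2 * form.tail_const\<^sup>2 * R\<^sup>2 \<le> c ^ 3"
      unfolding M_def .
    have "small_side A dd Us U pb wb k Om alpha R r om Phi zb ab B K c e L \<epsilon>"
    proof (intro small_side.intro hls *(1) small_side_axioms.intro)
      show "R \<le> \<epsilon>" using R \<epsilon>0(2) by simp
      show "om e \<subseteq> ball (pb e, 0) \<epsilon>" using om \<epsilon>0(2) by (meson order_trans subset_ball)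
      show "dim Y \<le> dim (decay_space A dd e (pb e, 0))"
        if "subspace Y" "\<And>v. \<lbrakk>v \<in> Y; v \<noteq> 0\<rbrakk> \<Longrightarrow> B v v < 0" for Y
        by (rule *(4)[OF that])
    qed (rule *(2,3,5-7) small; assumption)+
    then show ?thesis by (intro exI)
  qed
  show ?thesis
    by (rule exI[of _ \<epsilon>0], intro conjI \<epsilon>0(1) allI impI) (rule thr)
qed

end

context profile_manifold begin

definition point_of :: "('n, 'd) state \<Rightarrow> side \<Rightarrow> ('n, 'd) side_state" where "point_of q e = restrict_side e q"
definition amplitude_of :: "('n, 'd) state \<Rightarrow> side \<Rightarrow> real^'n" where "amplitude_of q e = at_side e (af q)"

lemma snd_point_of [simp]: "snd (point_of q e) = snd (snd q)" by (simp add: point_of_def)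

lemma subspace_amp: "subspace amp_space"
  unfolding amp_space_def by (intro subspace_Times subspace_decay_space)

lemma at_side_amp: "a \<in> amp_space \<Longrightarrow> at_side e a \<in> amplitudes e"
  unfolding amp_space_def by (cases e) auto

lemma graph_nbhd:
  obtains V where "open V" "V \<inter> (UNIV \<times> amp_space) \<subseteq> Psi_dom"
    "\<And>q. q \<in> C \<Longrightarrow> (q, af q) \<in> V \<inter> (UNIV \<times> amp_space) \<and> Psi (q, af q) = 0"
proof -
  obtain V where V: "open V" "V \<inter> (UNIV \<times> amp_space) \<subseteq> Psi_dom"
      "{y \<in> V \<inter> (UNIV \<times> amp_space). Psi y = 0} = (\<lambda>q. (q, af q)) ` C"
    using zero_set by (elim exE conjE)
  have "(q, af q) \<in> V \<inter> (UNIV \<times> amp_space) \<and> Psi (q, af q) = 0" if "q \<in> C" for q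
  proof -
    have "(q, af q) \<in> (\<lambda>q. (q, af q)) ` C" using that by (rule imageI)
    then show ?thesis unfolding V(3)[symmetric] by simp
  qed
  with V(1,2) show ?thesis by (rule that)
qed

lemma Psi_dom_admissible:
  assumes "(q, a) \<in> Psi_dom" shows "admissible e (restrict_side e q) (at_side e a)"
proof -
  have "a \<in> amp_space" using assms by (simp add: Psi_dom_def)
  from at_side_amp[OF this] show ?thesis
    using assms unfolding Psi_dom_def admissible_def by simp
qed

text \<open>Membership in \<open>Psi_dom\<close> is a condition on both sides; fixing the parameters of the other side leaves
  an open condition on this one.\<close>

lemma admissible_nbhd_exists:
  assumes q: "q \<in> C"
  obtains S where "admissible_nbhd e S" "(point_of q e, amplitude_of q e) \<in> S"
proof -
  obtain V where V: "open V" "V \<inter> (UNIV \<times> amp_space) \<subseteq> Psi_dom"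
    "\<And>q. q \<in> C \<Longrightarrow> (q, af q) \<in> V \<inter> (UNIV \<times> amp_space) \<and> Psi (q, af q) = 0"
    by (rule graph_nbhd) (rule that)
  obtain pp pm \<sigma> where q': "q = (pp, pm, \<sigma>)" by (cases q)
  obtain ap am where a': "af q = (ap, am)" by (cases "af q")
  have amp: "(ap, am) \<in> amp_space" using V(3)[OF q] a' by simp
  define ins where "ins p = (case e of Pl \<Rightarrow> ((fst (fst p), pm, snd (fst p)), (snd p, am))
      | Mi \<Rightarrow> ((pp, fst (fst p), snd (fst p)), (ap, snd p)))" for p :: "('n, 'd) side_state \<times> (real^'n)"
  have "continuous_on UNIV ins"
    unfolding ins_def by (cases e) (auto intro!: continuous_intros)
  then have op: "open (ins -` V)" using V(1) by (simp add: open_vimage)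
  have "admissible e x a" if "(x, a) \<in> ins -` V" "a \<in> amplitudes e" for x a
  proof -
    have "ins (x, a) \<in> V \<inter> (UNIV \<times> amp_space)"
      using that amp by (cases e) (auto simp: ins_def amp_space_def)
    then have "(fst (ins (x, a)), snd (ins (x, a))) \<in> Psi_dom" using V(2) by auto
    from Psi_dom_admissible[OF this, of e] show ?thesis
      by (cases e) (simp_all add: ins_def restrict_side_alt)
  qed
  then have "admissible_nbhd e (ins -` V)" using op unfolding admissible_nbhd_def by blast
  moreover have "ins (point_of q e, amplitude_of q e) = (q, af q)"
    using a' by (cases e) (simp_all add: ins_def point_of_def amplitude_of_def q')
  then have "(point_of q e, amplitude_of q e) \<in> ins -` V" using V(3)[OF q] by simp
  ultimately show ?thesis by (rule that)
qed

lemma amplitude_of_decay: "q \<in> C \<Longrightarrow> amplitude_of q e \<in> amplitudes e"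
proof -
  assume q: "q \<in> C"
  obtain V where "\<And>q. q \<in> C \<Longrightarrow> (q, af q) \<in> V \<inter> (UNIV \<times> amp_space) \<and> Psi (q, af q) = 0"
    by (rule graph_nbhd) (rule that)
  from this[OF q] have "af q \<in> amp_space" by simp
  then show ?thesis unfolding amplitude_of_def by (rule at_side_amp)
qed

lemma admissible_q: "q \<in> C \<Longrightarrow> admissible e (point_of q e) (amplitude_of q e)"
  using admissible_nbhd_exists[of q e] admissible_nbhdD amplitude_of_decay by metis

lemma W_prof: "W q e z = prof e (point_of q e) (amplitude_of q e) (sg e * z + zb)"
  by (simp add: W_def phi_def prof_def point_of_def amplitude_of_def distrib_left)

lemma W_deriv:
  assumes q: "q \<in> C" and z: "z \<in> half e"
  shows "deriv_in (half e) (W q e) z = sg e *\<^sub>R prof' e (point_of q e) (amplitude_of q e) (sg e * z + zb)" (is ?A)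
    and "deriv_in (half e) (deriv_in (half e) (W q e)) z
      = sg e *\<^sub>R (Gd A dd (W q e z, snd (snd q)) *v prof' e (point_of q e) (amplitude_of q e) (sg e * z + zb))" (is ?B)
proof -
  let ?p = "prof e (point_of q e) (amplitude_of q e)" and ?v = "prof' e (point_of q e) (amplitude_of q e)"
  note ode = prof_ode[OF admissible_q[OF q, of e]]
  have t: "zb \<le> sg e * z + zb" if "z \<in> half e" for z using that by (simp add: half_def)
  have D: "deriv_in (half e) (W q e) z = sg e *\<^sub>R ?v (sg e * z + zb)" if "z \<in> half e" for z
    by (rule deriv_in_half[OF that])
       (use from_outgoing[OF has_vector_derivative_at_within[OF ode(1)[OF t[OF that]]]] in \<open>simp add: W_prof[abs_def]\<close>)
  then show ?A using z .
  have "((\<lambda>z. ?v (sg e * z + zb)) has_vector_derivative sg e *\<^sub>R sg e *\<^sub>R (Gd A dd (?p (sg e * z + zb), snd (point_of q e)) *v ?v (sg e * z + zb))) (at z within half e)"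
    by (rule from_outgoing[OF has_vector_derivative_at_within[OF ode(2)[OF t[OF z]]]])
  then have "((\<lambda>z. sg e *\<^sub>R ?v (sg e * z + zb)) has_vector_derivative sg e *\<^sub>R (Gd A dd (W q e z, snd (snd q)) *v ?v (sg e * z + zb))) (at z within half e)"
    by (intro bounded_linear.has_vector_derivative[OF bounded_linear_scaleR_right]) (simp add: W_prof)
  then have "(deriv_in (half e) (W q e) has_vector_derivative sg e *\<^sub>R (Gd A dd (W q e z, snd (snd q)) *v ?v (sg e * z + zb))) (at z within half e)"
    by (rule has_vector_derivative_transform[OF z, rotated]) (simp add: D)
  then show ?B by (rule deriv_in_half[OF z])
qed

definition linearized_on :: "('n, 'd) state \<Rightarrow> side \<Rightarrow> real^'d \<Rightarrow> (real \<Rightarrow> real^'n) \<Rightarrow> bool" where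
  "linearized_on q e \<tau> w \<longleftrightarrow> twice_differentiable_on (half e) w \<and> (\<forall>z\<in>half e. L0 q e w z = L01 q e \<tau> z)"

text \<open>The transition to the outgoing variable \<open>t = sg e * z + zb\<close>; each derivative in \<open>z\<close> contributes a factor
  \<open>sg e\<close>, whose square is 1.\<close>

lemma L0_L01_iff:
  assumes q: "q \<in> C" and z: "z \<in> half e"
  shows "L0 q e w z = L01 q e \<tau> z \<longleftrightarrow>
    (1 + hsq dd (snd (snd q))) *\<^sub>R deriv_in (half e) (deriv_in (half e) w) z
      = mode_rhs e (point_of q e) (amplitude_of q e) (sg e * z + zb) \<tau> (w z) (sg e *\<^sub>R deriv_in (half e) w z)"
proof -
  have t: "zb \<le> sg e * z + zb" using z by (simp add: half_def)
  have WU: "W q e z \<in> Us" unfolding W_prof by (rule prof_ode(3)[OF admissible_q[OF q] t])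
  let ?\<sigma> = "snd (snd q)" and ?V = "prof' e (point_of q e) (amplitude_of q e) (sg e * z + zb)" and ?Dw = "deriv_in (half e) w z"
  define S where "S = (\<Sum>j\<in>UNIV - {dd}. (\<tau> $ j) *\<^sub>R (A j (W q e z) *v sg e *\<^sub>R ?V))"
  define H where "H = (2 * (\<Sum>j\<in>UNIV - {dd}. ?\<sigma> $ j * \<tau> $ j)) *\<^sub>R (sg e *\<^sub>R (Gd A dd (W q e z, ?\<sigma>) *v ?V))"
  have S': "sg e *\<^sub>R (\<Sum>j\<in>UNIV - {dd}. (\<tau> $ j) *\<^sub>R (A j (W q e z) *v ?V)) = S"
    unfolding S_def by (simp add: mv.scaleR_right scaleR_sum_right mult.commute)
  have rhs: "mode_rhs e (point_of q e) (amplitude_of q e) (sg e * z + zb) \<tau> (w z) (sg e *\<^sub>R ?Dw)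
      = D_Acal A dd (W q e z) ?\<sigma> (w z) *v sg e *\<^sub>R ?V + Acal A dd (W q e z) ?\<sigma> *v ?Dw - (\<tau> $ dd) *\<^sub>R (sg e *\<^sub>R ?V) - S - H"
    unfolding mode_rhs_def W_prof[symmetric] snd_point_of scaleR_diff_right S' H_def
    by (simp add: mv.scaleR_right scaleR_add_right mult.commute)
  have alg: "(- X + P + Q = T + S + H) = (X = Q + P - T - S - H)" for X P Q T :: "real^'n"
    by (auto simp: algebra_simps)
  show ?thesis
    unfolding rhs L0_def L01_def Let_def W_deriv[OF q z] frechet_derivative_Acal[OF WU] S_def[symmetric] H_def[symmetric]
    by (rule alg)
qed

end

section \<open>The kernel of the reduced operator\<close>

lemma smooth_on_slice_twice_differentiable:
  fixes F :: "real \<times> 'p::real_normed_vector \<Rightarrow> 'b::real_normed_vector"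
  assumes F: "smooth_on (J \<times> P) F" and J: "\<And>t. t \<in> J \<Longrightarrow> t islimpt J" and p: "p \<in> P"
  shows "twice_differentiable_on J (\<lambda>t. F (t, p))"
proof -
  define F' where "F' = (\<lambda>(t, p). deriv_in J (\<lambda>t. F (t, p)) t)"
  have d: "((\<lambda>t. F (t, p)) has_vector_derivative F' (t, p)) (at t within J)" if "t \<in> J" "p \<in> P" for t p
    using smooth_on_slice_differentiable[OF F that] by (simp add: F'_def)
  have F'_smooth: "smooth_on (J \<times> P) F'"
    by (rule smooth_on_partial_fst[OF F J d])
  have "(\<lambda>t. F (t, p)) differentiable_on J"
    unfolding differentiable_on_def by (intro ballI differentiableI_vector[OF d] p)
  moreover have "(\<lambda>t. F' (t, p)) differentiable_on J"
    unfolding differentiable_on_def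
    by (intro ballI differentiableI_vector[OF smooth_on_slice_differentiable[OF F'_smooth]] p)
  ultimately show ?thesis
    unfolding twice_differentiable_on_def F'_def by simp
qed

lemma at_side_zero: "at_side e (0, 0) = 0"
  by (cases e) auto

context half_line_solutions begin

text \<open>Bundled into one predicate, so that a pair of maps can be selected for each side.\<close>

definition is_variation ::
  "side \<Rightarrow> ('n, 'd) side_state \<Rightarrow> real^'n \<Rightarrow> (real \<Rightarrow> ('n, 'd) side_state \<times> (real^'n) \<Rightarrow> real^'n) \<Rightarrow>
   (real \<Rightarrow> ('n, 'd) side_state \<times> (real^'n) \<Rightarrow> real^'n) \<Rightarrow> bool" where
  "is_variation e x a Dw Dy \<longleftrightarrow>
     (\<forall>t\<ge>zb. ((\<lambda>p. prof e (fst p) (snd p) t) has_derivative Dw t) (at (x, a) within params e)) \<and>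
     (\<forall>t\<ge>zb. ((\<lambda>p. prof' e (fst p) (snd p) t) has_derivative Dy t) (at (x, a) within params e)) \<and>
     (\<forall>dx. \<forall>da\<in>amplitudes e.
        linear_mode e x a (snd dx) (\<lambda>t. Dw t (dx, da)) (\<lambda>t. Dy t (dx, da)) \<and>
        ((\<lambda>t. Dw t (dx, da)) \<longlongrightarrow> fst dx) at_top)"

end

context profile_manifold begin

lemma mode_imp_linearized:
  assumes q: "q \<in> C" and m: "linear_mode e (point_of q e) (amplitude_of q e) \<tau> v y"
  shows "linearized_on q e \<tau> (\<lambda>z. v (sg e * z + zb))"
    and "deriv_in (half e) (\<lambda>z. v (sg e * z + zb)) 0 = sg e *\<^sub>R y zb"
proof -
  let ?w = "\<lambda>z. v (sg e * z + zb)"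
  define y' where "y' t = (1 / (1 + hsq dd (snd (snd q)))) *\<^sub>R mode_rhs e (point_of q e) (amplitude_of q e) t \<tau> (v t) (y t)" for t
  have ode: "(v has_vector_derivative y t) (at t within {zb..})" "(y has_vector_derivative y' t) (at t within {zb..})"
    if "zb \<le> t" for t
    using m that unfolding linear_mode_def y'_def by simp_all
  have t: "zb \<le> sg e * z + zb" if "z \<in> half e" for z using that by (simp add: half_def)
  have w': "(?w has_vector_derivative sg e *\<^sub>R y (sg e * z + zb)) (at z within half e)" if "z \<in> half e" for z
    by (rule from_outgoing[OF ode(1)[OF t[OF that]]])
  have D: "deriv_in (half e) ?w z = sg e *\<^sub>R y (sg e * z + zb)" if "z \<in> half e" for z
    by (rule deriv_in_half[OF that w'[OF that]])
  show "deriv_in (half e) ?w 0 = sg e *\<^sub>R y zb" using D[OF half_0] by simp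
  have w'': "(deriv_in (half e) ?w has_vector_derivative y' (sg e * z + zb)) (at z within half e)" if z: "z \<in> half e" for z
  proof -
    have "((\<lambda>z. sg e *\<^sub>R y (sg e * z + zb)) has_vector_derivative sg e *\<^sub>R sg e *\<^sub>R y' (sg e * z + zb)) (at z within half e)"
      by (rule bounded_linear.has_vector_derivative[OF bounded_linear_scaleR_right from_outgoing[OF ode(2)[OF t[OF z]]]])
    then have "((\<lambda>z. sg e *\<^sub>R y (sg e * z + zb)) has_vector_derivative y' (sg e * z + zb)) (at z within half e)"
      by simp
    then show ?thesis
      by (rule has_vector_derivative_transform[OF z, rotated]) (rule D)
  qed
  have "twice_differentiable_on (half e) ?w"
    unfolding twice_differentiable_on_def differentiable_on_def
    by (intro conjI ballI differentiableI_vector[OF w'] differentiableI_vector[OF w''])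
  moreover have "L0 q e ?w z = L01 q e \<tau> z" if z: "z \<in> half e" for z
    unfolding L0_L01_iff[OF q z] deriv_in_half[OF z w''[OF z]] D[OF z] y'_def
    using hsq_pos[of dd "snd (snd q)"] by simp
  ultimately show "linearized_on q e \<tau> ?w" unfolding linearized_on_def by simp
qed

lemma linearized_imp_mode:
  assumes q: "q \<in> C" and l: "linearized_on q e \<tau> w"
  shows "linear_mode e (point_of q e) (amplitude_of q e) \<tau> (\<lambda>t. w (sg e * (t - zb))) (\<lambda>t. sg e *\<^sub>R deriv_in (half e) w (sg e * (t - zb)))"
  unfolding linear_mode_def
proof (intro allI impI conjI)
  fix t assume t: "zb \<le> t"
  let ?z = "sg e * (t - zb)" and ?n = "1 + hsq dd (snd (snd q))"
  have z: "?z \<in> half e" using t by (simp add: half_def)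
  have zt: "sg e * ?z + zb = t" by simp
  have diff: "w differentiable_on half e" "deriv_in (half e) w differentiable_on half e"
    using l unfolding linearized_on_def twice_differentiable_on_def by auto
  show "((\<lambda>t. w (sg e * (t - zb))) has_vector_derivative sg e *\<^sub>R deriv_in (half e) w ?z) (at t within {zb..})"
    by (rule to_outgoing[OF has_deriv_in_half[OF diff(1) z]])
  have "((\<lambda>t. sg e *\<^sub>R deriv_in (half e) w (sg e * (t - zb))) has_vector_derivative
      sg e *\<^sub>R sg e *\<^sub>R deriv_in (half e) (deriv_in (half e) w) ?z) (at t within {zb..})"
    by (rule bounded_linear.has_vector_derivative[OF bounded_linear_scaleR_right to_outgoing[OF has_deriv_in_half[OF diff(2) z]]])
  moreover have "?n *\<^sub>R deriv_in (half e) (deriv_in (half e) w) ?z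
      = mode_rhs e (point_of q e) (amplitude_of q e) t \<tau> (w ?z) (sg e *\<^sub>R deriv_in (half e) w ?z)"
    using L0_L01_iff[OF q z, of w \<tau>] l z unfolding linearized_on_def zt by blast
  then have "(1 / ?n) *\<^sub>R mode_rhs e (point_of q e) (amplitude_of q e) t \<tau> (w ?z) (sg e *\<^sub>R deriv_in (half e) w ?z)
      = (1 / ?n) *\<^sub>R ?n *\<^sub>R deriv_in (half e) (deriv_in (half e) w) ?z" by simp
  then have "(1 / ?n) *\<^sub>R mode_rhs e (point_of q e) (amplitude_of q e) t \<tau> (w ?z) (sg e *\<^sub>R deriv_in (half e) w ?z)
      = deriv_in (half e) (deriv_in (half e) w) ?z"
    using hsq_pos[of dd "snd (snd q)"] by simp
  ultimately show "((\<lambda>t. sg e *\<^sub>R deriv_in (half e) w (sg e * (t - zb))) has_vector_derivative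
      (1 / (1 + hsq dd (snd (point_of q e)))) *\<^sub>R mode_rhs e (point_of q e) (amplitude_of q e) t \<tau> (w ?z) (sg e *\<^sub>R deriv_in (half e) w ?z)) (at t within {zb..})"
    by simp
qed

lemma outgoing_inverse [simp]: "sg e * (sg e * z + b - b) = z" by simp

lemma linearized_on_add:
  assumes q: "q \<in> C" and l: "linearized_on q e \<tau> w" "linearized_on q e \<tau>' w'"
  shows "linearized_on q e (\<tau> + \<tau>') (\<lambda>z. w z + w' z)"
  using mode_imp_linearized(1)[OF q linear_mode_add[OF admissible_q[OF q] linearized_imp_mode[OF q l(1)] linearized_imp_mode[OF q l(2)]]]
  by (simp only: outgoing_inverse)

lemma linearized_on_diff:
  assumes q: "q \<in> C" and l: "linearized_on q e \<tau> w" "linearized_on q e \<tau>' w'"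
  shows "linearized_on q e (\<tau> - \<tau>') (\<lambda>z. w z - w' z)"
  using mode_imp_linearized(1)[OF q linear_mode_diff[OF admissible_q[OF q] linearized_imp_mode[OF q l(1)] linearized_imp_mode[OF q l(2)]]]
  by (simp only: outgoing_inverse)

lemma L01_zero: "L01 q e 0 z = 0"
  by (simp add: L01_def Let_def)

lemma homogeneous_sol_iff:
  "homogeneous_sol q dp v \<longleftrightarrow> (\<forall>e. linearized_on q e 0 (v e) \<and> (v e \<longlongrightarrow> at_side e dp) (far e))"
  unfolding homogeneous_sol_def linearized_on_def L01_zero by simp

lemma linearized_sol_iff:
  "linearized_sol q dp \<tau> w \<longleftrightarrow> (\<forall>e. linearized_on q e \<tau> (w e) \<and> (w e \<longlongrightarrow> at_side e dp) (far e))"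
  unfolding linearized_sol_def linearized_on_def by simp

lemma linearized_on_deriv_0:
  "linearized_on q e \<tau> w \<Longrightarrow> (w has_vector_derivative deriv_in (half e) w 0) (at 0 within half e)"
  unfolding linearized_on_def twice_differentiable_on_def by (intro has_deriv_in_half) auto

lemma jump_add: "jump (\<lambda>e z. f e z + g e z) = jump f + jump g"
  and jump_diff: "jump (\<lambda>e z. f e z - g e z) = jump f - jump g"
  by (simp_all add: jump_def)

lemma jump_z_add:
  assumes "\<And>e. linearized_on q e \<tau> (f e)" "\<And>e. linearized_on q e \<tau>' (g e)"
  shows "jump_z (\<lambda>e z. f e z + g e z) = jump_z f + jump_z g"
  unfolding jump_z_def
  using deriv_in_half[OF half_0 has_vector_derivative_add[OF linearized_on_deriv_0[OF assms(1)] linearized_on_deriv_0[OF assms(2)]]]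
  by simp

lemma jump_z_diff:
  assumes "\<And>e. linearized_on q e \<tau> (f e)" "\<And>e. linearized_on q e \<tau>' (g e)"
  shows "jump_z (\<lambda>e z. f e z - g e z) = jump_z f - jump_z g"
  unfolding jump_z_def
  using deriv_in_half[OF half_0 has_vector_derivative_diff[OF linearized_on_deriv_0[OF assms(1)] linearized_on_deriv_0[OF assms(2)]]]
  by simp

lemma corrector_facts:
  assumes R: "corrector \<R>" and q: "q \<in> C"
  shows "linearized_on q e \<tau> (\<lambda>z. \<R> e z q \<tau>)"
    and "((\<lambda>z. \<R> e z q \<tau>) \<longlongrightarrow> 0) (far e)"
    and "\<R> e 0 q \<tau> \<bullet> wb_z0 = - (\<tau> $ dd)"
    and "z \<in> half e \<Longrightarrow> \<R> e z q 0 = 0"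
proof -
  have sm: "smooth_on (half e \<times> C \<times> UNIV) (\<lambda>(z, q, \<tau>). \<R> e z q \<tau>)"
    and lin: "\<And>z. z \<in> half e \<Longrightarrow> linear (\<R> e z q)"
    and dec: "\<exists>K \<delta>. \<delta> > 0 \<and> (\<forall>z\<in>half e. \<forall>\<tau>. norm (\<R> e z q \<tau>) \<le> K * exp (- \<delta> * \<bar>z\<bar>) * norm \<tau>)"
    and eqs: "\<And>\<tau>. (\<forall>z\<in>half e. L0 q e (\<lambda>z. \<R> e z q \<tau>) z = L01 q e \<tau> z) \<and> wb_z0 \<bullet> \<R> e 0 q \<tau> = - (\<tau> $ dd)"
    using R q unfolding corrector_def by simp_all
  have lim: "z islimpt half e" if "z \<in> half e" for z
    using at_half_neq_bot[OF that] by (simp add: trivial_limit_within)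
  have "twice_differentiable_on (half e) (\<lambda>z. (\<lambda>(z, q, \<tau>). \<R> e z q \<tau>) (z, (q, \<tau>)))"
    by (rule smooth_on_slice_twice_differentiable[OF sm lim]) (use q in auto)
  then have "twice_differentiable_on (half e) (\<lambda>z. \<R> e z q \<tau>)" by (simp only: prod.case)
  then show "linearized_on q e \<tau> (\<lambda>z. \<R> e z q \<tau>)"
    unfolding linearized_on_def using eqs by simp
  show "\<R> e 0 q \<tau> \<bullet> wb_z0 = - (\<tau> $ dd)" using eqs by (simp add: inner_commute)
  show "\<R> e z q 0 = 0" if "z \<in> half e" using linear_0[OF lin[OF that]] .
  obtain K \<delta> where K: "\<delta> > 0" "\<And>z \<tau>. z \<in> half e \<Longrightarrow> norm (\<R> e z q \<tau>) \<le> K * exp (- \<delta> * \<bar>z\<bar>) * norm \<tau>"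
    using dec by auto
  have out: "filterlim (\<lambda>z. sg e * z) at_top (far e)" using filterlim_outgoing[of e 0] by simp
  have "((\<lambda>t. K * exp (- \<delta> * t) * norm \<tau>) \<longlongrightarrow> K * 0 * norm \<tau>) at_top"
  proof (intro tendsto_mult tendsto_const filterlim_compose[OF exp_at_bot])
    show "filterlim (\<lambda>t. - \<delta> * t) at_bot at_top"
      by (rule filterlim_tendsto_neg_mult_at_bot[OF tendsto_const _ filterlim_ident]) (use K(1) in simp)
  qed
  from filterlim_compose[OF this out]
  have lim0: "((\<lambda>z. K * exp (- \<delta> * (sg e * z)) * norm \<tau>) \<longlongrightarrow> 0) (far e)" by simp
  show "((\<lambda>z. \<R> e z q \<tau>) \<longlongrightarrow> 0) (far e)"
  proof (rule Lim_null_comparison[OF _ lim0])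
    have "eventually (\<lambda>z. 0 \<le> sg e * z) (far e)"
      using out by (simp add: filterlim_at_top)
    then show "eventually (\<lambda>z. norm (\<R> e z q \<tau>) \<le> K * exp (- \<delta> * (sg e * z)) * norm \<tau>) (far e)"
    proof eventually_elim
      case (elim z)
      have "\<bar>z\<bar> = \<bar>sg e * z\<bar>" by (simp add: abs_mult)
      then have "\<bar>z\<bar> = sg e * z" using elim by simp
      then show ?case using K(2)[of z \<tau>] elim by (simp add: half_def)
    qed
  qed
qed

text \<open>\<open>Gamma_red\<close> vanishes at \<open>(pp, pm, \<tau>)\<close> iff \<open>Gamma_b \<R> q v \<tau> = Gamma_b \<R> q v0 0\<close> for some decaying
  homogeneous solution \<open>v0\<close>, that is, iff \<open>w = v - v0 + \<R> \<tau>\<close> has no jumps; by the normalization of the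
  corrector the last component then becomes the condition
  \<open>\<tau> $ dd + w Pl 0 \<bullet> wb_z0 = 0\<close> of the linearized problem.  The choice
  of \<open>v\<close> in \<open>Gamma_red\<close> is meaningful only because homogeneous solutions with all limits exist.\<close>

lemma Gamma_red_kernel:
  assumes q: "q \<in> C" and R: "corrector \<R>" and F: "complementary F\<^sub>H (F_P \<R> q)"
    and ex: "\<And>dp. \<exists>v. homogeneous_sol q dp v"
  shows "{dq. Gamma_red \<R> F\<^sub>H q dq = 0} = linearized_profile_states q"
proof -
  note Rf = corrector_facts[OF R q]
  have R0: "jump (\<lambda>e z. \<R> e z q 0) = 0" "jump_z (\<lambda>e z. \<R> e z q 0) = 0"
  proof -
    show "jump (\<lambda>e z. \<R> e z q 0) = 0" using Rf(4) by (simp add: jump_def)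
    have "deriv_in (half e) (\<lambda>z. \<R> e z q 0) 0 = 0" for e
    proof (rule deriv_in_half[OF half_0])
      show "((\<lambda>z. \<R> e z q 0) has_vector_derivative 0) (at 0 within half e)"
        by (rule has_vector_derivative_transform[OF half_0 _ has_vector_derivative_const]) (rule Rf(4))
    qed
    then show "jump_z (\<lambda>e z. \<R> e z q 0) = 0" by (simp add: jump_z_def)
  qed
  have "Gamma_red \<R> F\<^sub>H q (pp, pm, \<tau>) = 0 \<longleftrightarrow> (pp, pm, \<tau>) \<in> linearized_profile_states q" for pp pm \<tau>
  proof -
    define v where "v = (SOME v. homogeneous_sol q (pp, pm) v)"
    have hv: "homogeneous_sol q (pp, pm) v" unfolding v_def by (rule someI_ex[OF ex])
    then have v: "\<And>e. linearized_on q e 0 (v e)" "\<And>e. (v e \<longlongrightarrow> at_side e (pp, pm)) (far e)"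
      unfolding homogeneous_sol_iff by auto
    have "Gamma_red \<R> F\<^sub>H q (pp, pm, \<tau>) = 0 \<longleftrightarrow> Gamma_b \<R> q v \<tau> \<in> F_P \<R> q"
      unfolding Gamma_red_def v_def[symmetric] prod.case by (rule proj_along_eq_0_iff[OF F])
    also have "\<dots> \<longleftrightarrow> (pp, pm, \<tau>) \<in> linearized_profile_states q"
    proof
      assume "Gamma_b \<R> q v \<tau> \<in> F_P \<R> q"
      then obtain v0 where h0: "homogeneous_sol q (0, 0) v0" and eq: "Gamma_b \<R> q v \<tau> = Gamma_b \<R> q v0 0"
        unfolding F_P_def by auto
      have v0: "\<And>e. linearized_on q e 0 (v0 e)" "\<And>e. (v0 e \<longlongrightarrow> 0) (far e)"
        using h0 unfolding homogeneous_sol_iff at_side_zero by auto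
      define w where "w e z = (v e z - v0 e z) + \<R> e z q \<tau>" for e z
      have d: "linearized_on q e 0 (\<lambda>z. v e z - v0 e z)" for e
        using linearized_on_diff[OF q v(1) v0(1), of e] by simp
      have "linearized_on q e \<tau> (w e)" for e
        using linearized_on_add[OF q d Rf(1), of e \<tau>] by (simp add: w_def[abs_def])
      moreover have "(w e \<longlongrightarrow> at_side e (pp, pm)) (far e)" for e
        using tendsto_add[OF tendsto_diff[OF v(2) v0(2)] Rf(2), of e] by (simp add: w_def[abs_def])
      ultimately have "linearized_sol q (pp, pm) \<tau> w" unfolding linearized_sol_iff by simp
      moreover have "jump w = jump v - jump v0 + jump (\<lambda>e z. \<R> e z q \<tau>)"
        unfolding w_def jump_add jump_diff ..
      then have "jump w = 0" using eq unfolding Gamma_b_def R0 by (auto simp: algebra_simps)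
      moreover have "jump_z w = jump_z v - jump_z v0 + jump_z (\<lambda>e z. \<R> e z q \<tau>)"
        unfolding w_def jump_z_add[OF d Rf(1)] jump_z_diff[OF v(1) v0(1)] ..
      then have "jump_z w = 0" using eq unfolding Gamma_b_def R0 by (auto simp: algebra_simps)
      moreover have "\<tau> $ dd + w Pl 0 \<bullet> wb_z0 = 0"
        using eq Rf(3)[of Pl \<tau>] unfolding Gamma_b_def w_def by (simp add: inner_simps)
      ultimately show "(pp, pm, \<tau>) \<in> linearized_profile_states q"
        unfolding linearized_profile_states_def by blast
    next
      assume "(pp, pm, \<tau>) \<in> linearized_profile_states q"
      then obtain w where ls: "linearized_sol q (pp, pm) \<tau> w" and j: "jump w = 0" "jump_z w = 0" "\<tau> $ dd + w Pl 0 \<bullet> wb_z0 = 0"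
        unfolding linearized_profile_states_def by auto
      have w: "\<And>e. linearized_on q e \<tau> (w e)" "\<And>e. (w e \<longlongrightarrow> at_side e (pp, pm)) (far e)"
        using ls unfolding linearized_sol_iff by auto
      define v0 where "v0 e z = v e z - (w e z - \<R> e z q \<tau>)" for e z
      have d: "linearized_on q e 0 (\<lambda>z. w e z - \<R> e z q \<tau>)" for e
        using linearized_on_diff[OF q w(1) Rf(1), of e \<tau>] by simp
      have "linearized_on q e 0 (v0 e)" for e
        using linearized_on_diff[OF q v(1) d, of e] by (simp add: v0_def[abs_def])
      moreover have "(v0 e \<longlongrightarrow> at_side e (0, 0)) (far e)" for e
        using tendsto_diff[OF v(2) tendsto_diff[OF w(2) Rf(2)], of e]
        by (cases e) (simp_all add: v0_def[abs_def])
      ultimately have "homogeneous_sol q (0, 0) v0" unfolding homogeneous_sol_iff by simp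
      then have "Gamma_b \<R> q v0 0 \<in> F_P \<R> q" unfolding F_P_def by blast
      moreover have "jump v0 = jump v + jump (\<lambda>e z. \<R> e z q \<tau>)"
        unfolding v0_def jump_diff j by simp
      moreover have "jump_z v0 = jump_z v + jump_z (\<lambda>e z. \<R> e z q \<tau>)"
        unfolding v0_def jump_z_diff[OF v(1) d] jump_z_diff[OF w(1) Rf(1)] j by simp
      moreover have "v0 Pl 0 \<bullet> wb_z0 = v Pl 0 \<bullet> wb_z0"
        using j(3) Rf(3)[of Pl \<tau>] unfolding v0_def by (simp add: inner_simps)
      ultimately show "Gamma_b \<R> q v \<tau> \<in> F_P \<R> q"
        unfolding Gamma_b_def R0 by simp
    qed
    finally show ?thesis .
  qed
  then show ?thesis by auto
qed

lemma dim_amp: "dim amp_space + k = CARD('n) + 1"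
proof -
  have "amplitudes Pl = spectral_space (A dd (pb Pl)) {..<0}"
    "amplitudes Mi = spectral_space (A dd (pb Mi)) {0<..}"
    unfolding decay_space_def Gd_zero decay_rates_def by (simp_all add: lessThan_def greaterThan_def)
  then show ?thesis
    using index unfolding amp_space_def dim_Times[OF subspace_decay_space subspace_decay_space] by simp
qed

lemma strongly_transversal_imp_transversal:
  assumes "strongly_transversal q" shows "transversal q"
proof -
  let ?D = "frechet_derivative Psi (at (q, af q) within UNIV \<times> amp_space)"
  have "dirs_ap \<subseteq> dirs_aps"
    unfolding dirs_ap_def dirs_aps_def by force
  then have "dim (?D ` dirs_ap) \<le> dim (?D ` dirs_aps)" by (intro dim_subset image_mono)
  moreover have "dim (?D ` dirs_aps) \<le> 2 * CARD('n) + 1"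
    using dim_subset_UNIV[of "?D ` dirs_aps"] by simp
  ultimately show ?thesis
    using assms unfolding strongly_transversal_def transversal_def strongly_transversal_at_def transversal_at_def rank_along_def
    by linarith
qed

end

section \<open>The tangent space at a transversal profile\<close>

locale regular_profile =
  profile_manifold A dd Us U pb wb k Om alpha R r om Phi zb ab C af
  for A :: "('n::finite, 'd::finite) coeffs" and dd Us U pb wb k Om alpha R r om Phi zb ab C af +
  fixes q :: "('n, 'd) state"
  assumes q: "q \<in> C" and transversal: "transversal q"
    and small: "\<And>e. \<exists>B K c L \<epsilon>. small_side A dd Us U pb wb k Om alpha R r om Phi zb ab B K c e L \<epsilon>"
begin

abbreviation base :: "('n, 'd) state \<times> (real^'n) \<times> (real^'n)" where "base \<equiv> (q, af q)"
abbreviation Q :: "(('n, 'd) state \<times> (real^'n) \<times> (real^'n)) set" where "Q \<equiv> UNIV \<times> amp_space"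

lemma side_params_base: "side_params e base = (point_of q e, amplitude_of q e)"
  by (simp add: side_params_def point_of_def amplitude_of_def)

lemma variation_exists: "\<exists>D. is_variation e (point_of q e) (amplitude_of q e) (fst D) (snd D)"
proof -
  obtain S where S: "admissible_nbhd e S" "(point_of q e, amplitude_of q e) \<in> S"
    using admissible_nbhd_exists[OF q, of e] by metis
  obtain B K c L \<epsilon> where "small_side A dd Us U pb wb k Om alpha R r om Phi zb ab B K c e L \<epsilon>"
    using small[of e] by (elim exE)
  then interpret s: small_side A dd Us U pb wb k Om alpha R r om Phi zb ab B K c e L \<epsilon> .
  show ?thesis
  proof (rule variation[OF S amplitude_of_decay[OF q]])
    fix Dw Dy
    assume D: "\<And>t. zb \<le> t \<Longrightarrow> ((\<lambda>p. prof e (fst p) (snd p) t) has_derivative Dw t) (at (point_of q e, amplitude_of q e) within params e)"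
      "\<And>t. zb \<le> t \<Longrightarrow> ((\<lambda>p. prof' e (fst p) (snd p) t) has_derivative Dy t) (at (point_of q e, amplitude_of q e) within params e)"
      "\<And>dx da. da \<in> amplitudes e \<Longrightarrow> linear_mode e (point_of q e) (amplitude_of q e) (snd dx) (\<lambda>t. Dw t (dx, da)) (\<lambda>t. Dy t (dx, da))"
    have lim: "((\<lambda>t. Dw t (dx, da)) \<longlongrightarrow> fst dx) at_top" if "da \<in> amplitudes e" for dx da
      by (rule s.variation_decay[OF S amplitude_of_decay[OF q] that D(1,2)])
    have "is_variation e (point_of q e) (amplitude_of q e) Dw Dy"
      unfolding is_variation_def
      by (intro conjI allI impI ballI D(1) D(2) D(3) lim)
    then show ?thesis by (intro exI[of _ "(Dw, Dy)"]) (simp only: fst_conv snd_conv)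
  qed
qed

text \<open>\<open>D\<^sub>w e t\<close> and \<open>D\<^sub>y e t\<close> are the derivatives of the profile and of its velocity at time \<open>t\<close> with respect to all
  parameters of side \<open>e\<close>.\<close>

definition D\<^sub>w :: "side \<Rightarrow> real \<Rightarrow> ('n, 'd) side_state \<times> (real^'n) \<Rightarrow> real^'n" where
  "D\<^sub>w e = fst (SOME D. is_variation e (point_of q e) (amplitude_of q e) (fst D) (snd D))"

definition D\<^sub>y :: "side \<Rightarrow> real \<Rightarrow> ('n, 'd) side_state \<times> (real^'n) \<Rightarrow> real^'n" where
  "D\<^sub>y e = snd (SOME D. is_variation e (point_of q e) (amplitude_of q e) (fst D) (snd D))"

lemma variation_facts:
  "zb \<le> t \<Longrightarrow> ((\<lambda>p. prof e (fst p) (snd p) t) has_derivative D\<^sub>w e t) (at (point_of q e, amplitude_of q e) within params e)"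
  "zb \<le> t \<Longrightarrow> ((\<lambda>p. prof' e (fst p) (snd p) t) has_derivative D\<^sub>y e t) (at (point_of q e, amplitude_of q e) within params e)"
  "da \<in> amplitudes e \<Longrightarrow> linear_mode e (point_of q e) (amplitude_of q e) (snd dx) (\<lambda>t. D\<^sub>w e t (dx, da)) (\<lambda>t. D\<^sub>y e t (dx, da))"
  "da \<in> amplitudes e \<Longrightarrow> ((\<lambda>t. D\<^sub>w e t (dx, da)) \<longlongrightarrow> fst dx) at_top"
proof -
  have "is_variation e (point_of q e) (amplitude_of q e) (D\<^sub>w e) (D\<^sub>y e)"
    unfolding D\<^sub>w_def D\<^sub>y_def by (rule someI_ex[OF variation_exists[of e]])
  note D = this[unfolded is_variation_def]
  show "zb \<le> t \<Longrightarrow> ((\<lambda>p. prof e (fst p) (snd p) t) has_derivative D\<^sub>w e t) (at (point_of q e, amplitude_of q e) within params e)"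
    using D[THEN conjunct1, rule_format] .
  show "zb \<le> t \<Longrightarrow> ((\<lambda>p. prof' e (fst p) (snd p) t) has_derivative D\<^sub>y e t) (at (point_of q e, amplitude_of q e) within params e)"
    using D[THEN conjunct2, THEN conjunct1, rule_format] .
  assume da: "da \<in> amplitudes e"
  show "linear_mode e (point_of q e) (amplitude_of q e) (snd dx) (\<lambda>t. D\<^sub>w e t (dx, da)) (\<lambda>t. D\<^sub>y e t (dx, da))"
    "((\<lambda>t. D\<^sub>w e t (dx, da)) \<longlongrightarrow> fst dx) at_top"
    using D[THEN conjunct2, THEN conjunct2, THEN spec, THEN bspec, OF da] by (rule conjunct1, rule conjunct2)
qed

lemma variation_linear: "zb \<le> t \<Longrightarrow> linear (D\<^sub>w e t)" "zb \<le> t \<Longrightarrow> linear (D\<^sub>y e t)"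
  using has_derivative_linear[OF variation_facts(1)] has_derivative_linear[OF variation_facts(2)] by auto

text \<open>In the second component both velocities are outgoing, which turns the difference of the derivatives in
  \<open>z\<close> into a sum.\<close>

definition DPsi :: "('n, 'd) state \<times> (real^'n) \<times> (real^'n) \<Rightarrow> (real^'n) \<times> (real^'n) \<times> real" where
  "DPsi y = (D\<^sub>w Pl zb (side_params Pl y) - D\<^sub>w Mi zb (side_params Mi y),
     D\<^sub>y Pl zb (side_params Pl y) + D\<^sub>y Mi zb (side_params Mi y),
     snd (snd (fst y)) $ dd + D\<^sub>w Pl zb (side_params Pl y) \<bullet> wb_z0)"

lemma Psi_prof:
  assumes "y \<in> Psi_dom"
  defines "p \<equiv> \<lambda>e. side_params e y"
  shows "Psi y = (prof Pl (fst (p Pl)) (snd (p Pl)) zb - prof Mi (fst (p Mi)) (snd (p Mi)) zb,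
     prof' Pl (fst (p Pl)) (snd (p Pl)) zb + prof' Mi (fst (p Mi)) (snd (p Mi)) zb,
     (snd (snd (fst y)) $ dd + prof Pl (fst (p Pl)) (snd (p Pl)) zb \<bullet> wb_z0) - wb 0 \<bullet> wb_z0)"
proof -
  obtain pp pm \<sigma> ap am where y: "y = ((pp, pm, \<sigma>), (ap, am))" by (cases y) auto
  have adm: "admissible e (restrict_side e (pp, pm, \<sigma>)) (at_side e (ap, am))" for e
    by (rule Psi_dom_admissible) (use assms(1) y in simp)
  have val: "phi e 0 x a = prof e x a zb" for e x a
    by (simp add: phi_def prof_def)
  have der: "vector_derivative (\<lambda>z. phi e z x a) (at 0) = sg e *\<^sub>R prof' e x a zb" if "admissible e x a" for e x a
  proof -
    have "((\<lambda>z. z + sg e * zb) has_vector_derivative 1) (at 0)"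
      by (rule derivative_eq_intros refl | simp)+
    from vector_diff_chain_at[OF this, of "\<lambda>z. Phi e z x a" "sg e *\<^sub>R prof' e x a zb"]
    have "((\<lambda>z. phi e z x a) has_vector_derivative sg e *\<^sub>R prof' e x a zb) (at 0)"
      using prof_ode(4)[OF that, of zb] by (simp add: phi_def o_def)
    then show ?thesis by (rule vector_derivative_at)
  qed
  show ?thesis
    using der[OF adm[of Pl]] der[OF adm[of Mi]]
    unfolding Psi_def y p_def side_params_def by (simp add: val)
qed

lemma base_mem: "base \<in> Q"
proof -
  obtain V where "\<And>q. q \<in> C \<Longrightarrow> (q, af q) \<in> V \<inter> Q \<and> Psi (q, af q) = 0"
    by (rule graph_nbhd) (rule that)
  from this[OF q] show ?thesis by simp
qed

lemma Psi_has_derivative: "(Psi has_derivative DPsi) (at base within Q)"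
proof -
  obtain V where V: "open V" "V \<inter> Q \<subseteq> Psi_dom" "\<And>q. q \<in> C \<Longrightarrow> (q, af q) \<in> V \<inter> Q \<and> Psi (q, af q) = 0"
    by (rule graph_nbhd) (rule that)
  have img: "side_params e ` Q \<subseteq> params e" for e
    by (auto simp: side_params_def intro: at_side_amp)
  have lin: "(side_params e has_derivative side_params e) (at base within Q)" for e
    by (rule bounded_linear_imp_has_derivative[OF bounded_linear_side_params])
  have w: "((\<lambda>y. prof e (fst (side_params e y)) (snd (side_params e y)) zb) has_derivative (\<lambda>y. D\<^sub>w e zb (side_params e y))) (at base within Q)" for e
    by (rule has_derivative_in_compose[OF lin])
       (use has_derivative_subset[OF variation_facts(1)[OF order_refl] img] in \<open>simp add: side_params_base\<close>)
  have v: "((\<lambda>y. prof' e (fst (side_params e y)) (snd (side_params e y)) zb) has_derivative (\<lambda>y. D\<^sub>y e zb (side_params e y))) (at base within Q)" for e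
    by (rule has_derivative_in_compose[OF lin])
       (use has_derivative_subset[OF variation_facts(2)[OF order_refl] img] in \<open>simp add: side_params_base\<close>)
  have bl: "bounded_linear (\<lambda>y :: ('n, 'd) state \<times> (real^'n) \<times> (real^'n). snd (snd (fst y)) $ dd)"
    by (intro bounded_linear_compose[OF bounded_linear_vec_nth] bounded_linear_snd_comp bounded_linear_fst)
  define F where "F y = (prof Pl (fst (side_params Pl y)) (snd (side_params Pl y)) zb - prof Mi (fst (side_params Mi y)) (snd (side_params Mi y)) zb,
     prof' Pl (fst (side_params Pl y)) (snd (side_params Pl y)) zb + prof' Mi (fst (side_params Mi y)) (snd (side_params Mi y)) zb,
     (snd (snd (fst y)) $ dd + prof Pl (fst (side_params Pl y)) (snd (side_params Pl y)) zb \<bullet> wb_z0) - wb 0 \<bullet> wb_z0)" for y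
  have "(F
     has_derivative (\<lambda>y. (D\<^sub>w Pl zb (side_params Pl y) - D\<^sub>w Mi zb (side_params Mi y),
     D\<^sub>y Pl zb (side_params Pl y) + D\<^sub>y Mi zb (side_params Mi y),
     (snd (snd (fst y)) $ dd + D\<^sub>w Pl zb (side_params Pl y) \<bullet> wb_z0) - 0))) (at base within Q)"
    unfolding F_def
    by (intro has_derivative_Pair has_derivative_diff has_derivative_add has_derivative_inner_left has_derivative_const
        bounded_linear_imp_has_derivative[OF bl] w v)
  then have "(F
     has_derivative DPsi) (at base within Q)"
    unfolding DPsi_def[abs_def] by simp
  then show ?thesis
  proof (rule has_derivative_transform_eventually)
    have dom: "y \<in> Psi_dom" if "y \<in> V" "y \<in> Q" for y using V(2) that by blast
    have "base \<in> V" using V(3)[OF q] by simp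
    then show "eventually (\<lambda>y. F y = Psi y) (at base within Q)"
      unfolding eventually_at_topological using V(1) Psi_prof[OF dom, folded F_def] by metis
    show "F base = Psi base"
      using Psi_prof[OF dom[OF \<open>base \<in> V\<close> base_mem], folded F_def] by simp
  qed (rule base_mem)
qed

lemma DPsi_linear: "linear DPsi"
  by (rule has_derivative_linear[OF Psi_has_derivative])

lemma subspace_Q: "subspace Q"
  by (intro subspace_Times subspace_UNIV subspace_amp)

lemma rank_along_DPsi:
  assumes "D \<subseteq> Q" shows "rank_along D base = dim (DPsi ` D)"
proof -
  have "Psi differentiable (at base within Q)"
    using Psi_has_derivative unfolding differentiable_def by blast
  then have "(Psi has_derivative frechet_derivative Psi (at base within Q)) (at base within Q)"
    by (simp only: frechet_derivative_works)
  then have "frechet_derivative Psi (at base within Q) y = DPsi y" if "y \<in> D" for y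
    using derivative_within_subspace_unique[OF subspace_Q base_mem _ _ Psi_has_derivative] that assms by blast
  then have "frechet_derivative Psi (at base within Q) ` D = DPsi ` D" by (rule image_cong[OF refl])
  then show ?thesis unfolding rank_along_def by simp
qed

text \<open>The rank of \<open>DPsi\<close> on the amplitudes is the dimension of the space of amplitudes.\<close>

lemma DPsi_injective_on_amplitudes:
  assumes a: "a \<in> amp_space" and 0: "DPsi (0, a) = 0"
  shows "a = 0"
proof -
  have dirs: "dirs_a = {0} \<times> amp_space" by (auto simp: dirs_a_def)
  have sub: "subspace ({0 :: ('n, 'd) state} \<times> amp_space)"
    by (intro subspace_Times subspace_amp subspace_single_0)
  have dimd: "dim ({0 :: ('n, 'd) state} \<times> amp_space) = dim amp_space"
    by (simp only: dim_Times[OF subspace_single_0 subspace_amp]) simp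
  have "rank_along dirs_a base + k = CARD('n) + 1"
    using transversal unfolding transversal_def transversal_at_def by simp
  moreover have "rank_along dirs_a base = dim (DPsi ` ({0} \<times> amp_space))"
    unfolding dirs by (rule rank_along_DPsi) auto
  ultimately have "dim (DPsi ` ({0} \<times> amp_space)) = dim amp_space"
    using dim_amp by linarith
  then have "dim {y \<in> {0} \<times> amp_space. DPsi y = 0} = 0"
    using dim_kernel_of_linear[OF DPsi_linear sub] dimd by linarith
  then have "{y \<in> {0} \<times> amp_space. DPsi y = 0} \<subseteq> {0}" by (simp only: dim_eq_0)
  moreover have "(0, a) \<in> {y \<in> {0} \<times> amp_space. DPsi y = 0}" using a 0 by simp
  ultimately have "(0 :: ('n, 'd) state, a) \<in> {0}" by (rule subsetD)
  then show ?thesis by (simp add: zero_prod_def)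
qed

lemma one_sided_injective:
  assumes da: "da \<in> amplitudes e" and 0: "D\<^sub>w e zb (0, da) = 0" "D\<^sub>y e zb (0, da) = 0"
  shows "da = 0"
proof -
  have z: "D\<^sub>w f zb (0, 0) = 0" "D\<^sub>y f zb (0, 0) = 0" for f
    using linear_0[OF variation_linear(1)[OF order_refl]] linear_0[OF variation_linear(2)[OF order_refl]]
    by (simp_all add: zero_prod_def)
  have 0: "(0 :: real^'n) \<in> decay_space A dd f x" for f x by (rule subspace_0[OF subspace_decay_space])
  show ?thesis
  proof (cases e)
    case Pl
    have "DPsi (0, (da, 0)) = 0"
      using assms(2,3) z unfolding DPsi_def side_params_def restrict_side_alt Pl by (simp add: zero_prod_def)
    then have "(da, 0 :: real^'n) = 0"
      using DPsi_injective_on_amplitudes[of "(da, 0)"] da 0 by (simp add: Pl amp_space_def)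
    then show ?thesis by (simp add: zero_prod_def)
  next
    case Mi
    have "DPsi (0, (0, da)) = 0"
      using assms(2,3) z unfolding DPsi_def side_params_def restrict_side_alt Mi by (simp add: zero_prod_def)
    then have "(0 :: real^'n, da) = 0"
      using DPsi_injective_on_amplitudes[of "(0, da)"] da 0 by (simp add: Mi amp_space_def)
    then show ?thesis by (simp add: zero_prod_def)
  qed
qed

definition kernel_states :: "('n, 'd) state set" where
  "kernel_states = {dq. \<exists>da\<in>amp_space. DPsi (dq, da) = 0}"

lemma kernel_states_fst: "kernel_states = fst ` {y \<in> Q. DPsi y = 0}"
  unfolding kernel_states_def by force

lemma subspace_kernel: "subspace {y \<in> Q. DPsi y = 0}"
  using subspace_inter[OF subspace_Q linear_subspace_kernel[OF DPsi_linear]] by (simp add: Int_def)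

text \<open>Rank and nullity of \<open>DPsi\<close>, which has full rank \<open>2 * N + 1\<close>.\<close>

lemma dim_kernel_states: "dim kernel_states \<le> CARD('n) + CARD('d) - k"
proof -
  have "rank_along dirs_aps base = 2 * CARD('n) + 1"
    using transversal unfolding transversal_def transversal_at_def by simp
  moreover have "dirs_aps \<subseteq> Q" unfolding dirs_aps_def by auto
  ultimately have "2 * CARD('n) + 1 = dim (DPsi ` dirs_aps)"
    using rank_along_DPsi by metis
  also have "\<dots> \<le> dim (DPsi ` Q)"
    by (rule dim_subset[OF image_mono[OF \<open>dirs_aps \<subseteq> Q\<close>]])
  finally have im: "2 * CARD('n) + 1 \<le> dim (DPsi ` Q)" .
  have "dim Q = (CARD('n) + (CARD('n) + CARD('d))) + dim amp_space"
    unfolding dim_Times[OF subspace_UNIV subspace_amp] by simp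
  then have "dim {y \<in> Q. DPsi y = 0} + dim (DPsi ` Q) = (CARD('n) + (CARD('n) + CARD('d))) + dim amp_space"
    using dim_kernel_of_linear[OF DPsi_linear subspace_Q] by simp
  moreover have "dim kernel_states \<le> dim {y \<in> Q. DPsi y = 0}"
    unfolding kernel_states_fst by (rule dim_image_le[OF linear_fst])
  ultimately show ?thesis using im dim_amp by linarith
qed

text \<open>Differentiate \<open>Psi (\<gamma> t, af (\<gamma> t)) = 0\<close>.\<close>

lemma tangent_subset_kernel: "tangent_space C q \<subseteq> kernel_states"
proof
  fix v assume "v \<in> tangent_space C q"
  then obtain c \<gamma> where c: "c > 0" and \<gamma>: "\<gamma> ` {-c<..<c} \<subseteq> C" "\<gamma> 0 = q" "(\<gamma> has_vector_derivative v) (at (0::real))"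
    unfolding tangent_space_def by auto
  let ?I = "{-c<..<c}"
  have 0: "0 \<in> ?I" "open ?I" using c by auto
  have at: "at 0 within ?I = at 0" by (rule at_within_open[OF 0])
  obtain Da where Da: "(af has_derivative Da) (at q within C)"
    using smooth_on_has_derivative[OF af_smooth q] by metis
  have af': "((\<lambda>t. af (\<gamma> t)) has_vector_derivative Da v) (at 0 within ?I)"
    by (rule has_vector_derivative_along[OF Da has_vector_derivative_at_within[OF \<gamma>(3)] \<gamma>(2,1)])
  obtain V where V: "\<And>q. q \<in> C \<Longrightarrow> (q, af q) \<in> V \<inter> Q \<and> Psi (q, af q) = 0"
    by (rule graph_nbhd) (rule that)
  have on: "(\<gamma> t, af (\<gamma> t)) \<in> Q" "Psi (\<gamma> t, af (\<gamma> t)) = 0" if "t \<in> ?I" for t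
  proof -
    have "\<gamma> t \<in> C" using \<gamma>(1) that by blast
    from V[OF this] show "(\<gamma> t, af (\<gamma> t)) \<in> Q" "Psi (\<gamma> t, af (\<gamma> t)) = 0" by simp_all
  qed
  have ev: "eventually (\<lambda>t. t \<in> ?I) (at (0::real))"
    by (rule eventually_at_in_open') (use 0 in auto)
  have "Da v \<in> amp_space"
  proof (rule derivative_in_subspace[OF _ subspace_amp])
    show "((\<lambda>t. af (\<gamma> t)) has_vector_derivative Da v) (at 0)" using af' at by simp
    show "eventually (\<lambda>t. af (\<gamma> t) \<in> amp_space) (at 0)"
      using ev by eventually_elim (use on(1) in auto)
    show "af (\<gamma> 0) \<in> amp_space" using on(1)[OF 0(1)] by simp
  qed
  moreover have "DPsi (v, Da v) = 0"
  proof -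
    have "((\<lambda>t. (\<gamma> t, af (\<gamma> t))) has_vector_derivative (v, Da v)) (at 0 within ?I)"
      by (intro has_vector_derivative_Pair has_vector_derivative_at_within[OF \<gamma>(3)] af')
    then have "((\<lambda>t. Psi (\<gamma> t, af (\<gamma> t))) has_vector_derivative DPsi (v, Da v)) (at 0 within ?I)"
    proof (rule has_vector_derivative_along[OF Psi_has_derivative])
      show "(\<lambda>t. (\<gamma> t, af (\<gamma> t))) ` ?I \<subseteq> Q" by (rule image_subsetI) (rule on(1))
    qed (simp only: \<gamma>(2))
    then have "((\<lambda>_. 0) has_vector_derivative DPsi (v, Da v)) (at 0 within ?I)"
      by (rule has_vector_derivative_transform[OF 0(1), rotated]) (simp add: on(2))
    then show ?thesis
      unfolding at using vector_derivative_unique_at has_vector_derivative_const by metis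
  qed
  ultimately show "v \<in> kernel_states" unfolding kernel_states_def by blast
qed

lemma tangent_space_eq: "tangent_space C q = kernel_states"
proof -
  obtain X where X: "subspace X" "dim X = CARD('n) + CARD('d) - k" "X \<subseteq> tangent_space C q"
    using submanifold_tangent_directions[OF C_manifold q] by metis
  have sub: "subspace kernel_states"
    unfolding kernel_states_fst by (rule linear_subspace_image[OF linear_fst subspace_kernel])
  have "X = kernel_states"
    by (rule subspace_dim_equal[OF X(1) sub order_trans[OF X(3) tangent_subset_kernel]])
       (simp only: X(2) dim_kernel_states)
  then show ?thesis using X(3) tangent_subset_kernel by blast
qed

text \<open>The variation in the direction \<open>y\<close>, as a function of the original variable \<open>z\<close>.\<close>

definition variation_mode :: "('n, 'd) state \<times> (real^'n) \<times> (real^'n) \<Rightarrow> side \<Rightarrow> real \<Rightarrow> real^'n" where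
  "variation_mode y e z = D\<^sub>w e (sg e * z + zb) (side_params e y)"

lemma side_params_split: "side_params e (dq, da) = (restrict_side e dq, at_side e da)"
  by (simp add: side_params_def)

lemma fst_restrict_side: "fst (restrict_side e (pp, pm, \<tau>)) = at_side e (pp, pm)"
  by simp

lemma variation_mode_facts:
  assumes da: "da \<in> amp_space"
  shows "linearized_on q e \<tau> (variation_mode ((pp, pm, \<tau>), da) e)"
    and "(variation_mode ((pp, pm, \<tau>), da) e \<longlongrightarrow> at_side e (pp, pm)) (far e)"
    and "deriv_in (half e) (variation_mode ((pp, pm, \<tau>), da) e) 0 = sg e *\<^sub>R D\<^sub>y e zb (side_params e ((pp, pm, \<tau>), da))"
    and "variation_mode ((pp, pm, \<tau>), da) e 0 = D\<^sub>w e zb (side_params e ((pp, pm, \<tau>), da))"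
proof -
  note m = variation_facts(3)[OF at_side_amp[OF da, of e], of "restrict_side e (pp, pm, \<tau>)", unfolded snd_restrict_side snd_conv]
  show "linearized_on q e \<tau> (variation_mode ((pp, pm, \<tau>), da) e)"
    "deriv_in (half e) (variation_mode ((pp, pm, \<tau>), da) e) 0 = sg e *\<^sub>R D\<^sub>y e zb (side_params e ((pp, pm, \<tau>), da))"
    using mode_imp_linearized[OF q m] unfolding variation_mode_def[abs_def] side_params_split by auto
  have "((\<lambda>t. D\<^sub>w e t (restrict_side e (pp, pm, \<tau>), at_side e da)) \<longlongrightarrow> fst (restrict_side e (pp, pm, \<tau>))) at_top"
    by (rule variation_facts(4)[OF at_side_amp[OF da]])
  from filterlim_compose[OF this[unfolded fst_restrict_side] filterlim_outgoing[of e zb]]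
  show "(variation_mode ((pp, pm, \<tau>), da) e \<longlongrightarrow> at_side e (pp, pm)) (far e)"
    unfolding variation_mode_def[abs_def] side_params_split .
  show "variation_mode ((pp, pm, \<tau>), da) e 0 = D\<^sub>w e zb (side_params e ((pp, pm, \<tau>), da))"
    by (simp add: variation_mode_def)
qed

lemma kernel_subset_linearized: "kernel_states \<subseteq> linearized_profile_states q"
proof
  fix dq assume "dq \<in> kernel_states"
  then obtain da where da: "da \<in> amp_space" "DPsi (dq, da) = 0" unfolding kernel_states_def by blast
  obtain pp pm \<tau> where dq: "dq = (pp, pm, \<tau>)" by (cases dq)
  let ?w = "variation_mode ((pp, pm, \<tau>), da)"
  note P = variation_mode_facts[OF da(1), where \<tau> = \<tau> and pp = pp and pm = pm]
  have "linearized_sol q (pp, pm) \<tau> ?w" unfolding linearized_sol_iff using P(1,2) by simp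
  moreover have "jump ?w = 0" "jump_z ?w = 0" "\<tau> $ dd + ?w Pl 0 \<bullet> wb_z0 = 0"
    using da(2) unfolding jump_def jump_z_def P(3,4) DPsi_def dq by (auto simp: zero_prod_def)
  ultimately show "dq \<in> linearized_profile_states q"
    unfolding linearized_profile_states_def dq by blast
qed

text \<open>On each side, subtract from \<open>w\<close> the variation in the direction \<open>(dq, 0)\<close>.  The difference is a decaying homogeneous mode,
  hence a variation in an amplitude direction.\<close>

lemma linearized_subset_kernel: "linearized_profile_states q \<subseteq> kernel_states"
proof
  fix dq assume dq': "dq \<in> linearized_profile_states q"
  obtain pp pm \<tau> where dq: "dq = (pp, pm, \<tau>)" by (cases dq)
  obtain w where ls: "linearized_sol q (pp, pm) \<tau> w" and j: "jump w = 0" "jump_z w = 0" "\<tau> $ dd + w Pl 0 \<bullet> wb_z0 = 0"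
    using dq' unfolding linearized_profile_states_def dq by auto
  have w: "\<And>e. linearized_on q e \<tau> (w e)" "\<And>e. (w e \<longlongrightarrow> at_side e (pp, pm)) (far e)"
    using ls unfolding linearized_sol_iff by auto
  have ex: "\<exists>a\<in>amplitudes e.
      w e 0 = D\<^sub>w e zb (restrict_side e dq, a) \<and> deriv_in (half e) (w e) 0 = sg e *\<^sub>R D\<^sub>y e zb (restrict_side e dq, a)" for e
  proof -
    obtain S where S: "admissible_nbhd e S" "(point_of q e, amplitude_of q e) \<in> S"
      using admissible_nbhd_exists[OF q, of e] by metis
    obtain B K c L \<epsilon> where "small_side A dd Us U pb wb k Om alpha R r om Phi zb ab B K c e L \<epsilon>"
      using small[of e] by (elim exE)
    then interpret s: small_side A dd Us U pb wb k Om alpha R r om Phi zb ab B K c e L \<epsilon> .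
    let ?E = "amplitudes e" and ?x = "restrict_side e dq"
    have 0: "0 \<in> ?E" by (rule subspace_0[OF subspace_decay_space])
    define v where "v t = w e (sg e * (t - zb)) - D\<^sub>w e t (?x, 0)" for t
    define y where "y t = sg e *\<^sub>R deriv_in (half e) (w e) (sg e * (t - zb)) - D\<^sub>y e t (?x, 0)" for t
    have "linear_mode e (point_of q e) (amplitude_of q e) (\<tau> - snd ?x) v y"
      unfolding v_def[abs_def] y_def[abs_def]
      by (rule linear_mode_diff[OF admissible_q[OF q] linearized_imp_mode[OF q w(1)] variation_facts(3)[OF 0]])
    then have m: "linear_mode e (point_of q e) (amplitude_of q e) 0 v y" by (simp add: dq)
    have "((\<lambda>t. w e (sg e * (t - zb)) - D\<^sub>w e t (?x, 0)) \<longlongrightarrow> at_side e (pp, pm) - fst ?x) at_top"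
      by (intro tendsto_diff filterlim_compose[OF w(2) filterlim_ingoing] variation_facts(4) 0)
    then have lim: "(v \<longlongrightarrow> 0) at_top" unfolding v_def[abs_def] dq fst_restrict_side by simp
    have lin0: "linear (D\<^sub>y e 0)" by (rule variation_linear(2)) (rule zb)
    show ?thesis
    proof (rule s.decaying_modes_are_variations[where Dw = "D\<^sub>w e" and Dy = "D\<^sub>y e", OF S amplitude_of_decay[OF q] lin0 _ _ _ m lim])
      show "linear_mode e (point_of q e) (amplitude_of q e) 0 (\<lambda>t. D\<^sub>w e t (0, da)) (\<lambda>t. D\<^sub>y e t (0, da))" if "da \<in> ?E" for da
        using variation_facts(3)[OF that, of 0] by simp
      show "((\<lambda>t. D\<^sub>w e t (0, da)) \<longlongrightarrow> 0) at_top" if "da \<in> ?E" for da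
        using variation_facts(4)[OF that, of 0] by simp
      show "da = 0" if "da \<in> ?E" "D\<^sub>w e zb (0, da) = 0" "D\<^sub>y e zb (0, da) = 0" for da
        by (rule one_sided_injective[OF that])
      fix da assume da: "da \<in> ?E" "\<And>t. zb \<le> t \<Longrightarrow> v t = D\<^sub>w e t (0, da) \<and> y t = D\<^sub>y e t (0, da)"
      have add: "D\<^sub>w e zb (?x, da) = D\<^sub>w e zb (?x, 0) + D\<^sub>w e zb (0, da)" "D\<^sub>y e zb (?x, da) = D\<^sub>y e zb (?x, 0) + D\<^sub>y e zb (0, da)"
        using linear_add[OF variation_linear(1)[OF order_refl, of e], of "(?x, 0)" "(0, da)"]
          linear_add[OF variation_linear(2)[OF order_refl, of e], of "(?x, 0)" "(0, da)"] by simp_all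
      have vz: "w e 0 - D\<^sub>w e zb (?x, 0) = D\<^sub>w e zb (0, da)" "sg e *\<^sub>R deriv_in (half e) (w e) 0 - D\<^sub>y e zb (?x, 0) = D\<^sub>y e zb (0, da)"
        using da(2)[of zb] by (simp_all add: v_def y_def)
      have "w e 0 = D\<^sub>w e zb (?x, da)" unfolding add vz(1)[symmetric] by simp
      moreover have "sg e *\<^sub>R D\<^sub>y e zb (?x, da) = deriv_in (half e) (w e) 0" unfolding add vz(2)[symmetric] by simp
      ultimately show ?thesis using da(1) by (intro bexI[of _ da]) auto
    qed
  qed
  obtain ap where ap: "ap \<in> amplitudes Pl" "w Pl 0 = D\<^sub>w Pl zb (restrict_side Pl dq, ap)"
      "deriv_in (half Pl) (w Pl) 0 = sg Pl *\<^sub>R D\<^sub>y Pl zb (restrict_side Pl dq, ap)"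
    using ex[of Pl] by blast
  obtain am where am: "am \<in> amplitudes Mi" "w Mi 0 = D\<^sub>w Mi zb (restrict_side Mi dq, am)"
      "deriv_in (half Mi) (w Mi) 0 = sg Mi *\<^sub>R D\<^sub>y Mi zb (restrict_side Mi dq, am)"
    using ex[of Mi] by blast
  have "(ap, am) \<in> amp_space" using ap(1) am(1) by (simp add: amp_space_def)
  moreover have "DPsi (dq, (ap, am)) = 0"
    using j ap(2,3) am(2,3) unfolding DPsi_def side_params_split jump_def jump_z_def
    by (auto simp: zero_prod_def dq)
  ultimately show "dq \<in> kernel_states" unfolding kernel_states_def by blast
qed

lemma tangent_space_linearized: "tangent_space C q = linearized_profile_states q"
  unfolding tangent_space_eq using kernel_subset_linearized linearized_subset_kernel by (rule equalityI)

lemma tangent_space_Gamma_red: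
  assumes "corrector \<R>" "complementary F\<^sub>H (F_P \<R> q)"
  shows "{dq. Gamma_red \<R> F\<^sub>H q dq = 0} = tangent_space C q"
  unfolding tangent_space_linearized
proof (rule Gamma_red_kernel[OF q assms])
  show "\<exists>v. homogeneous_sol q dp v" for dp
  proof -
    obtain pp pm where dp: "dp = (pp, pm)" by (cases dp)
    have 0: "(0, 0) \<in> amp_space"
      using subspace_0[OF subspace_amp] by (simp add: zero_prod_def)
    have "homogeneous_sol q dp (variation_mode ((pp, pm, 0), (0, 0)))"
      unfolding homogeneous_sol_iff dp using variation_mode_facts(1,2)[OF 0, where \<tau> = 0 and pp = pp and pm = pm] by simp
    then show ?thesis by blast
  qed
qed

end

theorem proposition3p12:
  fixes A :: "('n::finite, 'd::finite) coeffs"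
  assumes "viscous_shock A dd Us U pb wb k Om alpha"
  shows "\<exists>\<epsilon>>0. \<forall>R r om Phi zb ab C af.
    profile_manifold A dd Us U pb wb k Om alpha R r om Phi zb ab C af \<and>
    R \<le> \<epsilon> \<and> r \<le> \<epsilon> \<and> (\<forall>e. om e \<subseteq> ball (pb e, 0) \<epsilon>) \<longrightarrow>
    (\<forall>q\<in>C.
      (profile_manifold.strongly_transversal A dd pb wb k Phi zb af q \<longrightarrow>
         (\<forall>\<R> F\<^sub>H. profile_manifold.corrector A dd wb Phi zb C af \<R> \<and>
            complementary F\<^sub>H (profile_manifold.F_P A dd wb Phi zb af \<R> q) \<longrightarrow>
            {dq. profile_manifold.Gamma_red A dd wb Phi zb af \<R> F\<^sub>H q dq = 0} = tangent_space C q) \<and>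
         tangent_space C q = profile_manifold.linearized_profile_states A dd wb Phi zb af q) \<and>
      (profile_manifold.transversal A dd pb wb k Phi zb af q \<longrightarrow>
         (\<forall>\<R> F\<^sub>H. profile_manifold.corrector A dd wb Phi zb C af \<R> \<and>
            complementary F\<^sub>H (profile_manifold.F_P A dd wb Phi zb af \<R> q) \<longrightarrow>
            {dq. profile_manifold.Gamma_red A dd wb Phi zb af \<R> F\<^sub>H q dq = 0} = tangent_space C q) \<and>
         tangent_space C q = profile_manifold.linearized_profile_states A dd wb Phi zb af q))"
proof -
  interpret viscous_shock A dd Us U pb wb k Om alpha by (rule assms)
  define good where "good e \<epsilon> \<longleftrightarrow> (\<forall>R r om Phi zb ab. half_line_solutions A dd Us U pb wb k Om alpha R r om Phi zb ab \<longrightarrow>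
     R \<le> \<epsilon> \<longrightarrow> om e \<subseteq> ball (pb e, 0) \<epsilon> \<longrightarrow>
     (\<exists>B K c L \<epsilon>'. small_side A dd Us U pb wb k Om alpha R r om Phi zb ab B K c e L \<epsilon>'))" for e \<epsilon>
  obtain \<epsilon>1 where \<epsilon>1: "\<epsilon>1 > 0" "good Pl \<epsilon>1"
    using small_side_threshold[of Pl] unfolding good_def by (elim exE conjE)
  obtain \<epsilon>2 where \<epsilon>2: "\<epsilon>2 > 0" "good Mi \<epsilon>2"
    using small_side_threshold[of Mi] unfolding good_def by (elim exE conjE)
  have transversal_case: "(\<forall>\<R> F\<^sub>H. profile_manifold.corrector A dd wb Phi zb C af \<R> \<and>
            complementary F\<^sub>H (profile_manifold.F_P A dd wb Phi zb af \<R> q) \<longrightarrow>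
            {dq. profile_manifold.Gamma_red A dd wb Phi zb af \<R> F\<^sub>H q dq = 0} = tangent_space C q) \<and>
         tangent_space C q = profile_manifold.linearized_profile_states A dd wb Phi zb af q"
    and strong_case: "profile_manifold.strongly_transversal A dd pb wb k Phi zb af q \<Longrightarrow>
      profile_manifold.transversal A dd pb wb k Phi zb af q" (is "?S \<Longrightarrow> ?T")
    if pm: "profile_manifold A dd Us U pb wb k Om alpha R r om Phi zb ab C af"
      and R: "R \<le> min \<epsilon>1 \<epsilon>2" and om_small: "\<forall>e. om e \<subseteq> ball (pb e, 0) (min \<epsilon>1 \<epsilon>2)" and q: "q \<in> C"
      and tr: "profile_manifold.transversal A dd pb wb k Phi zb af q \<or> profile_manifold.strongly_transversal A dd pb wb k Phi zb af q"
    for R r om Phi zb ab C af q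
  proof -
    interpret profile_manifold A dd Us U pb wb k Om alpha R r om Phi zb ab C af by (rule pm)
    show imp: "?S \<Longrightarrow> ?T" by (rule strongly_transversal_imp_transversal)
    have sub: "om e \<subseteq> ball (pb e, 0) \<epsilon>1" "om e \<subseteq> ball (pb e, 0) \<epsilon>2" for e
    proof -
      have "om e \<subseteq> ball (pb e, 0) (min \<epsilon>1 \<epsilon>2)" using om_small by blast
      then show "om e \<subseteq> ball (pb e, 0) \<epsilon>1" "om e \<subseteq> ball (pb e, 0) \<epsilon>2"
        using subset_ball[of "min \<epsilon>1 \<epsilon>2" \<epsilon>1] subset_ball[of "min \<epsilon>1 \<epsilon>2" \<epsilon>2] by auto
    qed
    have small: "\<exists>B K c L \<epsilon>'. small_side A dd Us U pb wb k Om alpha R r om Phi zb ab B K c e L \<epsilon>'" for e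
    proof (cases e)
      case Pl
      have "R \<le> \<epsilon>1" using R by simp
      from \<epsilon>1(2)[unfolded good_def, rule_format, OF half_line_solutions_axioms this sub(1)] show ?thesis
        unfolding Pl .
    next
      case Mi
      have "R \<le> \<epsilon>2" using R by simp
      from \<epsilon>2(2)[unfolded good_def, rule_format, OF half_line_solutions_axioms this sub(2)] show ?thesis
        unfolding Mi .
    qed
    have "transversal q" using tr imp by blast
    then interpret regular_profile A dd Us U pb wb k Om alpha R r om Phi zb ab C af q
      by unfold_locales (rule q, assumption, rule small)
    show "(\<forall>\<R> F\<^sub>H. profile_manifold.corrector A dd wb Phi zb C af \<R> \<and>
            complementary F\<^sub>H (profile_manifold.F_P A dd wb Phi zb af \<R> q) \<longrightarrow>
            {dq. profile_manifold.Gamma_red A dd wb Phi zb af \<R> F\<^sub>H q dq = 0} = tangent_space C q) \<and>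
         tangent_space C q = profile_manifold.linearized_profile_states A dd wb Phi zb af q"
      using tangent_space_Gamma_red tangent_space_linearized by simp
  qed
  show ?thesis
  proof (rule exI[of _ "min \<epsilon>1 \<epsilon>2"], rule conjI)
    show "0 < min \<epsilon>1 \<epsilon>2" using \<epsilon>1(1) \<epsilon>2(1) by simp
  qed (intro allI impI ballI, elim conjE, rule conjI; rule impI, rule transversal_case; (assumption | rule disjI1, assumption | rule disjI2, assumption))
qed

end
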